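(* Let $\kappa$ be an infinite cardinal. If $\theta=\max\{\kappa,2^{\aleph_0}\}$, or $\theta=\lambda^{\nu(\lambda,\kappa)}$ for some infinite cardinal $\lambda\leq\kappa$, then there exist $2^\kappa$ incomparable pathwise connected, compact Hausdorff spaces of weight $\kappa$ and size $\theta$. For $\theta=2^{\aleph_0}$ it can be accomplished that all these spaces are first countable. Furthermore, if $\mu$ is an infinite cardinal with $\mu\leq\kappa$, then there exist $2^\kappa$ incomparable connected, compact Hausdorff spaces of weight $\kappa$ and size $\kappa^\mu$.
   Context: For infinite cardinals $\lambda\leq\kappa$, $\nu(\lambda,\kappa)$ denotes the smallest infinite cardinal $\mu$ such that $\lambda^\mu>\kappa$. The size of a space is the cardinality of its underlying set. Spaces $X_i$ $(i\in I)$ are called incomparable if $X_i$ is not homeomorphic to a subspace of $X_j$ whenever $i,j\in I$ and $i\neq j$. *)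

theory Defs
  imports "HOL-Analysis.Analysis"
begin

unbundle cardinal_syntax

section \<open>Cardinals\<close>

text \<open>
  Cardinals are cardinal orders (\<^const>\<open>Card_order\<close>) up to order isomorphism \<open>=o\<close>.  The cardinal
  \<open>max {r, s}\<close> cannot be formed with \<^const>\<open>max\<close> when \<open>r\<close> and \<open>s\<close> live on different types.
\<close>

definition is_card_max :: "'c rel \<Rightarrow> 'a rel \<Rightarrow> 'b rel \<Rightarrow> bool" where
  "is_card_max t r s \<longleftrightarrow> r \<le>o t \<and> s \<le>o t \<and> (t =o r \<or> t =o s)"

abbreviation continuum :: "(nat \<Rightarrow> bool) rel" where
  "continuum \<equiv> ctwo ^c natLeq"

text \<open>
  \<open>nu l k\<close> is the smallest infinite cardinal \<open>m\<close> with \<open>k < l ^ m\<close>.  It is at most \<open>k\<close>, so it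
  can be represented on the type carrying \<open>k\<close>; by \<open>nu_least\<close> below it is minimal among the
  cardinals on arbitrary types.
\<close>

definition nu :: "'l rel \<Rightarrow> 'k rel \<Rightarrow> 'k rel" where
  "nu l k = (SOME m. Cinfinite m \<and> k <o l ^c m \<and>
     (\<forall>m'::'k rel. Cinfinite m' \<and> k <o l ^c m' \<longrightarrow> m \<le>o m'))"

lemma nu_aux:
  fixes l :: "'l rel" and k :: "'k rel"
  assumes "Cinfinite l" "Cinfinite k"
  shows "Cinfinite (nu l k) \<and> k <o l ^c nu l k \<and>
     (\<forall>m'::'k rel. Cinfinite m' \<and> k <o l ^c m' \<longrightarrow> nu l k \<le>o m')"
proof -
  let ?R = "{m::'k rel. Cinfinite m \<and> k <o l ^c m}"
  have "k <o ctwo ^c k"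
    using assms by (simp add: ordLess_ctwo_cexp)
  also have "ctwo ^c k \<le>o l ^c k"
    using assms by (simp add: cexp_mono1 ctwo_ordLeq_Cinfinite)
  finally (ordLess_ordLeq_trans) have "k \<in> ?R"
    using assms by simp
  then have "\<exists>m\<in>?R. \<forall>m'\<in>?R. m \<le>o m'"
    by (intro exists_minim_Card_order) (auto simp: card_of_Card_order)
  then have "\<exists>m::'k rel. Cinfinite m \<and> k <o l ^c m \<and>
     (\<forall>m'::'k rel. Cinfinite m' \<and> k <o l ^c m' \<longrightarrow> m \<le>o m')"
    by blast
  then show ?thesis
    unfolding nu_def by (rule someI_ex)
qed

lemma
  fixes l :: "'l rel" and k :: "'k rel"
  assumes "Cinfinite l" "Cinfinite k"
  shows Cinfinite_nu: "Cinfinite (nu l k)"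
    and less_cexp_nu: "k <o l ^c nu l k"
  using nu_aux[OF assms] by auto

lemma nu_least:
  fixes l :: "'l rel" and k :: "'k rel" and m :: "'m rel"
  assumes l: "Cinfinite l" and k: "Cinfinite k" and m: "Cinfinite m" "k <o l ^c m"
  shows "nu l k \<le>o m"
proof (rule ccontr)
  have nu: "Cinfinite (nu l k)" using l k by (rule Cinfinite_nu)
  assume "\<not> nu l k \<le>o m"
  then have less: "m <o nu l k"
    using m nu by (meson card_order_on_well_order_on not_ordLeq_iff_ordLess)
  then have "|Field m| \<le>o |Field (nu l k)|"
    using card_of_mono2 ordLess_imp_ordLeq by blast
  then obtain f where f: "inj_on f (Field m)" "f ` Field m \<subseteq> Field (nu l k)"
    by (meson card_of_ordLeq)
  let ?m' = "|f ` Field m|"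
  have "|Field m| =o ?m'"
    using f card_of_ordIsoI inj_on_imp_bij_betw by blast
  then have eq: "m =o ?m'"
    using card_of_Field_ordIso m ordIso_symmetric ordIso_transitive by blast
  then have m': "Cinfinite ?m'"
    using m Cinfinite_cong by blast
  have "l ^c m =o l ^c ?m'"
    using eq l m m' by (intro cexp_cong2) auto
  then have "nu l k \<le>o ?m'"
    using nu_aux[OF l k] m' m(2) ordLess_ordIso_trans by blast
  then have "nu l k \<le>o m"
    using eq ordIso_symmetric ordLeq_ordIso_trans by blast
  with \<open>\<not> nu l k \<le>o m\<close> show False ..
qed

section \<open>Topological spaces\<close>

definition base_of :: "'a topology \<Rightarrow> 'a set set \<Rightarrow> bool" where
  "base_of X \<B> \<longleftrightarrow> openin X = arbitrary union_of (\<lambda>U. U \<in> \<B>)"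

text \<open>
  The weight is the least cardinality of a base.  (Some authors take its maximum with \<open>\<aleph>\<^sub>0\<close>; this
  makes no difference for infinite Hausdorff spaces, whose bases are all infinite.)
\<close>

definition weight :: "'a topology \<Rightarrow> 'a set rel" where
  "weight X = |SOME \<B>. base_of X \<B> \<and> (\<forall>\<C>. base_of X \<C> \<longrightarrow> |\<B>| \<le>o |\<C>| )|"

lemma weight:
  shows ex_base_weight: "\<exists>\<B>. base_of X \<B> \<and> weight X = |\<B>|"
    and weight_least: "base_of X \<C> \<Longrightarrow> weight X \<le>o |\<C>|"
proof -
  let ?R = "{|\<B>| |\<B>. base_of X \<B>}"
  have "base_of X {U. openin X U}"
    by (simp add: base_of_def openin_topology_base_unique) blast
  then have "\<exists>r\<in>?R. \<forall>r'\<in>?R. r \<le>o r'"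
    by (intro exists_minim_Card_order) (auto simp: card_of_Card_order)
  then have "\<exists>\<B>. base_of X \<B> \<and> (\<forall>\<C>. base_of X \<C> \<longrightarrow> |\<B>| \<le>o |\<C>| )"
    by blast
  then have *: "base_of X (SOME \<B>. base_of X \<B> \<and> (\<forall>\<C>. base_of X \<C> \<longrightarrow> |\<B>| \<le>o |\<C>| )) \<and>
      (\<forall>\<C>. base_of X \<C> \<longrightarrow> weight X \<le>o |\<C>| )"
    unfolding weight_def by (rule someI_ex)
  show "\<exists>\<B>. base_of X \<B> \<and> weight X = |\<B>|"
    using * unfolding weight_def by blast
  show "base_of X \<C> \<Longrightarrow> weight X \<le>o |\<C>|"
    using * by blast
qed

definition incomparable :: "'i set \<Rightarrow> ('i \<Rightarrow> 'a topology) \<Rightarrow> bool" where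
  "incomparable I X \<longleftrightarrow>
     (\<forall>i\<in>I. \<forall>j\<in>I. i \<noteq> j \<longrightarrow>
        \<not> (\<exists>S. S \<subseteq> topspace (X j) \<and> X i homeomorphic_space subtopology (X j) S))"

end

theory Submission
  imports Defs
begin

text \<open>
  The spaces are built so that an embedding between them induces an injective homomorphism between
  graphs, and the graphs are built so that such a homomorphism forces an inclusion between subsets of
  a set of size \<open>\<kappa>\<close>.  An antichain of \<open>2\<^sup>\<kappa>\<close> subsets then gives \<open>2\<^sup>\<kappa>\<close> incomparable spaces.

  \<^emph>\<open>From graphs to spaces.\<close>  The brick is the 2-sphere.  It stays connected when two points are removed,
  and an embedding of the sphere into itself is onto.  Given a graph on a vertex set \<open>V\<close>, add an apex
  adjacent to all vertices and replace every edge by a sphere whose two poles are the end points of the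
  edge.  With the topology in which the sphere joining \<open>x\<close> to \<open>y\<close> tends to the sphere joining \<open>x\<close> to the
  apex as \<open>y\<close> leaves every finite set, this is a compact space: it is the closed subset
  \<open>graph_space\<close> of a power of the sphere.  The open sphere of an edge is cut off by two points, so a
  sphere embedded in this space is the sphere of an edge (\<open>S2_image_is_edge_sphere\<close>).  Hence an
  embedding maps spheres to spheres, sends their intersection points to such points, and is a graph
  homomorphism (\<open>graph_space_embedding_imp_cone_hom\<close>).

  \<^emph>\<open>From subsets to graphs.\<close>  Take a well-order with a greatest element and fix for each point of
  cofinality \<open>\<omega>\<close> a cofinal \<open>\<omega>\<close>-sequence.  A strictly increasing self-map that preserves the indexed
  sequences is the identity (\<open>rigid\<close>): if it moved \<open>x\<close>, then the supremum of the orbit of \<open>x\<close> would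
  contradict the preservation of its sequence, as in Kunen's inconsistency theorem.  The order, the
  sequences and a subset \<open>A\<close> are coded by the edges of one graph, and an injective homomorphism
  from the graph of \<open>A\<close> to the graph of \<open>B\<close> gives \<open>A \<subseteq> B\<close> (\<open>cone_hom_imp_subset\<close>).

  \<^emph>\<open>Adjusting the size.\<close>  Such a graph space has \<open>max {\<kappa>, 2\<^sup>\<omega>}\<close> points.  For larger sizes and infinite \<open>\<lambda>, \<nu> \<le> \<kappa>\<close>, glue it
  at the vertex of the cone over the \<open>\<nu>\<close>-th power of the one-point compactification of a discrete space
  of size \<open>\<lambda>\<close>.  The cone is path connected, has weight at most \<open>\<kappa>\<close> and \<open>\<lambda>\<^sup>\<nu>\<close> points, and it contains no
  sphere because it falls apart into half-open segments when its vertex is removed.  This yields the sizes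
  \<open>\<lambda>\<^sup>\<nu>\<close> for \<open>\<nu> = \<nu>(\<lambda>, \<kappa>)\<close> and \<open>\<kappa>\<^sup>\<mu>\<close>; both families are path connected.

  \<^emph>\<open>First countability.\<close>  If the size is \<open>2\<^sup>\<omega>\<close>, then \<open>\<kappa> \<le> 2\<^sup>\<omega>\<close>.  There are \<open>2\<^sup>\<omega>\<close> incomparable graph spaces of
  countable weight.  Attach \<open>\<kappa>\<close> of them to distinct points of \<open>[0,1]\<close>, with the topology of an Alexandroff
  duplicate, in which pieces attached at points near \<open>t\<close> but different from \<open>t\<close> are close to \<open>t\<close>.  The result is
  first countable, and it remembers which pieces were attached.  The construction \<open>comb\<close> covers both this
  case and the cone with a single piece.
\<close>

section \<open>A rigid well-order\<close>

text \<open>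
  The greatest element guarantees suprema; they are needed to follow the orbits of increasing maps.
\<close>

locale topped_wellorder =
  fixes W :: "'w set" and less :: "'w \<Rightarrow> 'w \<Rightarrow> bool" (infix "\<sqsubset>" 50)
  assumes less_carrier: "x \<sqsubset> y \<Longrightarrow> x \<in> W \<and> y \<in> W"
    and irrefl: "\<not> x \<sqsubset> x"
    and trans: "x \<sqsubset> y \<Longrightarrow> y \<sqsubset> z \<Longrightarrow> x \<sqsubset> z"
    and ex_least: "S \<subseteq> W \<Longrightarrow> S \<noteq> {} \<Longrightarrow> \<exists>m\<in>S. \<forall>y\<in>S. m = y \<or> m \<sqsubset> y"
    and ex_top: "\<exists>t\<in>W. \<forall>x\<in>W. x = t \<or> x \<sqsubset> t"
    and infinite_carrier: "infinite W"
begin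

definition origin :: 'w where
  "origin = (SOME m. m \<in> W \<and> (\<forall>y\<in>W. m = y \<or> m \<sqsubset> y))"

lemma origin: "origin \<in> W" "y \<in> W \<Longrightarrow> y = origin \<or> origin \<sqsubset> y"
proof -
  have "\<exists>m. m \<in> W \<and> (\<forall>y\<in>W. m = y \<or> m \<sqsubset> y)"
    using ex_least[of W] infinite_carrier by auto
  then have "origin \<in> W \<and> (\<forall>y\<in>W. origin = y \<or> origin \<sqsubset> y)"
    unfolding origin_def by (rule someI_ex)
  then show "origin \<in> W" "y \<in> W \<Longrightarrow> y = origin \<or> origin \<sqsubset> y" by auto
qed

lemma linear: "x \<in> W \<Longrightarrow> y \<in> W \<Longrightarrow> x \<sqsubset> y \<or> x = y \<or> y \<sqsubset> x"
  using ex_least[of "{x, y}"] by auto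

lemma asym: "x \<sqsubset> y \<Longrightarrow> \<not> y \<sqsubset> x"
  using irrefl trans by blast

text \<open>
  A ladder to \<open>d\<close> is a cofinal \<open>\<omega>\<close>-sequence below \<open>d\<close>.  It avoids the least element because the code
  graphs below use the edges that end in the ray of the least element for another purpose.
\<close>

definition is_ladder :: "'w \<Rightarrow> (nat \<Rightarrow> 'w) \<Rightarrow> bool" where
  "is_ladder d s \<longleftrightarrow> (\<forall>i. origin \<sqsubset> s i \<and> s i \<sqsubset> s (Suc i) \<and> s i \<sqsubset> d) \<and> (\<forall>y. y \<sqsubset> d \<longrightarrow> (\<exists>i. y \<sqsubset> s i))"

definition rung :: "'w \<Rightarrow> nat \<Rightarrow> 'w \<Rightarrow> bool" where
  "rung d i a \<longleftrightarrow> (\<exists>s. is_ladder d s) \<and> a = (SOME s. is_ladder d s) i"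

lemma rung_ladder:
  assumes "rung d i a"
  obtains s where "is_ladder d s" "\<And>j b. rung d j b \<longleftrightarrow> b = s j"
proof
  show "is_ladder d (SOME s. is_ladder d s)"
    using assms unfolding rung_def by (metis someI_ex)
  show "\<And>j b. rung d j b \<longleftrightarrow> b = (SOME s. is_ladder d s) j"
    using assms unfolding rung_def by auto
qed

lemma ladder_strict: "is_ladder d s \<Longrightarrow> i < j \<Longrightarrow> s i \<sqsubset> s j"
  by (induction j) (auto simp: is_ladder_def less_Suc_eq intro: trans)

lemma rung_unique:
  assumes "rung d i a" "rung d j a" shows "i = j"
proof -
  obtain s where s: "is_ladder d s" "\<And>j b. rung d j b \<longleftrightarrow> b = s j"
    using assms(1) by (rule rung_ladder) blast
  then show ?thesis using assms ladder_strict[OF s(1)] irrefl by (metis nat_neq_iff)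
qed

lemma rung_less:
  assumes "rung d i a" shows "origin \<sqsubset> a" "a \<sqsubset> d"
proof -
  obtain s where "is_ladder d s" "\<And>j b. rung d j b \<longleftrightarrow> b = s j"
    using assms by (rule rung_ladder) blast
  then show "origin \<sqsubset> a" "a \<sqsubset> d" using assms by (auto simp: is_ladder_def)
qed

text \<open>
  Suppose that \<open>f\<close> moves \<open>x\<close>.  As \<open>f\<close> is increasing, the orbit of \<open>x\<close> is an increasing sequence; let \<open>d\<close> be
  its supremum.  Then \<open>f\<close> maps everything below \<open>d\<close> below \<open>d\<close>, but it also maps the ladder of \<open>d\<close> to the ladder of
  \<open>f d\<close>, so that \<open>f d = d\<close>.  As the index of a rung is preserved, the rungs are fixed points cofinal in \<open>d\<close>, and
  the orbit of \<open>x\<close> cannot get past the first of them that lies above \<open>x\<close>.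
\<close>

lemma rigid:
  assumes mono: "\<And>x y. x \<sqsubset> y \<Longrightarrow> f x \<sqsubset> f y"
    and rung: "\<And>d i a. rung d i a \<Longrightarrow> rung (f d) i (f a)"
    and "x \<in> W"
  shows "f x = x"
proof (rule ccontr)
  assume neq: "f x \<noteq> x"
  have fW: "f y \<in> W" if "y \<in> W" for y
  proof -
    obtain z where "z \<in> W" "z \<noteq> y"
      using infinite_carrier by (metis finite.emptyI finite.insertI finite_subset insertCI subsetI)
    then show ?thesis using linear[OF that, of z] mono less_carrier by metis
  qed
  have infl: "f y = y \<or> y \<sqsubset> f y" if y: "y \<in> W" for y
  proof (rule ccontr)
    assume "\<not> ?thesis"
    then have "{y\<in>W. f y \<sqsubset> y} \<noteq> {}" using y fW linear by blast
    then obtain m where m: "m \<in> W" "f m \<sqsubset> m" "\<And>y. y \<in> W \<Longrightarrow> f y \<sqsubset> y \<Longrightarrow> m = y \<or> m \<sqsubset> y"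
      using ex_least[of "{y\<in>W. f y \<sqsubset> y}"] by blast
    have "f (f m) \<sqsubset> f m" using m(2) mono by blast
    then show False using m(2) m(3)[of "f m"] fW m(1) irrefl asym by metis
  qed
  define X where "X n = (f ^^ n) x" for n
  have XW: "X n \<in> W" for n by (induction n) (auto simp: X_def \<open>x \<in> W\<close> fW)
  have X_Suc: "f (X n) = X (Suc n)" for n by (simp add: X_def)
  have step: "X n \<sqsubset> X (Suc n)" for n
    by (induction n) (use neq infl[OF \<open>x \<in> W\<close>] mono in \<open>auto simp: X_def\<close>)
  \<comment> \<open>\<open>d\<close> is the supremum of the orbit of \<open>x\<close>\<close>
  obtain d where d: "d \<in> W" "\<And>n. X n \<sqsubset> d" and least: "\<And>e. e \<in> W \<Longrightarrow> (\<And>n. X n \<sqsubset> e) \<Longrightarrow> d = e \<or> d \<sqsubset> e"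
  proof -
    obtain t where t: "t \<in> W" "\<And>x. x \<in> W \<Longrightarrow> x = t \<or> x \<sqsubset> t" using ex_top by blast
    have "X n \<sqsubset> t" for n using t(2)[OF XW[of n]] t(2)[OF XW[of "Suc n"]] step[of n] asym by metis
    then have "{e\<in>W. \<forall>n. X n \<sqsubset> e} \<noteq> {}" using t(1) by blast
    then show thesis using ex_least[of "{e\<in>W. \<forall>n. X n \<sqsubset> e}"] that by blast
  qed
  have below: "\<exists>n. y \<sqsubset> X n" if "y \<sqsubset> d" for y
  proof (rule ccontr)
    assume "\<not> (\<exists>n. y \<sqsubset> X n)"
    then have "X n = y \<or> X n \<sqsubset> y" for n using linear XW that less_carrier by metis
    then have "X n \<sqsubset> y" for n using step[of n] irrefl[of y] asym by metis
    then show False using least[of y] that less_carrier asym irrefl by metis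
  qed
  have "is_ladder d (\<lambda>n. X (Suc n))"
    unfolding is_ladder_def using d(2) step below origin(2)[OF XW] trans
    by (metis XW asym irrefl)
  then have ex: "rung d 0 ((SOME s. is_ladder d s) 0)" unfolding rung_def by blast
  then obtain s where s: "is_ladder d s" "\<And>j b. rung d j b \<longleftrightarrow> b = s j" by (rule rung_ladder) blast
  have "rung (f d) 0 (f (s 0))" using rung s(2) by blast
  then obtain s' where s': "is_ladder (f d) s'" "\<And>j b. rung (f d) j b \<longleftrightarrow> b = s' j" by (rule rung_ladder) blast
  have fs: "f (s i) = s' i" for i using rung[of d i "s i"] s(2) s'(2) by blast
  have bounded: "f (s i) \<sqsubset> d" for i
  proof -
    obtain n where "s i \<sqsubset> X n" using below s(1) unfolding is_ladder_def by blast
    then show ?thesis using mono[of "s i" "X n"] X_Suc d(2) trans by metis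
  qed
  from infl[OF d(1)] show False
  proof
    assume "d \<sqsubset> f d"
    then obtain i where "d \<sqsubset> s' i" using s'(1) unfolding is_ladder_def by blast
    then show False using bounded[of i] fs asym by metis
  next
    assume "f d = d"
    then have fix_s: "f (s i) = s i" for i using fs s(2) s'(2) by metis
    obtain i where i: "X 0 \<sqsubset> s i" using d(2) s(1) unfolding is_ladder_def by blast
    have "X n \<sqsubset> s i" for n
      by (induction n) (use i mono fix_s X_Suc in \<open>metis+\<close>)
    then show False using least[of "s i"] s(1) less_carrier asym irrefl unfolding is_ladder_def by metis
  qed
qed

end

text \<open>
  Move an arbitrary element of a well-ordered set to the top.
\<close>

lemma ex_topped_wellorder:
  assumes "infinite (W::'w set)"
  shows "\<exists>less. topped_wellorder W less"
proof -
  obtain r where r: "well_order_on W r" using well_order_on by blast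
  obtain a where a: "a \<in> W" using assms by fastforce
  have refl: "refl_on W r" and trans: "trans r" and antisym: "antisym r" and total: "total_on W r" and wf: "wf (r - Id)"
    using r unfolding well_order_on_def linear_order_on_def partial_order_on_def preorder_on_def by blast+
  let ?less = "\<lambda>x y. x \<in> W \<and> y \<in> W \<and> x \<noteq> a \<and> x \<noteq> y \<and> (y = a \<or> (x, y) \<in> r)"
  have "topped_wellorder W ?less"
  proof
    fix x y z assume "?less x y" "?less y z"
    then show "?less x z" using transD[OF trans] antisymD[OF antisym] by metis
  next
    fix S assume S: "S \<subseteq> W" "S \<noteq> {}"
    show "\<exists>m\<in>S. \<forall>y\<in>S. m = y \<or> ?less m y"
    proof (cases "S - {a} = {}")
      case True
      then show ?thesis using S by blast
    next
      case False
      then obtain m where m: "m \<in> S - {a}" "\<And>y. (y, m) \<in> r - Id \<Longrightarrow> y \<notin> S - {a}"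
        using wfE_min'[OF wf False] by blast
      have "m = y \<or> ?less m y" if "y \<in> S" for y
      proof (cases "y = a \<or> y = m")
        case True
        then show ?thesis using m(1) S(1) a by blast
      next
        case False
        then have "(y, m) \<notin> r" using m(2)[of y] that by blast
        then have "(m, y) \<in> r" using total that m(1) S(1) False unfolding total_on_def by blast
        then show ?thesis using m(1) S(1) that by blast
      qed
      then show ?thesis using m(1) by blast
    qed
  next
    show "\<exists>t\<in>W. \<forall>x\<in>W. x = t \<or> ?less x t" using a by blast
  qed (use assms in auto)
  then show ?thesis by blast
qed

section \<open>Graphs coding subsets of a well-order\<close>

text \<open>
  The graph with an added apex \<open>None\<close> that is adjacent to all vertices.
\<close>

fun cone_adj :: "('v \<Rightarrow> 'v \<Rightarrow> bool) \<Rightarrow> 'v set \<Rightarrow> 'v option \<Rightarrow> 'v option \<Rightarrow> bool" where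
  "cone_adj R V (Some x) (Some y) \<longleftrightarrow> R x y"
| "cone_adj R V (Some x) None \<longleftrightarrow> x \<in> V"
| "cone_adj R V None (Some y) \<longleftrightarrow> y \<in> V"
| "cone_adj R V None None \<longleftrightarrow> False"

text \<open>
  The adjacency relation of the square of the one-way infinite path.  Its triangles are the triples of
  consecutive numbers, and any two successive triangles share an edge, which makes the graph stiff.
\<close>

definition near :: "nat \<Rightarrow> nat \<Rightarrow> bool" where
  "near a b \<longleftrightarrow> b = a + 1 \<or> b = a + 2 \<or> a = b + 1 \<or> a = b + 2"

lemma near_triple:
  assumes "near a b" "near b c" "near a c"
  shows "(b = a + 1 \<and> c = a + 2) \<or> (b = a + 2 \<and> c = a + 1) \<or> (a = b + 1 \<and> c = b + 2) \<or>
    (a = b + 2 \<and> c = b + 1) \<or> (a = c + 1 \<and> b = c + 2) \<or> (b = c + 1 \<and> a = c + 2)"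
  using assms(1) unfolding near_def[of a b]
  apply (elim disjE)
  subgoal using assms(2) unfolding near_def[of b] apply (elim disjE) using assms(3) unfolding near_def by auto
  subgoal using assms(2) unfolding near_def[of b] apply (elim disjE) using assms(3) unfolding near_def by auto
  subgoal using assms(2) unfolding near_def[of b] apply (elim disjE) using assms(3) unfolding near_def by auto
  subgoal using assms(2) unfolding near_def[of b] apply (elim disjE) using assms(3) unfolding near_def by auto
  done

text \<open>
  Two vertices of a triangle determine where a further triangle on them can go; the second and the
  last case are folded images, which cannot be continued for another step.
\<close>

lemma near_extend:
  assumes "near a b" "near b c" "near a c" "near b d" "near c d" "a \<noteq> d"
  shows "(b = a + 1 \<and> c = a + 2 \<and> d = a + 3) \<or> (c = a + 1 \<and> b = a + 2 \<and> d = a + 3) \<or>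
    (b = c + 1 \<and> a = c + 2 \<and> c = d + 1) \<or> (a = c + 1 \<and> c = b + 1 \<and> b = d + 1)"
  using near_triple[OF assms(1-3)] 
  apply (elim disjE conjE)
  subgoal using assms(4,5,6) unfolding near_def by auto
  subgoal using assms(4,5,6) unfolding near_def by auto
  subgoal using assms(4,5,6) unfolding near_def by auto
  subgoal using assms(4,5,6) unfolding near_def by auto
  subgoal using assms(4,5,6) unfolding near_def by auto
  subgoal using assms(4,5,6) unfolding near_def by auto
  done
lemma near_no_K4:
  assumes "near a b" "near a c" "near a d" "near b c" "near b d" "near c d"
  shows False
proof -
  have "a \<noteq> d" using assms(3) by (auto simp: near_def)
  from near_extend[OF assms(1,4,2,5,6) this] show False
    by (elim disjE conjE) (use assms(3) in \<open>simp_all add: near_def\<close>)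
qed

lemma near_sym: "near a b \<Longrightarrow> near b a"
  unfolding near_def by auto

text \<open>
  Four consecutive vertices may still be folded, but five may not; so the image of the path runs
  monotonically, and it cannot run downwards forever.
\<close>

lemma ray_embedding_is_shift:
  fixes k :: "nat \<Rightarrow> nat"
  assumes inj: "inj k" and hom: "\<And>i j. near i j \<Longrightarrow> near (k i) (k j)"
  shows "k i = k 0 + i"
proof -
  have nr: "near (k i) (k (i+1))" "near (k i) (k (i+2))" for i
    by (rule hom, simp add: near_def)+
  have ne: "k i \<noteq> k (i+3)" for i using inj by (simp add: inj_eq)
  have step: "(k (i+1) = k i + 1 \<and> k (i+2) = k (i+1) + 1) \<or> (k i = k (i+1) + 1 \<and> k (i+1) = k (i+2) + 1)" for i
    using near_extend[of "k i" "k (i+1)" "k (i+2)" "k (i+3)"]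
      near_extend[of "k (i+1)" "k (i+2)" "k (i+3)" "k (i+4)"]
      nr[of i] nr[of "i+1"] nr[of "i+2"] nr[of "i+3"] ne[of i] ne[of "i+1"]
    by (simp add: numeral_eq_Suc) linarith
  have up: "k 1 = k 0 + 1"
  proof (rule ccontr)
    assume "k 1 \<noteq> k 0 + 1"
    then have down: "k i = k (i+1) + 1" for i
    proof (induction i)
      case 0 then show ?case using step[of 0] by simp
    next
      case (Suc i) then show ?case using step[of i] by simp
    qed
    have "k i + i = k 0" for i
    proof (induction i)
      case (Suc i) then show ?case using down[of i] by simp
    qed simp
    then have "k (Suc (k 0)) + Suc (k 0) = k 0" .
    then show False by simp
  qed
  have Suc_k: "k (i+1) = k i + 1" for i
  proof (induction i)
    case 0 then show ?case using up by simp
  next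
    case (Suc i) then show ?case using step[of i] by simp
  qed
  show ?thesis
  proof (induction i)
    case (Suc i) then show ?case using Suc_k[of i] by simp
  qed simp
qed

context topped_wellorder
begin

text \<open>
  The indices \<open>k\<close> for which vertex \<open>0\<close> of the ray of \<open>v\<close> is joined to vertex \<open>k\<close> of the ray of a smaller \<open>w\<close>:
  index 1 codes the order, indices from 4 on code the ladder of \<open>v\<close>, and the ladder-free ray of the least element
  is used to code membership in \<open>A\<close>.  Indices 1 and at least 4 are not adjacent in a ray.
\<close>

definition cross_label :: "'w set \<Rightarrow> 'w \<Rightarrow> 'w \<Rightarrow> nat \<Rightarrow> bool" where
  "cross_label A v w k \<longleftrightarrow> w \<sqsubset> v \<and> (k = 1 \<or> (4 \<le> k \<and> rung v (k - 4) w) \<or> (k = 4 \<and> w = origin \<and> v \<in> A))"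

text \<open>
  Every element of \<open>W\<close> is replaced by a ray \<open>{w} \<times> \<nat>\<close> carrying the square of a path.
\<close>

definition code_graph :: "'w set \<Rightarrow> 'w \<times> nat \<Rightarrow> 'w \<times> nat \<Rightarrow> bool" where
  "code_graph A x y \<longleftrightarrow>
     (fst x = fst y \<and> fst x \<in> W \<and> near (snd x) (snd y)) \<or>
     (snd x = 0 \<and> cross_label A (fst x) (fst y) (snd y)) \<or> (snd y = 0 \<and> cross_label A (fst y) (fst x) (snd x))"

lemma code_graph_sym: "code_graph A x y \<Longrightarrow> code_graph A y x"
  unfolding code_graph_def using near_sym by auto

lemma code_graph_irrefl: "\<not> code_graph A x x"
  unfolding code_graph_def cross_label_def near_def using irrefl by auto

lemma code_graph_carrier: "code_graph A x y \<Longrightarrow> x \<in> W \<times> UNIV \<and> y \<in> W \<times> UNIV"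
  unfolding code_graph_def cross_label_def using less_carrier by (cases x, cases y) auto

lemma cross_label_pos: "cross_label A v w k \<Longrightarrow> 0 < k"
  unfolding cross_label_def by auto

lemma cross_label_spread:
  assumes "cross_label A v w k" "cross_label A v w l" "k \<noteq> l"
  shows "(k = 1 \<and> 4 \<le> l) \<or> (4 \<le> k \<and> l = 1)"
proof -
  have no: "\<not> rung v i origin" for i using rung_less(1) irrefl by blast
  have same: "i = 4 + (j - 4)" if "rung v (i - 4) w" "rung v (j - 4) w" "4 \<le> i" for i j
    using rung_unique[OF that(1,2)] that(3) by simp
  from assms(1,2) show ?thesis unfolding cross_label_def
    using assms(3) no same[of k l] by auto
qed

lemma code_graph_same_ray:
  "code_graph A u v \<Longrightarrow> fst u = fst v \<Longrightarrow> near (snd u) (snd v)"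
  using irrefl unfolding code_graph_def cross_label_def by auto

lemma code_graph_cross:
  "code_graph A u v \<Longrightarrow> fst u \<noteq> fst v \<Longrightarrow>
     (snd u = 0 \<and> cross_label A (fst u) (fst v) (snd v)) \<or> (snd v = 0 \<and> cross_label A (fst v) (fst u) (snd u))"
  unfolding code_graph_def by auto

text \<open>
  Triangles identify the rays.  An edge between different rays joins an index 0 to a positive index, so
  three rays cannot contribute a vertex each, and two vertices of one ray joined to the same vertex of
  another ray carry labels that are too far apart to be adjacent.
\<close>

lemma triangle_in_ray:
  assumes xyz: "code_graph A x y" "code_graph A y z" "code_graph A x z"
  shows "fst x = fst y"
proof (rule ccontr)
  assume neq: "fst x \<noteq> fst y"
  have no_mixed: False if "code_graph A u v" "code_graph A u w" "code_graph A v w" "fst v = fst w" "fst u \<noteq> fst v" for u v w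
  proof -
    note vw = code_graph_same_ray[OF that(3,4)]
    from code_graph_cross[OF that(1,5)] show False
    proof
      assume uv: "snd u = 0 \<and> cross_label A (fst u) (fst v) (snd v)"
      then have "cross_label A (fst u) (fst v) (snd w)"
        using code_graph_cross[OF that(2)] that(4,5) cross_label_pos by fastforce
      with uv vw cross_label_spread[of A "fst u" "fst v" "snd v" "snd w"] show False by (auto simp: near_def)
    next
      assume uv: "snd v = 0 \<and> cross_label A (fst v) (fst u) (snd u)"
      then have "snd u \<noteq> 0" using cross_label_pos by blast
      then have "snd w = 0" using code_graph_cross[OF that(2)] that(4,5) by auto
      with uv vw show False by (simp add: near_def)
    qed
  qed
  have parity: "(snd u = 0) \<noteq> (snd v = 0)" if "code_graph A u v" "fst u \<noteq> fst v" for u v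
    using code_graph_cross[OF that] cross_label_pos by fastforce
  consider "fst z = fst y" | "fst z = fst x" | "fst z \<noteq> fst x" "fst z \<noteq> fst y" by blast
  then show False
  proof cases
    case 1 then show False using no_mixed[of x y z] xyz neq by auto
  next
    case 2 then show False using no_mixed[of y x z] xyz neq code_graph_sym by auto
  next
    case 3 then show False using parity[OF xyz(1)] parity[OF xyz(2)] parity[OF xyz(3)] neq by metis
  qed
qed

lemma no_K4:
  assumes "code_graph A x y" "code_graph A x z" "code_graph A x u" "code_graph A y z" "code_graph A y u" "code_graph A z u"
  shows False
proof -
  have "fst x = fst y" "fst y = fst z" "fst z = fst u"
    using triangle_in_ray assms code_graph_sym by blast+
  then have "near (snd x) (snd y)" "near (snd x) (snd z)" "near (snd x) (snd u)"
    "near (snd y) (snd z)" "near (snd y) (snd u)" "near (snd z) (snd u)"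
    using assms code_graph_same_ray by metis+
  then show False
    using near_no_K4 by blast
qed

text \<open>
  A triangle together with the apex is a 4-clique, and there are no others; so the apex is fixed.  Since
  triangles stay inside rays, every ray is mapped to a ray by a shift.  An edge between rays
  has index 0 at its larger end and a positive index at the other one; hence there is no shift at all, except
  possibly in the least ray, the induced map on \<open>W\<close> is increasing and it preserves ladders.  By rigidity it is
  the identity, and the edges coding \<open>A\<close> are edges coding \<open>B\<close>.
\<close>

lemma cone_hom_imp_subset:
  fixes g :: "('w \<times> nat) option \<Rightarrow> ('w \<times> nat) option"
  assumes inj: "inj_on g (insert None (Some ` (W \<times> UNIV)))"
    and hom: "\<And>a b. cone_adj (code_graph A) (W \<times> UNIV) a b \<Longrightarrow> cone_adj (code_graph B) (W \<times> UNIV) (g a) (g b)"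
    and A: "origin \<notin> A" "A \<subseteq> W"
  shows "A \<subseteq> B"
proof -
  let ?V = "W \<times> (UNIV::nat set)"
  have ray: "code_graph C (w, i) (w, j)" if "w \<in> W" "near i j" for C w i j
    using that unfolding code_graph_def by auto
  have inj': "a = b" if "g a = g b" "a \<in> insert None (Some ` ?V)" "b \<in> insert None (Some ` ?V)" for a b
    using inj that by (meson inj_onD)
  \<comment> \<open>A triangle and the apex form a 4-clique, whose image has to contain the apex.\<close>
  have apex_hit: "\<exists>a\<in>{None, Some (origin, i), Some (origin, i+1), Some (origin, i+2)}. g a = None" for i
  proof (rule ccontr)
    assume "\<not> ?thesis"
    then obtain x y z u where xyzu: "g None = Some x" "g (Some (origin, i)) = Some y"
      "g (Some (origin, i+1)) = Some z" "g (Some (origin, i+2)) = Some u"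
      by (metis insert_iff not_None_eq)
    have "code_graph A (origin, i) (origin, i+1)" "code_graph A (origin, i) (origin, i+2)"
      "code_graph A (origin, i+1) (origin, i+2)"
      by (rule ray; simp add: origin(1) near_def)+
    then show False
      using hom[of None "Some (origin, i)"] hom[of None "Some (origin, i+1)"] hom[of None "Some (origin, i+2)"]
        hom[of "Some (origin, i)" "Some (origin, i+1)"] hom[of "Some (origin, i)" "Some (origin, i+2)"]
        hom[of "Some (origin, i+1)" "Some (origin, i+2)"] no_K4[of B x y z u]
      unfolding xyzu cone_adj.simps using origin(1) by blast
  qed
  \<comment> \<open>Two disjoint triangles: the apex is the only vertex common to both cliques.\<close>
  have apex: "g None = None"
  proof -
    obtain a b where a: "a\<in>{None, Some (origin, 0), Some (origin, 1), Some (origin, 2)}" "g a = None"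
      and b: "b\<in>{None, Some (origin, 3), Some (origin, 4), Some (origin, 5)}" "g b = None"
      using apex_hit[of 0] apex_hit[of 3] by (auto simp: eval_nat_numeral)
    have "a = b" using inj'[of a b] a b origin(1) by auto
    then show ?thesis using a b by auto
  qed
  define h where "h x = the (g (Some x))" for x
  have gh: "g (Some x) = Some (h x)" if "x \<in> ?V" for x
    using inj'[of "Some x" None] apex that by (cases "g (Some x)") (auto simp: h_def)
  have h_inj: "x = y" if "h x = h y" "x \<in> ?V" "y \<in> ?V" for x y
    using inj'[of "Some x" "Some y"] that gh by auto
  have h_hom: "code_graph B (h x) (h y)" if "code_graph A x y" for x y
    using hom[of "Some x" "Some y"] that gh code_graph_carrier[OF that] by auto
  have h_ray: "code_graph B (h (w, i)) (h (w, j))" if "w \<in> W" "near i j" for w i j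
    using h_hom ray that by blast
  define f where "f w = fst (h (w, 0))" for w
  define n where "n w = snd (h (w, 0))" for w
  have fst_h: "fst (h (w, i)) = f w" if w: "w \<in> W" for w i
  proof (induction i)
    case (Suc i)
    have "fst (h (w, i)) = fst (h (w, Suc i))"
      by (rule triangle_in_ray[of B _ _ "h (w, i+2)"]; rule h_ray; use w in \<open>simp add: near_def\<close>)
    with Suc show ?case by simp
  qed (simp add: f_def)
  have snd_h: "snd (h (w, i)) = n w + i" if w: "w \<in> W" for w i
  proof -
    have "snd (h (w, i)) = snd (h (w, 0)) + i"
    proof (rule ray_embedding_is_shift[of "\<lambda>i. snd (h (w, i))"])
      show "inj (\<lambda>i. snd (h (w, i)))"
        using h_inj[of "(w, _)" "(w, _)"] fst_h[OF w] w by (auto simp: inj_on_def prod_eq_iff)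
      fix i j :: nat
      assume "near i j"
      then show "near (snd (h (w, i))) (snd (h (w, j)))"
        using code_graph_same_ray[OF h_ray[OF w]] fst_h[OF w] by simp
    qed
    then show ?thesis by (simp add: n_def)
  qed
  have h: "h (w, i) = (f w, n w + i)" if "w \<in> W" for w i
    using fst_h[OF that] snd_h[OF that] by (simp add: prod_eq_iff)
  have f_inj: "v = w" if "f v = f w" "v \<in> W" "w \<in> W" for v w
    using h_inj[of "(v, n w)" "(w, n v)"] that h by auto
  \<comment> \<open>In the image, the end in the ray of \<open>f w\<close> has the positive index \<open>n w + k\<close>, so the other end has index 0.\<close>
  have cross: "n v = 0 \<and> cross_label B (f v) (f w) (n w + k)" if "cross_label A v w k" for v w k
  proof -
    have "w \<sqsubset> v" "0 < k" using that cross_label_pos unfolding cross_label_def by auto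
    then have W: "v \<in> W" "w \<in> W" "f v \<noteq> f w" using less_carrier f_inj irrefl by blast+
    have "code_graph A (v, 0) (w, k)" using that unfolding code_graph_def by simp
    then have "code_graph B (f v, n v) (f w, n w + k)" using h_hom h W by fastforce
    then show ?thesis using \<open>0 < k\<close> W unfolding code_graph_def by auto
  qed
  have f_mono: "f w \<sqsubset> f v" if "w \<sqsubset> v" for v w
    using cross[of v w 1] that unfolding cross_label_def by simp
  have n0: "n v = 0" if "v \<in> W" "v \<noteq> origin" for v
    using cross[of v origin 1] origin(2)[OF that(1)] that(2) unfolding cross_label_def by simp
  have f_id: "f w = w" if "w \<in> W" for w
  proof (rule rigid[OF _ _ that])
    fix d i a assume r: "rung d i a"
    then have a: "origin \<sqsubset> a" "a \<sqsubset> d" by (rule rung_less)+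
    have "n a = 0" using n0 a(1) less_carrier irrefl by blast
    moreover have "f a \<noteq> origin"
      using f_mono[OF a(1)] origin(2) less_carrier asym by metis
    moreover have "cross_label A d a (4 + i)" using r a unfolding cross_label_def by simp
    ultimately show "rung (f d) i (f a)" using cross[of d a "4 + i"] unfolding cross_label_def by auto
  qed (rule f_mono)
  show "A \<subseteq> B"
  proof
    fix v assume v: "v \<in> A"
    then have "v \<in> W" "v \<noteq> origin" using A by auto
    then have "cross_label A v origin 4" using v origin(2) unfolding cross_label_def by auto
    then have "cross_label B v origin (n origin + 4)" using cross[of v origin 4] f_id \<open>v \<in> W\<close> origin(1) by simp
    moreover have "\<not> rung v (n origin) origin" using rung_less(1) irrefl by blast
    ultimately show "v \<in> B" unfolding cross_label_def by auto
  qed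
qed

end
section \<open>The 2-sphere as a building block\<close>

definition S2 :: "(real^3) set" where
  "S2 = sphere 0 1"

lemma compact_S2: "compact S2" and path_connected_S2: "path_connected S2" and zero_notin_S2: "0 \<notin> S2"
  unfolding S2_def by (auto simp: path_connected_sphere)

lemma S2_uminus [simp]: "- e \<in> S2 \<longleftrightarrow> e \<in> S2"
  by (simp add: S2_def)

definition pole :: "real^3" where
  "pole = axis 1 1"

lemma pole_in_S2 [simp]: "pole \<in> S2"
  by (auto simp: pole_def S2_def)

lemma S2_antipodal: "e \<in> S2 \<Longrightarrow> e \<noteq> - e"
proof
  assume "e \<in> S2" "e = - e"
  then have "2 *\<^sub>R e = 0" by (simp add: scaleR_2 eq_neg_iff_add_eq_0)
  then show False using \<open>e \<in> S2\<close> zero_notin_S2 by simp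
qed

lemma pole_neq [simp]: "pole \<noteq> - pole" "- pole \<noteq> pole"
  using S2_antipodal[OF pole_in_S2] by metis+

lemma S2_third_point: "\<exists>e\<in>S2. e \<noteq> pole \<and> e \<noteq> - pole"
proof -
  have "axis 2 1 \<in> S2" by (simp add: S2_def)
  moreover have "axis 2 1 \<noteq> pole" unfolding pole_def by (simp add: axis_eq_axis)
  moreover have "(axis 2 1 :: real^3) $ 2 \<noteq> (- pole) $ 2" unfolding pole_def by (simp add: axis_def)
  ultimately show ?thesis by metis
qed

text \<open>
  Stereographic projection from one point reduces this to a plane with a point removed.
\<close>

lemma connected_S2_minus_two: "connected (S2 - {a, b})"
proof -
  have one: "connected (S2 - {c} - {d})" if c: "c \<in> S2" for c d
  proof -
    let ?H = "{x::real^3. axis 1 1 \<bullet> x = 0}"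
    have "(axis 1 1 :: real^3) \<noteq> 0" by (simp add: axis_eq_0_iff)
    then obtain g h where gh: "homeomorphism (S2 - {c}) ?H g h"
      using homeomorphic_punctured_sphere_hyperplane[OF zero_less_one c[unfolded S2_def], of "axis 1 1" 0]
      unfolding homeomorphic_def S2_def by blast
    have "aff_dim ?H = 2"
      using \<open>axis 1 1 \<noteq> (0::real^3)\<close> by (subst aff_dim_hyperplane) auto
    moreover have "convex ?H" by (rule convex_hyperplane)
    ultimately have H: "connected (?H - {y})" for y
      by (intro connected_punctured_convex) auto
    show ?thesis
    proof (cases "d \<in> S2 - {c}")
      case True
      have hH: "h ` ?H = S2 - {c}" "g d \<in> ?H" "h (g d) = d" and gh': "\<And>z. z \<in> ?H \<Longrightarrow> g (h z) = z"
        using gh True unfolding homeomorphism_def by blast+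
      have "inj_on h ?H" using gh' by (rule inj_on_inverseI)
      then have "S2 - {c} - {d} = h ` (?H - {g d})"
        using hH inj_on_image_set_diff[of h ?H ?H "{g d}"] by auto
      moreover have "continuous_on (?H - {g d}) h"
        using gh unfolding homeomorphism_def by (meson Diff_subset continuous_on_subset)
      ultimately show ?thesis using connected_continuous_image H by metis
    next
      case False
      then have "S2 - {c} - {d} = h ` ?H" using gh unfolding homeomorphism_def by blast
      then show ?thesis
        using gh connected_continuous_image[of ?H h] convex_connected[OF \<open>convex ?H\<close>]
        unfolding homeomorphism_def by metis
    qed
  qed
  consider "a \<in> S2" | "b \<in> S2" | "a \<notin> S2" "b \<notin> S2" by blast
  then show ?thesis
  proof cases
    case 1 then show ?thesis using one[of a b] Diff_insert2[of S2 a "{b}"] by metis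
  next
    case 2 then show ?thesis using one[of b a] Diff_insert[of S2 a "{b}"] by metis
  next
    case 3
    then have "S2 - {a, b} = S2" by blast
    then show ?thesis by (simp add: path_connected_imp_connected path_connected_S2)
  qed
qed

lemma connected_S2_minus_one: "connected (S2 - {a})"
  using connected_S2_minus_two[of a a] by simp

text \<open>
  If the image missed a point, stereographic projection from that point would embed the sphere in a plane; by
  invariance of domain the image would be open there and, being compact, it would be the whole plane, so that a
  sphere minus a point would be compact.
\<close>

lemma S2_self_embedding_onto:
  assumes cont: "continuous_on S2 f" and inj: "inj_on f S2" and im: "f ` S2 \<subseteq> S2"
  shows "f ` S2 = S2"
proof (rule ccontr)
  assume "f ` S2 \<noteq> S2"
  then obtain y where y: "y \<in> S2" "y \<notin> f ` S2" using im by blast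
  let ?H = "{x::real^3. axis 1 1 \<bullet> x = 0}"
  have nz: "(axis 1 1 :: real^3) \<noteq> 0" by (simp add: axis_eq_0_iff)
  then obtain g h where gh: "homeomorphism (S2 - {y}) ?H g h"
    using homeomorphic_punctured_sphere_hyperplane[OF zero_less_one y(1)[unfolded S2_def], of "axis 1 1" 0]
    unfolding homeomorphic_def S2_def by blast
  have fy: "f ` S2 \<subseteq> S2 - {y}" using im y by auto
  have contgf: "continuous_on S2 (g \<circ> f)"
    using gh fy cont unfolding homeomorphism_def by (metis continuous_on_compose continuous_on_subset)
  have "inj_on g (S2 - {y})"
    using gh unfolding homeomorphism_def by (meson inj_on_inverseI)
  then have injgf: "inj_on (g \<circ> f) S2"
    using fy inj by (metis comp_inj_on inj_on_subset)
  have imgf: "(g \<circ> f) ` S2 \<subseteq> ?H"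
    using gh fy unfolding homeomorphism_def image_comp[symmetric] by blast
  have "openin (top_of_set ?H) ((g \<circ> f) ` S2)"
    by (rule invariance_of_domain_sphere_affine_set[OF contgf injgf, of ?H 1 0])
      (use imgf nz in \<open>auto simp: aff_dim_hyperplane affine_hyperplane S2_def[symmetric]\<close>)
  moreover have "closedin (top_of_set ?H) ((g \<circ> f) ` S2)"
    using compact_continuous_image[OF contgf compact_S2] imgf by (simp add: closed_subset compact_imp_closed)
  moreover have "connected ?H" by (simp add: convex_connected convex_hyperplane)
  ultimately have "(g \<circ> f) ` S2 = ?H"
    using connected_clopen[of ?H] pole_in_S2 by blast
  then have "h ` g ` f ` S2 = h ` ?H" by (simp add: image_comp)
  moreover have "h ` g ` f ` S2 = f ` S2"
  proof -
    have "h (g z) = z" if "z \<in> f ` S2" for z using that gh fy unfolding homeomorphism_def by blast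
    then have "(\<lambda>z. h (g z)) ` f ` S2 = id ` f ` S2" by (intro image_cong) auto
    then show ?thesis by (simp add: image_image)
  qed
  moreover have "h ` ?H = S2 - {y}" using gh unfolding homeomorphism_def by blast
  ultimately have eq: "f ` S2 = S2 - {y}" by simp
  have "closedin (top_of_set S2) (S2 - {y})"
    using compact_continuous_image[OF cont compact_S2] eq by (simp add: closed_subset compact_imp_closed)
  moreover have "openin (top_of_set S2) (S2 - {y})"
    by (simp add: openin_delete)
  moreover have "connected S2" by (simp add: path_connected_imp_connected path_connected_S2)
  ultimately have "S2 - {y} = {} \<or> S2 - {y} = S2" using connected_clopen by blast
  then show False using y eq pole_in_S2 by blast
qed

text \<open>
  Removing the point with the middle one of three values would disconnect the image.
\<close>

lemma no_S2_embedding_real: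
  fixes f :: "real^3 \<Rightarrow> real"
  assumes cont: "continuous_on S2 f" and inj: "inj_on f S2"
  shows False
proof -
  have between: False if "x \<in> S2" "y \<in> S2" "z \<in> S2" "f x < f y" "f y < f z" for x y z
  proof -
    have "connected (f ` (S2 - {y}))"
      using cont connected_S2_minus_one by (intro connected_continuous_image) (auto intro: continuous_on_subset)
    moreover have "f x \<in> f ` (S2 - {y})" "f z \<in> f ` (S2 - {y})" using that by auto
    ultimately have "f y \<in> f ` (S2 - {y})"
      using that by (meson connectedD_interval less_imp_le)
    then show False using inj that(2) by (auto simp: inj_on_def)
  qed
  obtain e where e: "e \<in> S2" "e \<noteq> pole" "e \<noteq> - pole" using S2_third_point by blast
  then have "f e \<noteq> f pole" "f e \<noteq> f (- pole)" "f pole \<noteq> f (- pole)"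
    using inj pole_in_S2 S2_uminus pole_neq by (metis inj_onD)+
  then show False using between e(1) pole_in_S2 S2_uminus by (metis linorder_neqE_linordered_idom)
qed

lemma connected_subset_clopen:
  assumes "connected C" "open P" "closed Q" "\<And>u. u \<in> C \<Longrightarrow> u \<in> P \<longleftrightarrow> u \<in> Q" "C \<inter> P \<noteq> {}"
  shows "C \<subseteq> P"
proof (rule ccontr)
  assume "\<not> C \<subseteq> P"
  then have "- Q \<inter> C \<noteq> {}" using assms(4) by auto
  then show False using connectedD[OF assms(1,2), of "- Q"] assms(3-5) by (auto simp: open_Compl)
qed

text \<open>
  The form in which the connectedness of the sphere minus two points is used throughout: if a piece of
  the target is clopen away from two points \<open>a\<close> and \<open>b\<close>, then a sphere that meets the piece lies in it,
  up to \<open>a\<close> and \<open>b\<close>.  Clopenness is expressed by an open set \<open>P\<close> and a closed set \<open>Q\<close> of the ambient space that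
  agree on the image of the sphere.
\<close>

lemma S2_image_in_piece:
  fixes h :: "real^3 \<Rightarrow> 'a::topological_space"
  assumes cont: "continuous_on S2 h" and inj: "inj_on h S2"
    and "open P" "closed Q"
    and PQ: "\<And>s. s \<in> S2 \<Longrightarrow> h s \<noteq> a \<Longrightarrow> h s \<noteq> b \<Longrightarrow> h s \<in> P \<longleftrightarrow> h s \<in> Q"
    and s0: "s0 \<in> S2" "h s0 \<in> P" "h s0 \<noteq> a" "h s0 \<noteq> b"
    and s: "s \<in> S2"
  shows "h s = a \<or> h s = b \<or> h s \<in> P"
proof -
  \<comment> \<open>If \<open>c\<close> is not a value of \<open>h\<close>, the point 0 serves as a dummy that does not lie on the sphere.\<close>
  have fibre: "\<exists>p. {s\<in>S2. h s = c} = S2 \<inter> {p}" for c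
  proof (cases "\<exists>p\<in>S2. h p = c")
    case True
    then show ?thesis using inj by (auto simp: inj_on_def)
  next
    case False
    moreover note zero_notin_S2
    ultimately show ?thesis by (intro exI[of _ 0]) auto
  qed
  obtain p q where pq: "{s\<in>S2. h s = a} = S2 \<inter> {p}" "{s\<in>S2. h s = b} = S2 \<inter> {q}"
    using fibre by meson
  let ?C = "h ` (S2 - {p, q})"
  have "connected ?C"
    using cont connected_S2_minus_two by (intro connected_continuous_image) (auto intro: continuous_on_subset)
  moreover have C: "t \<in> S2 - {p, q} \<longleftrightarrow> t \<in> S2 \<and> h t \<noteq> a \<and> h t \<noteq> b" for t
    using pq by blast
  moreover have "u \<in> P \<longleftrightarrow> u \<in> Q" if "u \<in> ?C" for u
    using that C PQ by blast
  moreover have "?C \<inter> P \<noteq> {}" using s0 C by blast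
  ultimately have "?C \<subseteq> P"
    using assms(3,4) by (intro connected_subset_clopen[of ?C P Q]) auto
  then show ?thesis using C s by blast
qed

section \<open>Spaces of spheres glued along a graph\<close>

definition base_point :: "'v \<Rightarrow> real^3" where
  "base_point = (\<lambda>_. pole)"

text \<open>
  On the sphere of the edge \<open>x y\<close>, a point other than the poles has exactly the coordinates \<open>x\<close> and \<open>y\<close> different
  from \<open>pole\<close>, and these are antipodal; on the sphere joining \<open>x\<close> to the apex, a point other than the apex has only
  coordinate \<open>x\<close> different from \<open>pole\<close>.  That
  at most two coordinates differ from \<open>pole\<close> need not be demanded, because three points cannot be
  pairwise antipodal.
\<close>

definition graph_space :: "('v \<Rightarrow> 'v \<Rightarrow> bool) \<Rightarrow> 'v set \<Rightarrow> ('v \<Rightarrow> real^3) set" where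
  "graph_space R V = {u. (\<forall>x. u x \<in> S2) \<and> (\<forall>x. x \<notin> V \<longrightarrow> u x = pole) \<and>
     (\<forall>x y. x \<noteq> y \<longrightarrow> u x = pole \<or> u y = pole \<or> (R x y \<and> u y = - u x))}"

lemma graph_spaceD:
  assumes "u \<in> graph_space R V"
  shows "u x \<in> S2" "u x \<noteq> pole \<Longrightarrow> x \<in> V"
    "x \<noteq> y \<Longrightarrow> u x \<noteq> pole \<Longrightarrow> u y \<noteq> pole \<Longrightarrow> R x y \<and> u y = - u x"
  using assms unfolding graph_space_def by auto

text \<open>
  The parametrised sphere of the edge from \<open>x\<close> to the apex (\<open>None\<close>) or to another vertex; the
  parameter \<open>- pole\<close> belongs to \<open>x\<close> and \<open>pole\<close> to the other end.
\<close>

fun edge_sphere :: "'v \<Rightarrow> 'v option \<Rightarrow> real^3 \<Rightarrow> 'v \<Rightarrow> real^3" where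
  "edge_sphere x None e = base_point(x := e)"
| "edge_sphere x (Some y) e = base_point(x := e, y := - e)"

text \<open>
  The positions of the apex and of the vertices.
\<close>

fun tip :: "'v option \<Rightarrow> 'v \<Rightarrow> real^3" where
  "tip None = base_point"
| "tip (Some x) = base_point(x := - pole)"

lemma tip_apply: "tip a x = (if a = Some x then - pole else pole)"
  by (cases a) (auto simp: base_point_def)

lemma edge_sphere_apply: "b \<noteq> Some x \<Longrightarrow> edge_sphere x b e z = (if z = x then e else if b = Some z then - e else pole)"
  by (cases b) (auto simp: base_point_def)

declare edge_sphere.simps [simp del] tip.simps [simp del]

lemma edge_sphere_poles:
  assumes "b \<noteq> Some x" shows "edge_sphere x b (- pole) = tip (Some x)" "edge_sphere x b pole = tip b"
  using assms by (auto simp: fun_eq_iff tip_apply edge_sphere_apply)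

lemma tip_inj:
  assumes "tip a = tip b" shows "a = b"
proof -
  have "a = Some x \<longleftrightarrow> b = Some x" for x
    using tip_apply[of a x] tip_apply[of b x] assms pole_neq by metis
  then show ?thesis by (metis option.exhaust)
qed

lemma continuous_on_coordinate [continuous_intros]:
  fixes f :: "'a::topological_space \<Rightarrow> 'i \<Rightarrow> 'b::topological_space"
  shows "continuous_on S f \<Longrightarrow> continuous_on S (\<lambda>u. f u x)"
  by (rule continuous_on_product_then_coordinatewise)

lemma continuous_on_edge_sphere: "continuous_on S (edge_sphere x b)"
proof (rule continuous_on_coordinatewise_then_product)
  fix z
  show "continuous_on S (\<lambda>e. edge_sphere x b e z)"
  proof (cases b)
    case None
    then show ?thesis by (cases "z = x") (simp_all add: edge_sphere_apply)
  next
    case (Some y)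
    then show ?thesis by (cases "z = x"; cases "z = y") (simp_all add: edge_sphere.simps base_point_def continuous_on_minus)
  qed
qed

locale simple_graph =
  fixes R :: "'v \<Rightarrow> 'v \<Rightarrow> bool" and V :: "'v set"
  assumes R_sym: "R x y \<Longrightarrow> R y x" and R_irrefl: "\<not> R x x" and R_carrier: "R x y \<Longrightarrow> x \<in> V"
begin

abbreviation "edge x b \<equiv> cone_adj R V (Some x) b"

lemma cone_adj_sym: "cone_adj R V a b \<Longrightarrow> cone_adj R V b a"
  by (cases a; cases b) (auto intro: R_sym)

lemma edge_distinct: "edge x b \<Longrightarrow> b \<noteq> Some x"
  using R_irrefl by auto

lemma edge_carrier: "edge x b \<Longrightarrow> x \<in> V" "edge x (Some y) \<Longrightarrow> y \<in> V"
  using R_carrier R_sym by (cases b; auto)+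

lemma edge_sphere_in_graph_space: "edge x b \<Longrightarrow> e \<in> S2 \<Longrightarrow> edge_sphere x b e \<in> graph_space R V"
  using edge_carrier R_carrier R_sym R_irrefl
  by (cases b) (auto simp: graph_space_def base_point_def edge_sphere.simps)

lemma base_point_in_graph_space: "base_point \<in> graph_space R V"
  by (auto simp: graph_space_def base_point_def)

lemma graph_space_at_most_two:
  assumes u: "u \<in> graph_space R V" and "x \<noteq> y" "u x \<noteq> pole" "u y \<noteq> pole"
  shows "R x y" "u = edge_sphere x (Some y) (u x)"
proof -
  note pair = graph_spaceD(3)[OF u assms(2-4)]
  show "R x y" using pair by blast
  have "u z = pole" if "z \<noteq> x" "z \<noteq> y" for z
  proof (rule ccontr)
    assume "u z \<noteq> pole"
    then have z: "u z = - u x" "u z = - u y" using graph_spaceD(3)[OF u, of x z] graph_spaceD(3)[OF u, of y z] that assms \<open>u z \<noteq> pole\<close> by simp_all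
    then have "u x = u y" by (simp only: neg_equal_iff_equal)
    also have "u y = - u x" using pair by blast
    finally have "u x = - u x" .
    then show False using S2_antipodal[OF graph_spaceD(1)[OF u]] by blast
  qed
  then show "u = edge_sphere x (Some y) (u x)"
    using pair assms(2) unfolding fun_eq_iff by (auto simp: edge_sphere_apply)
qed

lemma graph_space_cases:
  assumes u: "u \<in> graph_space R V" and "u \<noteq> base_point"
  obtains x b where "edge x b" "u x \<in> S2" "u = edge_sphere x b (u x)"
proof -
  obtain x where x: "u x \<noteq> pole" using assms(2) unfolding base_point_def by blast
  have "x \<in> V" "u x \<in> S2" using graph_spaceD(1,2)[OF u] x by blast+
  show thesis
  proof (cases "\<exists>y. y \<noteq> x \<and> u y \<noteq> pole")
    case True
    then obtain y where "y \<noteq> x" "u y \<noteq> pole" by blast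
    then have "R x y" "u = edge_sphere x (Some y) (u x)" using graph_space_at_most_two[OF u _ x, of y] by blast+
    then show thesis using \<open>u x \<in> S2\<close> by (intro that[of x "Some y"]) simp_all
  next
    case False
    then have "u z = pole" if "z \<noteq> x" for z using that by blast
    then have "u = edge_sphere x None (u x)" unfolding fun_eq_iff by (simp add: edge_sphere_apply)
    then show thesis using \<open>x \<in> V\<close> \<open>u x \<in> S2\<close> by (intro that[of x None]) simp_all
  qed
qed

text \<open>
  A sphere meeting the open sphere of an edge \<open>x y\<close> lies in its closure, because the open sphere is clopen
  away from the tips of \<open>x\<close> and \<open>y\<close>.  Otherwise the sphere lies in the union of the spheres at the apex, and
  these are separated from each other by the apex alone.  In both cases a coordinate turns the given
  embedding into an embedding of the sphere into itself, which is onto.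
\<close>

lemma S2_image_is_edge_sphere:
  assumes cont: "continuous_on S2 h" and inj: "inj_on h S2" and im: "h ` S2 \<subseteq> graph_space R V"
  obtains x b where "edge x b" "h ` S2 = edge_sphere x b ` S2"
proof -
  have finish: "h ` S2 = edge_sphere x b ` S2" if sub: "\<And>s. s \<in> S2 \<Longrightarrow> h s = edge_sphere x b (h s x)" for x b
  proof -
    let ?k = "\<lambda>s. h s x"
    have "?k ` S2 = S2"
    proof (rule S2_self_embedding_onto)
      show "continuous_on S2 ?k" using cont by (rule continuous_on_coordinate)
      show "inj_on ?k S2"
      proof (rule inj_onI)
        fix s t assume st: "s \<in> S2" "t \<in> S2" "h s x = h t x"
        have "h s = edge_sphere x b (h s x)" by (rule sub[OF st(1)])
        also have "\<dots> = edge_sphere x b (h t x)" by (simp only: st(3))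
        also have "\<dots> = h t" by (rule sub[OF st(2), symmetric])
        finally show "s = t" by (rule inj_onD[OF inj _ st(1,2)])
      qed
      show "?k ` S2 \<subseteq> S2" using im by (intro image_subsetI graph_spaceD(1)) auto
    qed
    then have "edge_sphere x b ` S2 = edge_sphere x b ` ?k ` S2" by simp
    also have "\<dots> = h ` S2" unfolding image_image by (rule image_cong[OF refl sub[symmetric]])
    finally show ?thesis by simp
  qed
  have openP: "open {u::'v \<Rightarrow> real^3. u x \<noteq> pole}" for x
    by (intro open_Collect_neq continuous_intros) 
  have hS: "h s \<in> graph_space R V" if "s \<in> S2" for s using im that by auto
  show thesis
  proof (cases "\<exists>s\<in>S2. \<exists>x y. x \<noteq> y \<and> h s x \<noteq> pole \<and> h s y \<noteq> pole")
    case True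
    then obtain s0 x y where s0: "s0 \<in> S2" "x \<noteq> y" "h s0 x \<noteq> pole" "h s0 y \<noteq> pole" by blast
    note xy = graph_space_at_most_two[OF hS[OF s0(1)] s0(2-4)]
    let ?P = "{u. u x \<noteq> pole} \<inter> {u. u y \<noteq> pole}"
    let ?Q = "{u. u y = - u x} \<inter> (\<Inter>z\<in>- {x, y}. {u. u z = pole})"
    have Q: "u \<in> ?Q \<longleftrightarrow> u = edge_sphere x (Some y) (u x)" for u
      using s0(2) unfolding fun_eq_iff by (auto simp: edge_sphere_apply)
    have "closed ?Q" by (intro closed_Int closed_INT ballI closed_Collect_eq continuous_intros)
    moreover have "open ?P" using openP by blast
    moreover have "h s \<in> ?P \<longleftrightarrow> h s \<in> ?Q" if s: "s \<in> S2" "h s \<noteq> tip (Some x)" "h s \<noteq> tip (Some y)" for s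
    proof
      assume "h s \<in> ?P" then show "h s \<in> ?Q"
        using graph_space_at_most_two(2)[OF hS[OF s(1)] s0(2)] unfolding Q by blast
    next
      assume q: "h s \<in> ?Q"
      then have "h s = edge_sphere x (Some y) (h s x)" unfolding Q .
      note eq = fun_cong[OF this]
      have "h s x \<noteq> pole"
      proof
        assume "h s x = pole"
        then have "h s z = tip (Some y) z" for z
          using eq[of z] s0(2) by (simp add: edge_sphere_apply tip_apply)
        then have "h s = tip (Some y)" by (rule ext)
        then show False using s by blast
      qed
      moreover have "h s x \<noteq> - pole"
      proof
        assume "h s x = - pole"
        then have "h s z = tip (Some x) z" for z
          using eq[of z] s0(2) by (simp add: edge_sphere_apply tip_apply)
        then have "h s = tip (Some x)" by (rule ext)
        then show False using s by blast
      qed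
      ultimately show "h s \<in> ?P" using q by (auto simp: minus_equation_iff)
    qed
    moreover have "h s0 \<in> ?P" "h s0 \<noteq> tip (Some x)" "h s0 \<noteq> tip (Some y)"
      using s0 by (auto simp: tip_apply)
    ultimately have piece: "h s = tip (Some x) \<or> h s = tip (Some y) \<or> h s \<in> ?P" if "s \<in> S2" for s
      using S2_image_in_piece[OF cont inj, of ?P ?Q "tip (Some x)" "tip (Some y)" s0 s] s0(1) that by blast
    have "h s = edge_sphere x (Some y) (h s x)" if s: "s \<in> S2" for s
    proof -
      consider "h s = tip (Some x)" | "h s = tip (Some y)" | "h s \<in> ?P" using piece[OF s] by blast
      then show ?thesis
      proof cases
        case 3 then show ?thesis using graph_space_at_most_two(2)[OF hS[OF s] s0(2)] by blast
      qed (use s0(2) in \<open>simp_all add: fun_eq_iff edge_sphere_apply tip_apply\<close>)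
    qed
    then have "h ` S2 = edge_sphere x (Some y) ` S2" by (rule finish)
    then show thesis using xy(1) by (intro that[of x "Some y"]) simp_all
  next
    case False
    obtain s0 where s0: "s0 \<in> S2" "h s0 \<noteq> base_point"
    proof -
      have "h pole \<noteq> h (- pole)" using inj pole_in_S2 S2_uminus pole_neq by (metis inj_onD)
      then show thesis using that pole_in_S2 S2_uminus by metis
    qed
    then obtain x where x: "h s0 x \<noteq> pole" unfolding base_point_def by blast
    then have "x \<in> V" using graph_spaceD(2)[OF hS[OF s0(1)]] by blast
    let ?P = "{u. u x \<noteq> pole}" and ?Q = "\<Inter>z\<in>- {x}. {u::'v \<Rightarrow> real^3. u z = pole}"
    have "closed ?Q" by (intro closed_INT ballI closed_Collect_eq continuous_intros)
    moreover have "h s \<in> ?P \<longleftrightarrow> h s \<in> ?Q" if s: "s \<in> S2" "h s \<noteq> base_point" for s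
      using False s by (auto simp: base_point_def fun_eq_iff)
    ultimately have piece: "h s = base_point \<or> h s \<in> ?P" if "s \<in> S2" for s
      using S2_image_in_piece[OF cont inj openP[of x], of ?Q base_point base_point s0 s] s0 x that by blast
    have "h s = edge_sphere x None (h s x)" if s: "s \<in> S2" for s
    proof -
      have "h s z = pole" if "z \<noteq> x" for z
        using piece[OF s] False s that unfolding base_point_def by fastforce
      then show ?thesis by (simp add: fun_eq_iff edge_sphere_apply)
    qed
    then have "h ` S2 = edge_sphere x None ` S2" by (rule finish)
    then show thesis using \<open>x \<in> V\<close> by (intro that[of x None]) simp_all
  qed
qed

lemma tip_in_edge_sphere: "edge x b \<Longrightarrow> c = Some x \<or> c = b \<Longrightarrow> tip c \<in> edge_sphere x b ` S2"
proof -
  assume e: "edge x b" and c: "c = Some x \<or> c = b"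
  show ?thesis using edge_sphere_poles[OF edge_distinct[OF e]] c pole_in_S2 S2_uminus by (metis imageI)
qed

lemma edge_sphere_eq_tip:
  assumes "edge x b" "edge_sphere x b e = tip c" shows "c = Some x \<or> c = b"
proof (rule ccontr)
  assume neg: "\<not> (c = Some x \<or> c = b)"
  note d = edge_distinct[OF assms(1)]
  have "e = pole" using fun_cong[OF assms(2), of x] neg d by (simp add: tip_apply edge_sphere_apply)
  then have "edge_sphere x b e = tip b" using edge_sphere_poles[OF d] by simp
  then show False using tip_inj assms(2) neg by metis
qed

lemma tip_edges:
  assumes "edge x b" "tip c \<in> edge_sphere x b ` S2" "tip d \<in> edge_sphere x b ` S2" "c \<noteq> d"
  shows "cone_adj R V c d"
  using assms edge_sphere_eq_tip[OF assms(1)] cone_adj_sym[OF assms(1)] by (metis imageE)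

text \<open>
  A point that is not a tip knows its edge: the end points are the coordinates different from \<open>pole\<close>.
\<close>

lemma edge_sphere_eq_nontip:
  assumes xb: "edge x b" "edge x' b'" and eq: "edge_sphere x b e = edge_sphere x' b' e'" and nontip: "\<And>c. edge_sphere x b e \<noteq> tip c"
  shows "edge_sphere x b ` S2 = edge_sphere x' b' ` S2"
proof -
  note d = edge_distinct[OF xb(1)] edge_distinct[OF xb(2)]
  have e_ne: "e \<noteq> pole" "e \<noteq> - pole"
    using nontip edge_sphere_poles[OF d(1)] by blast+
  have e'_ne: "e' \<noteq> pole" "e' \<noteq> - pole"
    using nontip[unfolded eq] edge_sphere_poles[OF d(2)] by blast+
  have supp: "edge_sphere x b e z \<noteq> pole \<longleftrightarrow> z = x \<or> b = Some z" for z
    using e_ne d(1) by (auto simp: edge_sphere_apply minus_equation_iff)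
  have supp': "edge_sphere x' b' e' z \<noteq> pole \<longleftrightarrow> z = x' \<or> b' = Some z" for z
    using e'_ne d(2) by (auto simp: edge_sphere_apply minus_equation_iff)
  have same: "z = x \<or> b = Some z \<longleftrightarrow> z = x' \<or> b' = Some z" for z
    using supp supp' eq by metis
  consider "x = x'" "b = b'" | "b = Some x'" "b' = Some x"
    using same d by (cases b; cases b') (metis option.inject option.distinct(1))+
  then show ?thesis
  proof cases
    case 2
    have flip: "edge_sphere x b s = edge_sphere x' b' (- s)" for s
      using 2 d by (auto simp: fun_eq_iff edge_sphere_apply)
    have "uminus ` S2 = S2"
    proof
      show "S2 \<subseteq> uminus ` S2" using S2_uminus by (metis image_eqI minus_minus subsetI)
    qed auto
    then have "edge_sphere x' b' ` S2 = edge_sphere x' b' ` uminus ` S2" by simp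
    then show ?thesis by (simp add: image_image flip)
  qed simp
qed

end

text \<open>
  A tip lies on two different spheres, whose images are two different spheres; since these meet only in
  tips, tips are mapped to tips.  The degree assumption provides the two spheres.
\<close>

lemma graph_space_embedding_imp_cone_hom:
  fixes f :: "('v \<Rightarrow> real^3) \<Rightarrow> 'u \<Rightarrow> real^3"
  assumes "simple_graph R V" "simple_graph R' V'"
    and cont: "continuous_on (graph_space R V) f" and inj: "inj_on f (graph_space R V)"
    and im: "f ` graph_space R V \<subseteq> graph_space R' V'"
    and deg: "\<And>x. x \<in> V \<Longrightarrow> \<exists>y. R x y" and "V \<noteq> {}"
  obtains g where "inj_on g (insert None (Some ` V))"
    "\<And>a b. cone_adj R V a b \<Longrightarrow> cone_adj R' V' (g a) (g b)"
proof -
  interpret G: simple_graph R V by fact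
  interpret H: simple_graph R' V' by fact
  let ?A = "insert None (Some ` V)"
  have sub: "edge_sphere x b ` S2 \<subseteq> graph_space R V" if "G.edge x b" for x b
    using G.edge_sphere_in_graph_space[OF that] by blast
  have image: "\<exists>x' b'. H.edge x' b' \<and> f ` edge_sphere x b ` S2 = edge_sphere x' b' ` S2" if e: "G.edge x b" for x b
  proof -
    have "inj_on (edge_sphere x b) S2"
      using G.edge_distinct[OF e] by (intro inj_onI) (metis edge_sphere_apply)
    then have "inj_on (f \<circ> edge_sphere x b) S2"
      using sub[OF e] inj by (metis comp_inj_on inj_on_subset)
    moreover have "continuous_on S2 (f \<circ> edge_sphere x b)"
      using sub[OF e] cont continuous_on_edge_sphere by (metis continuous_on_compose continuous_on_subset)
    moreover have "(f \<circ> edge_sphere x b) ` S2 \<subseteq> graph_space R' V'" using sub[OF e] im by auto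
    ultimately obtain x' b' where "H.edge x' b'" "(f \<circ> edge_sphere x b) ` S2 = edge_sphere x' b' ` S2"
      using H.S2_image_is_edge_sphere by blast
    then show ?thesis by (auto simp: image_comp)
  qed
  have two_edges: "\<exists>x b x' b'. G.edge x b \<and> G.edge x' b' \<and> edge_sphere x b ` S2 \<noteq> edge_sphere x' b' ` S2 \<and>
      tip a \<in> edge_sphere x b ` S2 \<and> tip a \<in> edge_sphere x' b' ` S2" if a: "a \<in> ?A" for a
  proof -
    obtain x where x: "x \<in> V" "a = None \<or> a = Some x" using a \<open>V \<noteq> {}\<close> by blast
    obtain y where y: "R x y" using deg[OF x(1)] by blast
    then have y': "y \<in> V" "x \<noteq> y" using G.R_carrier G.R_sym G.R_irrefl by blast+
    have e: "G.edge x None" "G.edge y None" "G.edge x (Some y)" using x y y' by auto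
    show ?thesis
    proof (cases a)
      case None
      have "tip (Some x) \<in> edge_sphere x None ` S2" "tip (Some x) \<notin> edge_sphere y None ` S2"
        using G.tip_in_edge_sphere[OF e(1)] G.edge_sphere_eq_tip[OF e(2)] y' by auto (metis option.distinct(1) option.inject)
      then show ?thesis using e(1,2) G.tip_in_edge_sphere[OF e(1), of None] G.tip_in_edge_sphere[OF e(2), of None] None by blast
    next
      case (Some x')
      have "tip None \<in> edge_sphere x None ` S2" "tip None \<notin> edge_sphere x (Some y) ` S2"
        using G.tip_in_edge_sphere[OF e(1)] G.edge_sphere_eq_tip[OF e(3)] by auto (metis option.distinct(1))
      then show ?thesis using e(1,3) G.tip_in_edge_sphere[OF e(1), of a] G.tip_in_edge_sphere[OF e(3), of a] Some x(2) by blast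
    qed
  qed
  have vertex: "tip a \<in> graph_space R V" if "a \<in> ?A" for a
    using two_edges[OF that] sub by blast
  have "\<exists>c. f (tip a) = tip c" if a: "a \<in> ?A" for a
  proof (rule ccontr)
    assume neg: "\<not> ?thesis"
    obtain x b x' b' where e: "G.edge x b" "G.edge x' b'" "edge_sphere x b ` S2 \<noteq> edge_sphere x' b' ` S2"
      "tip a \<in> edge_sphere x b ` S2" "tip a \<in> edge_sphere x' b' ` S2" using two_edges[OF a] by blast
    obtain y c where yc: "H.edge y c" "f ` edge_sphere x b ` S2 = edge_sphere y c ` S2" using image[OF e(1)] by blast
    obtain y' c' where yc': "H.edge y' c'" "f ` edge_sphere x' b' ` S2 = edge_sphere y' c' ` S2" using image[OF e(2)] by blast
    obtain s where s: "f (tip a) = edge_sphere y c s" using yc(2) e(4) by blast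
    obtain s' where s': "f (tip a) = edge_sphere y' c' s'" using yc'(2) e(5) by blast
    have "edge_sphere y c ` S2 = edge_sphere y' c' ` S2"
      using H.edge_sphere_eq_nontip[OF yc(1) yc'(1), of s s'] s s' neg by metis
    then have "f ` edge_sphere x b ` S2 = f ` edge_sphere x' b' ` S2" using yc yc' by simp
    then show False using inj_on_image_eq_iff[OF inj sub[OF e(1)] sub[OF e(2)]] e(3) by blast
  qed
  then obtain g where g: "\<And>a. a \<in> ?A \<Longrightarrow> f (tip a) = tip (g a)" by metis
  have g_inj: "inj_on g ?A"
  proof (rule inj_onI)
    fix a b assume ab: "a \<in> ?A" "b \<in> ?A" "g a = g b"
    then have "f (tip a) = f (tip b)" using g by metis
    then show "a = b" using inj_onD[OF inj] vertex ab(1,2) tip_inj by metis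
  qed
  have g_edge: "cone_adj R' V' (g (Some x)) (g b)" if e: "G.edge x b" for x b
  proof -
    have A1: "Some x \<in> ?A" using G.edge_carrier(1)[OF e] by blast
    have A2: "b \<in> ?A"
    proof (cases b)
      case (Some y)
      then show ?thesis using G.edge_carrier(2)[of x y] e by blast
    qed simp
    note A = A1 A2
    obtain y c where yc: "H.edge y c" "f ` edge_sphere x b ` S2 = edge_sphere y c ` S2" using image[OF e] by blast
    have "tip (g (Some x)) \<in> edge_sphere y c ` S2" "tip (g b) \<in> edge_sphere y c ` S2"
      using yc(2) G.tip_in_edge_sphere[OF e, of "Some x"] G.tip_in_edge_sphere[OF e, of b] g[OF A(1)] g[OF A(2)] by (metis imageI)+
    moreover have "g (Some x) \<noteq> g b" using inj_onD[OF g_inj] A G.edge_distinct[OF e] by metis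
    ultimately show ?thesis using H.tip_edges[OF yc(1)] by blast
  qed
  have "cone_adj R' V' (g a) (g b)" if ab: "cone_adj R V a b" for a b
  proof (cases a)
    case None
    then obtain x where "b = Some x" using ab by (cases b) auto
    then show ?thesis using g_edge[of x a] G.cone_adj_sym[OF ab] H.cone_adj_sym by blast
  next
    case (Some x)
    then show ?thesis using g_edge ab by blast
  qed
  then show thesis using that g_inj by blast
qed

section \<open>Cones over powers of one-point compactifications\<close>

lemma compact_funset:
  fixes K :: "'i \<Rightarrow> 'a::topological_space set"
  assumes "\<And>i. compact (K i)"
  shows "compact {u. \<forall>i. u i \<in> K i}"
proof -
  have "compactin (product_topology (\<lambda>_. euclidean) UNIV) (PiE UNIV K)"
    unfolding compactin_PiE using assms by simp
  moreover have "PiE UNIV K = {u. \<forall>i. u i \<in> K i}" by (auto simp: PiE_def Pi_def)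
  ultimately show ?thesis by (simp add: euclidean_product_topology)
qed

text \<open>
  With \<open>A(L)\<close> the one-point compactification of the discrete space \<open>L\<close>, this is the cone over \<open>A(L)\<^sup>N\<close>: a point \<open>z\<close> of
  the power is given by the indicator function of the partial function from \<open>N\<close> to \<open>L\<close> that is undefined
  where \<open>z\<close> takes the value infinity, and the points \<open>t\<close> below are the multiples \<open>s z\<close> for \<open>s \<in> [0,1]\<close>.  For singletons
  \<open>N\<close> and \<open>L\<close> it is the unit interval.
\<close>

definition cone_base :: "'n set \<Rightarrow> 'l set \<Rightarrow> ('n \<times> 'l \<Rightarrow> real) set" where
  "cone_base N L = {t. (\<forall>i. t i \<in> {0..1}) \<and> (\<forall>i. i \<notin> N \<times> L \<longrightarrow> t i = 0) \<and>
     (\<forall>i j. i \<noteq> j \<longrightarrow> t i = 0 \<or> t j = 0 \<or> (t i = t j \<and> fst i \<noteq> fst j))}"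

lemma compact_cone_base: "compact (cone_base N L)"
proof -
  let ?K = "{t::'a \<times> 'b \<Rightarrow> real. \<forall>i. t i \<in> {0..1}}"
  let ?C = "{t::'a \<times> 'b \<Rightarrow> real. (\<forall>i. i \<notin> N \<times> L \<longrightarrow> t i = 0) \<and>
     (\<forall>i j. i \<noteq> j \<longrightarrow> t i = 0 \<or> t j = 0 \<or> (t i = t j \<and> fst i \<noteq> fst j))}"
  have eq: "closed {t::'a \<times> 'b \<Rightarrow> real. t i = 0}" for i
    by (intro closed_Collect_eq continuous_intros)
  have eq': "closed {t::'a \<times> 'b \<Rightarrow> real. t i = t j}" for i j
    by (intro closed_Collect_eq continuous_intros)
  have "closed ?C"
    by (intro closed_Collect_conj closed_Collect_all closed_Collect_imp closed_Collect_disj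
        closed_Collect_const open_Collect_const eq eq')
  moreover have "compact ?K" by (rule compact_funset) simp
  moreover have "cone_base N L = ?K \<inter> ?C"
    by (simp only: cone_base_def Collect_conj_eq)
  ultimately show ?thesis by (simp only: compact_Int_closed)
qed

lemma cone_baseD:
  assumes "t \<in> cone_base N L"
  shows "0 \<le> t i" "t i \<le> 1" "t i \<noteq> 0 \<Longrightarrow> i \<in> N \<times> L" "t i \<noteq> 0 \<Longrightarrow> t j \<noteq> 0 \<Longrightarrow> t i = t j"
    "t i \<noteq> 0 \<Longrightarrow> t j \<noteq> 0 \<Longrightarrow> i \<noteq> j \<Longrightarrow> fst i \<noteq> fst j"
proof -
  note t = assms[unfolded cone_base_def mem_Collect_eq]
  have "t i \<in> {0..1}" using t[THEN conjunct1] by (rule spec)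
  then show "0 \<le> t i" "t i \<le> 1" by simp_all
  show "t i \<noteq> 0 \<Longrightarrow> i \<in> N \<times> L" using t[THEN conjunct2, THEN conjunct1, rule_format, of i] by blast
  show "t i \<noteq> 0 \<Longrightarrow> t j \<noteq> 0 \<Longrightarrow> t i = t j" using t[THEN conjunct2, THEN conjunct2, rule_format, of i j] by (cases "i = j") simp_all
  show "t i \<noteq> 0 \<Longrightarrow> t j \<noteq> 0 \<Longrightarrow> i \<noteq> j \<Longrightarrow> fst i \<noteq> fst j"
    using t[THEN conjunct2, THEN conjunct2, rule_format, of i j] by simp
qed

lemma cone_baseI:
  assumes "\<And>i. 0 \<le> t i" "\<And>i. t i \<le> 1" "\<And>i. t i \<noteq> 0 \<Longrightarrow> i \<in> N \<times> L"
    and "\<And>i j. t i \<noteq> 0 \<Longrightarrow> t j \<noteq> 0 \<Longrightarrow> i \<noteq> j \<Longrightarrow> t i = t j \<and> fst i \<noteq> fst j"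
  shows "t \<in> cone_base N L"
  unfolding cone_base_def mem_Collect_eq using assms by (intro conjI allI impI) (simp, blast, metis)

lemma zero_in_cone_base: "(\<lambda>_. 0) \<in> cone_base N L"
  unfolding cone_base_def by auto

lemma path_connected_cone_base: "path_connected (cone_base N L)"
proof -
  have scale: "(\<lambda>i. s * t i) \<in> cone_base N L" if "t \<in> cone_base N L" "s \<in> {0..1}" for s t
    using that(2) cone_baseD[OF that(1)] by (intro cone_baseI) (auto simp: mult_le_one)
  have "path_component (cone_base N L) t (\<lambda>_. 0)" if t: "t \<in> cone_base N L" for t
    unfolding path_component_def
  proof (intro exI conjI)
    let ?g = "\<lambda>s i. (1 - s) * t i"
    show "path ?g" unfolding path_def
      by (intro continuous_on_coordinatewise_then_product continuous_intros)
    show "path_image ?g \<subseteq> cone_base N L"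
      unfolding path_image_def using scale[OF t] by auto
  qed (auto simp: pathstart_def pathfinish_def)
  then show ?thesis
    unfolding path_connected_component by (meson path_component_sym path_component_trans)
qed

text \<open>
  Away from the vertex the support of a point is locally constant, so a sphere would lie in a single segment
  and a coordinate would embed it in the real line.
\<close>

lemma no_S2_embedding_cone_base:
  assumes cont: "continuous_on S2 h" and inj: "inj_on h S2" and im: "h ` S2 \<subseteq> cone_base N L"
  shows False
proof -
  have hS: "h s \<in> cone_base N L" if "s \<in> S2" for s using im that by blast
  have support: "h s = (\<lambda>_. 0) \<or> h s i \<noteq> 0" if s: "s \<in> S2" and s0: "s0 \<in> S2" "h s0 i \<noteq> 0" for s s0 i
  proof -
    \<comment> \<open>Away from the vertex, coordinate \<open>i\<close> is non-zero iff it is maximal.\<close>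
    let ?P = "{t. t i \<noteq> (0::real)}" and ?Q = "\<Inter>k. {t. t k \<le> (t i::real)}"
    have "open ?P" by (intro open_Collect_neq continuous_intros)
    moreover have "closed ?Q" by (intro closed_INT ballI closed_Collect_le continuous_intros)
    moreover have "h r \<in> ?P \<longleftrightarrow> h r \<in> ?Q" if r: "r \<in> S2" "h r \<noteq> (\<lambda>_. 0)" for r
    proof
      assume P: "h r \<in> ?P"
      have "h r k \<le> h r i" for k
        using P cone_baseD(1)[OF hS[OF r(1)], of i] cone_baseD(4)[OF hS[OF r(1)], of i k] by (cases "h r k = 0") auto
      then show "h r \<in> ?Q" by blast
    next
      assume Q: "h r \<in> ?Q"
      obtain k where "h r k \<noteq> 0" using r(2) unfolding fun_eq_iff by blast
      then have "0 < h r k" using cone_baseD(1)[OF hS[OF r(1)], of k] by linarith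
      moreover have "h r k \<le> h r i" using Q by blast
      ultimately show "h r \<in> ?P" by auto
    qed
    moreover have "h s0 \<in> ?P" "h s0 \<noteq> (\<lambda>_. 0)" using s0(2) by auto
    ultimately have "h s = (\<lambda>_. 0) \<or> h s = (\<lambda>_. 0) \<or> h s \<in> ?P"
      by (intro S2_image_in_piece[OF cont inj, of ?P ?Q "\<lambda>_. 0" "\<lambda>_. 0" s0 s]) (use s0 s in auto)
    then show ?thesis by auto
  qed
  obtain s0 where s0: "s0 \<in> S2" "h s0 \<noteq> (\<lambda>_. 0)"
  proof -
    have "h pole \<noteq> h (- pole)" using inj pole_in_S2 S2_uminus pole_neq by (metis inj_onD)
    then show thesis using that pole_in_S2 S2_uminus by metis
  qed
  then obtain j where j: "h s0 j \<noteq> 0" unfolding fun_eq_iff by blast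
  have zero: "h s = (\<lambda>_. 0)" if s: "s \<in> S2" "h s j = 0" for s
    using support[OF s(1) s0(1) j] s(2) by blast
  have "inj_on (\<lambda>s. h s j) S2"
  proof (rule inj_onI)
    fix r s assume rs: "r \<in> S2" "s \<in> S2" "h r j = h s j"
    have "h r = h s"
    proof (cases "h r j = 0")
      case True
      then show ?thesis using zero rs by metis
    next
      case False
      have "h r i = h s i" for i
      proof (cases "h r i = 0")
        case True
        have "h r \<noteq> (\<lambda>_. 0)" using False by auto
        then have "h s i = 0" using support[OF rs(1,2), of i] True by blast
        then show ?thesis using True by simp
      next
        case r: False
        have "h s \<noteq> (\<lambda>_. 0)" using False rs(3) by auto
        then have "h s i \<noteq> 0" using support[OF rs(2,1) r] by blast
        then show ?thesis
          using cone_baseD(4)[OF hS[OF rs(1)], of i j] cone_baseD(4)[OF hS[OF rs(2)], of i j] r False rs(3) by simp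
      qed
      then show ?thesis by (rule ext)
    qed
    then show "r = s" using inj rs(1,2) by (meson inj_onD)
  qed
  moreover have "continuous_on S2 (\<lambda>s. h s j)" using cont by (rule continuous_on_coordinate)
  ultimately show False by (rule no_S2_embedding_real[rotated])
qed

section \<open>Combs of graph spaces\<close>

text \<open>
  A copy of \<open>Y b\<close> is attached to the base \<open>T\<close> at every \<open>b \<in> B\<close>, by identifying \<open>base_point\<close> with \<open>b\<close>.  The second
  component of a point records its position in each of the attached spaces, so that at most one entry differs
  from \<open>base_point\<close>, and the product topology makes spaces attached at points close to \<open>t\<close>, but different from \<open>t\<close>,
  shrink to \<open>t\<close>.
\<close>

definition comb :: "('j \<Rightarrow> real) set \<Rightarrow> ('j \<Rightarrow> real) set \<Rightarrow> (('j \<Rightarrow> real) \<Rightarrow> ('v \<Rightarrow> real^3) set) \<Rightarrow>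
    (('j \<Rightarrow> real) \<times> (('j \<Rightarrow> real) \<Rightarrow> 'v \<Rightarrow> real^3)) set" where
  "comb T B Y = {p. fst p \<in> T \<and> (\<forall>b. snd p b = base_point \<or> (b \<in> B \<and> fst p = b \<and> snd p b \<in> Y b))}"

definition in_piece :: "('j \<Rightarrow> real) \<Rightarrow> ('j \<Rightarrow> real) \<times> (('j \<Rightarrow> real) \<Rightarrow> 'v \<Rightarrow> real^3) \<Rightarrow> bool" where
  "in_piece b p \<longleftrightarrow> fst p = b \<and> (\<forall>c. c \<noteq> b \<longrightarrow> snd p c = base_point)"

definition tooth :: "('j \<Rightarrow> real) \<Rightarrow> ('v \<Rightarrow> real^3) \<Rightarrow> ('j \<Rightarrow> real) \<times> (('j \<Rightarrow> real) \<Rightarrow> 'v \<Rightarrow> real^3)" where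
  "tooth b u = (b, (\<lambda>_. base_point)(b := u))"

lemma comb_in_piece: "p \<in> comb T B Y \<Longrightarrow> in_piece (fst p) p"
  unfolding comb_def in_piece_def by blast

lemma in_piece_iff_tooth: "in_piece b p \<longleftrightarrow> p = tooth b (snd p b)"
proof
  assume p: "in_piece b p"
  then have "snd p = (\<lambda>_. base_point)(b := snd p b)" by (intro ext) (simp add: in_piece_def)
  then show "p = tooth b (snd p b)" using p unfolding tooth_def in_piece_def by (intro prod_eqI) simp_all
next
  assume p: "p = tooth b (snd p b)"
  show "in_piece b p" by (subst p) (simp add: in_piece_def tooth_def)
qed

lemma continuous_on_fst_coordinate: "continuous_on A (\<lambda>p. fst p j)"
  by (rule continuous_on_coordinate[OF continuous_on_fst[OF continuous_on_id]])

lemma continuous_on_snd_coordinate: "continuous_on A (\<lambda>p. snd p b)"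
  by (rule continuous_on_coordinate[OF continuous_on_snd[OF continuous_on_id]])

lemma continuous_on_snd_coordinate2: "continuous_on A (\<lambda>p. snd p b v)"
  by (rule continuous_on_coordinate[OF continuous_on_snd_coordinate])

lemma continuous_on_tooth: "continuous_on A (tooth b)"
  unfolding tooth_def
proof (intro continuous_on_Pair continuous_on_const continuous_on_coordinatewise_then_product)
  fix c v
  show "continuous_on A (\<lambda>u. ((\<lambda>_. base_point)(b := u)) c v)"
    by (cases "c = b") (simp_all add: continuous_on_coordinate[OF continuous_on_id])
qed

lemma closed_snd_eq_base_point:
  "closed {p :: ('j \<Rightarrow> real) \<times> (('j \<Rightarrow> real) \<Rightarrow> 'v \<Rightarrow> real^3). snd p b = base_point}"
proof -
  have "{p :: ('j \<Rightarrow> real) \<times> (('j \<Rightarrow> real) \<Rightarrow> 'v \<Rightarrow> real^3). snd p b = base_point} = (\<Inter>v. {p. snd p b v = pole})"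
    unfolding base_point_def by (auto simp: fun_eq_iff)
  then show ?thesis
    by (simp add: closed_INT closed_Collect_eq continuous_on_snd_coordinate2)
qed

lemma closed_fst_eq:
  "closed {p :: ('j \<Rightarrow> real) \<times> (('j \<Rightarrow> real) \<Rightarrow> 'v \<Rightarrow> real^3). fst p = b}"
proof -
  have "{p :: ('j \<Rightarrow> real) \<times> (('j \<Rightarrow> real) \<Rightarrow> 'v \<Rightarrow> real^3). fst p = b} = (\<Inter>j. {p. fst p j = b j})"
    by (auto simp: fun_eq_iff)
  then show ?thesis
    by (simp add: closed_INT closed_Collect_eq continuous_on_fst_coordinate)
qed

text \<open>
  An attached space, without its base point, is clopen away from that point; the base itself contains no
  sphere.
\<close>

lemma S2_image_in_tooth:
  fixes h :: "real^3 \<Rightarrow> ('j \<Rightarrow> real) \<times> (('j \<Rightarrow> real) \<Rightarrow> 'v \<Rightarrow> real^3)"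
  assumes cont: "continuous_on S2 h" and inj: "inj_on h S2" and im: "h ` S2 \<subseteq> comb T B Y"
    and T: "\<And>g. continuous_on S2 g \<Longrightarrow> inj_on g S2 \<Longrightarrow> g ` S2 \<subseteq> T \<Longrightarrow> False"
  shows "\<exists>b\<in>B. \<forall>s\<in>S2. in_piece b (h s)"
proof -
  have hS: "h s \<in> comb T B Y" if "s \<in> S2" for s using im that by blast
  have piece: "in_piece b (h s)" if "s \<in> S2" "fst (h s) = b" for s b
    using comb_in_piece[OF hS[OF that(1)]] that(2) by simp
  show ?thesis
  proof (cases "\<exists>s\<in>S2. \<exists>b. snd (h s) b \<noteq> base_point")
    case True
    then obtain s0 b where s0: "s0 \<in> S2" "snd (h s0) b \<noteq> base_point" by blast
    then have b: "b \<in> B" "fst (h s0) = b" using hS[OF s0(1)] unfolding comb_def by blast+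
    let ?P = "- {p :: ('j \<Rightarrow> real) \<times> (('j \<Rightarrow> real) \<Rightarrow> 'v \<Rightarrow> real^3). snd p b = base_point}"
    let ?Q = "{p :: ('j \<Rightarrow> real) \<times> (('j \<Rightarrow> real) \<Rightarrow> 'v \<Rightarrow> real^3). fst p = b}"
    let ?a = "tooth b base_point :: ('j \<Rightarrow> real) \<times> (('j \<Rightarrow> real) \<Rightarrow> 'v \<Rightarrow> real^3)"
    have a: "p = ?a" if "in_piece b p" "snd p b = base_point" for p
      using that unfolding in_piece_iff_tooth by metis
    have PQ: "h s \<in> ?P \<longleftrightarrow> h s \<in> ?Q" if s: "s \<in> S2" "h s \<noteq> ?a" for s
    proof
      assume "h s \<in> ?P" then show "h s \<in> ?Q" using hS[OF s(1)] unfolding comb_def by blast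
    next
      assume "h s \<in> ?Q"
      then show "h s \<in> ?P" using a[of "h s"] piece[OF s(1)] s(2) by auto
    qed
    have "h s0 \<noteq> ?a" using s0(2) unfolding tooth_def by auto
    moreover have "open ?P" using closed_snd_eq_base_point by (rule open_Compl)
    ultimately have "h s = ?a \<or> h s = ?a \<or> h s \<in> ?P" if s: "s \<in> S2" for s
      by (intro S2_image_in_piece[OF cont inj _ closed_fst_eq[of b], of ?P ?a ?a s0 s] PQ s s0(1))
        (use s0(2) in auto)
    then have "fst (h s) = b" if "s \<in> S2" for s
      using PQ[OF that] that unfolding tooth_def by fastforce
    then show ?thesis using b(1) piece by blast
  next
    case False
    have fst_inj: "h r = h s" if "r \<in> S2" "s \<in> S2" "fst (h r) = fst (h s)" for r s
      using False that by (intro prod_eqI ext[of "snd (h r)"]) auto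
    have "inj_on (\<lambda>s. fst (h s)) S2"
      using fst_inj inj by (meson inj_onD inj_onI)
    moreover have "continuous_on S2 (\<lambda>s. fst (h s))" using cont by (rule continuous_on_fst)
    moreover have "(\<lambda>s. fst (h s)) ` S2 \<subseteq> T" using hS unfolding comb_def by blast
    ultimately show ?thesis using T by blast
  qed
qed

text \<open>
  Every edge sphere lies in one attached space.  It is the same for all of them, since spheres at the apex
  share the apex, every other sphere shares a tip with one of these, and different attached spaces are disjoint.
\<close>

lemma graph_space_image_in_tooth:
  fixes f :: "('u \<Rightarrow> real^3) \<Rightarrow> ('j \<Rightarrow> real) \<times> (('j \<Rightarrow> real) \<Rightarrow> 'v \<Rightarrow> real^3)"
  assumes G: "simple_graph R V" and "V \<noteq> {}"
    and cont: "continuous_on (graph_space R V) f" and inj: "inj_on f (graph_space R V)"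
    and im: "f ` graph_space R V \<subseteq> comb T B Y"
    and T: "\<And>g. continuous_on S2 g \<Longrightarrow> inj_on g S2 \<Longrightarrow> g ` S2 \<subseteq> T \<Longrightarrow> False"
  shows "\<exists>b\<in>B. \<forall>u\<in>graph_space R V. in_piece b (f u)"
proof -
  interpret G: simple_graph R V by fact
  define b where "b = fst (f base_point)"
  have sph: "\<exists>c\<in>B. \<forall>e\<in>S2. in_piece c (f (edge_sphere x a e))" if e: "G.edge x a" for x a
  proof -
    have sub: "edge_sphere x a ` S2 \<subseteq> graph_space R V" using G.edge_sphere_in_graph_space[OF e] by blast
    have "inj_on (edge_sphere x a) S2"
      using G.edge_distinct[OF e] by (intro inj_onI) (metis edge_sphere_apply)
    then have "inj_on (f \<circ> edge_sphere x a) S2"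
      using sub inj by (metis comp_inj_on inj_on_subset)
    moreover have "continuous_on S2 (f \<circ> edge_sphere x a)"
      using sub cont continuous_on_edge_sphere by (metis continuous_on_compose continuous_on_subset)
    moreover have "(f \<circ> edge_sphere x a) ` S2 \<subseteq> comb T B Y" using sub im by auto
    ultimately have "\<exists>c\<in>B. \<forall>s\<in>S2. in_piece c ((f \<circ> edge_sphere x a) s)"
      using T by (intro S2_image_in_tooth[of _ T B Y])
    then show ?thesis by simp
  qed
  have axis: "b \<in> B \<and> (\<forall>e\<in>S2. in_piece b (f (edge_sphere x None e)))" if "x \<in> V" for x
  proof -
    obtain c where c: "c \<in> B" "\<And>e. e \<in> S2 \<Longrightarrow> in_piece c (f (edge_sphere x None e))" using sph[of x None] \<open>x \<in> V\<close> by auto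
    have "edge_sphere x None pole = base_point" by (simp add: edge_sphere_poles tip.simps)
    then have "c = b" using c(2)[of pole] unfolding in_piece_def b_def by simp
    then show ?thesis using c by blast
  qed
  have all: "in_piece b (f (edge_sphere x a e))" if e: "G.edge x a" "e \<in> S2" for x a e
  proof -
    obtain c where c: "\<And>e. e \<in> S2 \<Longrightarrow> in_piece c (f (edge_sphere x a e))" using sph[OF e(1)] by blast
    have "edge_sphere x a (- pole) = edge_sphere x None (- pole)"
      using edge_sphere_poles(1)[OF G.edge_distinct[OF e(1)]] edge_sphere_poles(1)[of None x] by simp
    then have "in_piece c (f (edge_sphere x None (- pole)))" using c[of "- pole"] by simp
    moreover have "in_piece b (f (edge_sphere x None (- pole)))" using axis[OF G.edge_carrier(1)[OF e(1)]] by simp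
    ultimately have "c = b" unfolding in_piece_def by simp
    then show ?thesis using c e(2) by blast
  qed
  obtain x where "x \<in> V" using \<open>V \<noteq> {}\<close> by blast
  then have "b \<in> B" using axis by blast
  moreover have "in_piece b (f u)" if u: "u \<in> graph_space R V" for u
  proof (cases "u = base_point")
    case True
    then show ?thesis using comb_in_piece im u unfolding b_def by blast
  next
    case False
    then obtain x a where "G.edge x a" "u x \<in> S2" "u = edge_sphere x a (u x)" using G.graph_space_cases[OF u] by blast
    then show ?thesis using all by metis
  qed
  ultimately show ?thesis by blast
qed

lemma comb_embedding_imp_cone_hom:
  fixes R :: "('j \<Rightarrow> real) \<Rightarrow> 'v \<Rightarrow> 'v \<Rightarrow> bool" and R' :: "('j \<Rightarrow> real) \<Rightarrow> 'v \<Rightarrow> 'v \<Rightarrow> bool"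
  assumes G: "\<And>b. b \<in> B \<Longrightarrow> simple_graph (R b) V" "\<And>b. b \<in> B' \<Longrightarrow> simple_graph (R' b) V"
    and deg: "\<And>b x. b \<in> B \<Longrightarrow> x \<in> V \<Longrightarrow> \<exists>y. R b x y" and "V \<noteq> {}"
    and cont: "continuous_on (comb T B (\<lambda>b. graph_space (R b) V)) f" and inj: "inj_on f (comb T B (\<lambda>b. graph_space (R b) V))"
    and im: "f ` comb T B (\<lambda>b. graph_space (R b) V) \<subseteq> comb T' B' (\<lambda>b. graph_space (R' b) V)"
    and T': "\<And>g. continuous_on S2 g \<Longrightarrow> inj_on g S2 \<Longrightarrow> g ` S2 \<subseteq> T' \<Longrightarrow> False"
    and b: "b \<in> B" "B \<subseteq> T"
  shows "\<exists>b'\<in>B'. \<exists>g. inj_on g (insert None (Some ` V)) \<and>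
    (\<forall>a c. cone_adj (R b) V a c \<longrightarrow> cone_adj (R' b') V (g a) (g c))"
proof -
  let ?X = "graph_space (R b) V" and ?C = "comb T B (\<lambda>b. graph_space (R b) V)" and ?C' = "comb T' B' (\<lambda>b. graph_space (R' b) V)"
  have sub: "tooth b ` ?X \<subseteq> ?C"
    using b unfolding tooth_def comb_def by auto
  have "inj (tooth b :: ('v \<Rightarrow> real^3) \<Rightarrow> _)"
    unfolding tooth_def by (rule injI) (metis fun_upd_same snd_conv)
  then have c_inj: "inj_on (f \<circ> tooth b) ?X"
    using sub inj by (meson comp_inj_on inj_on_subset subset_UNIV)
  have c_cont: "continuous_on ?X (f \<circ> tooth b)"
    by (rule continuous_on_compose[OF continuous_on_tooth continuous_on_subset[OF cont sub]])
  have c_im: "(f \<circ> tooth b) ` ?X \<subseteq> ?C'" using sub im by auto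
  have "\<exists>b'\<in>B'. \<forall>u\<in>?X. in_piece b' ((f \<circ> tooth b) u)"
    by (rule graph_space_image_in_tooth[OF G(1)[OF b(1)] \<open>V \<noteq> {}\<close> c_cont c_inj c_im T'])
  then obtain b' where b': "b' \<in> B'" "\<forall>u\<in>?X. in_piece b' ((f \<circ> tooth b) u)" ..
  let ?g = "\<lambda>u. snd ((f \<circ> tooth b) u) b'"
  have g_inj: "inj_on ?g ?X"
  proof (rule inj_onI)
    fix u v assume uv: "u \<in> ?X" "v \<in> ?X" "?g u = ?g v"
    then have "(f \<circ> tooth b) u = (f \<circ> tooth b) v"
      using bspec[OF b'(2) uv(1)] bspec[OF b'(2) uv(2)] uv(3) unfolding in_piece_iff_tooth by metis
    then show "u = v" by (rule inj_onD[OF c_inj _ uv(1,2)])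
  qed
  have g_cont: "continuous_on ?X ?g"
    using c_cont by (rule continuous_on_coordinate[OF continuous_on_snd])
  have g_im: "?g ` ?X \<subseteq> graph_space (R' b') V"
  proof
    fix w assume "w \<in> ?g ` ?X"
    then obtain u where u: "u \<in> ?X" "w = ?g u" by blast
    interpret H: simple_graph "R' b'" V using G(2) b'(1) by blast
    have "(f \<circ> tooth b) u \<in> ?C'" using c_im u(1) by blast
    then have "w = base_point \<or> w \<in> graph_space (R' b') V" unfolding comb_def u(2) by blast
    then show "w \<in> graph_space (R' b') V" using H.base_point_in_graph_space by blast
  qed
  obtain g where "inj_on g (insert None (Some ` V))"
    "\<And>a c. cone_adj (R b) V a c \<Longrightarrow> cone_adj (R' b') V (g a) (g c)"
    using graph_space_embedding_imp_cone_hom[OF G(1)[OF b(1)] G(2)[OF b'(1)] g_cont g_inj g_im deg[OF b(1)] \<open>V \<noteq> {}\<close>] by blast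
  then show ?thesis using b'(1) by blast
qed

section \<open>Weight, first countability and copies on a given type\<close>

definition cell :: "('i \<Rightarrow> 'a \<Rightarrow> real) \<Rightarrow> 'a topology \<Rightarrow> ('i \<times> rat \<times> rat) set \<Rightarrow> 'a set" where
  "cell \<phi> X F = {z \<in> topspace X. \<forall>(i, a, b)\<in>F. of_rat a < \<phi> i z \<and> \<phi> i z < of_rat b}"

lemma openin_cell:
  assumes "finite F" "F \<subseteq> I \<times> UNIV" "\<And>i. i \<in> I \<Longrightarrow> continuous_map X euclideanreal (\<phi> i)"
  shows "openin X (cell \<phi> X F)"
  using assms
proof (induction F)
  case empty
  then show ?case by (simp add: cell_def)
next
  case (insert p F)
  obtain i a b where p: "p = (i, a, b)" by (cases p)
  have "openin X {z \<in> topspace X. \<phi> i z \<in> {of_rat a<..<of_rat b}}"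
    using insert.prems p by (intro openin_continuous_map_preimage[of X euclideanreal]) auto
  moreover have "cell \<phi> X (insert p F) = {z \<in> topspace X. \<phi> i z \<in> {of_rat a<..<of_rat b}} \<inter> cell \<phi> X F"
    unfolding cell_def p by auto
  ultimately show ?case using insert by auto
qed

text \<open>
  Each point outside \<open>U\<close> is separated from \<open>x\<close> by a rational interval condition on one of the functions, and
  finitely many of these conditions suffice by compactness.
\<close>

lemma compact_separating_cell:
  assumes X: "compact_space X" and cont: "\<And>i. i \<in> I \<Longrightarrow> continuous_map X euclideanreal (\<phi> i)"
    and U: "openin X U" "x \<in> U"
    and sep: "\<And>y. y \<in> topspace X \<Longrightarrow> y \<noteq> x \<Longrightarrow> \<exists>i\<in>I. \<phi> i y \<noteq> \<phi> i x"
  obtains F where "finite F" "F \<subseteq> I \<times> UNIV" "x \<in> cell \<phi> X F" "cell \<phi> X F \<subseteq> U"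
proof -
  have xX: "x \<in> topspace X" using U openin_subset by blast
  have "\<exists>i a b D. i \<in> I \<and> openin X D \<and> y \<in> D \<and> of_rat a < \<phi> i x \<and> \<phi> i x < of_rat b \<and>
      (\<forall>z\<in>D. \<not> (of_rat a < \<phi> i z \<and> \<phi> i z < of_rat b))" if y: "y \<in> topspace X - U" for y
  proof -
    obtain i where i: "i \<in> I" "\<phi> i y \<noteq> \<phi> i x" using sep[of y] y U by auto
    obtain q where q: "of_rat q < \<phi> i x" using of_rat_dense[of "\<phi> i x - 1" "\<phi> i x"] by auto
    obtain r where r: "\<phi> i x < of_rat r" using of_rat_dense[of "\<phi> i x" "\<phi> i x + 1"] by auto
    show ?thesis
    proof (cases "\<phi> i x < \<phi> i y")
      case True
      then obtain c where c: "\<phi> i x < of_rat c" "of_rat c < \<phi> i y" using of_rat_dense by blast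
      have "openin X {z \<in> topspace X. \<phi> i z \<in> {of_rat c<..}}"
        using cont[OF i(1)] by (rule openin_continuous_map_preimage) auto
      then show ?thesis using i(1) q c y
        by (intro exI[of _ i] exI[of _ q] exI[of _ c] exI[of _ "{z \<in> topspace X. \<phi> i z \<in> {of_rat c<..}}"]) auto
    next
      case False
      then have "\<phi> i y < \<phi> i x" using i(2) by simp
      then obtain c where c: "\<phi> i y < of_rat c" "of_rat c < \<phi> i x" using of_rat_dense by blast
      have "openin X {z \<in> topspace X. \<phi> i z \<in> {..<of_rat c}}"
        using cont[OF i(1)] by (rule openin_continuous_map_preimage) auto
      then show ?thesis using i(1) r c y
        by (intro exI[of _ i] exI[of _ c] exI[of _ r] exI[of _ "{z \<in> topspace X. \<phi> i z \<in> {..<of_rat c}}"]) auto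
    qed
  qed
  then obtain i a b D where D: "\<And>y. y \<in> topspace X - U \<Longrightarrow> i y \<in> I \<and> openin X (D y) \<and> y \<in> D y \<and>
      of_rat (a y) < \<phi> (i y) x \<and> \<phi> (i y) x < of_rat (b y) \<and>
      (\<forall>z\<in>D y. \<not> (of_rat (a y) < \<phi> (i y) z \<and> \<phi> (i y) z < of_rat (b y)))"
    by metis
  have "compactin X (topspace X - U)"
    using X U(1) by (intro closedin_compact_space) auto
  moreover have "\<And>W. W \<in> D ` (topspace X - U) \<Longrightarrow> openin X W" "topspace X - U \<subseteq> \<Union> (D ` (topspace X - U))"
    using D by auto
  ultimately obtain \<F> where F: "finite \<F>" "\<F> \<subseteq> D ` (topspace X - U)" "topspace X - U \<subseteq> \<Union> \<F>"
    unfolding compactin_def by meson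
  obtain Y where Y: "Y \<subseteq> topspace X - U" "finite Y" "\<F> = D ` Y"
    using F(1,2) by (meson finite_subset_image)
  let ?F = "(\<lambda>y. (i y, a y, b y)) ` Y"
  have "cell \<phi> X ?F \<subseteq> U"
  proof
    fix z assume z: "z \<in> cell \<phi> X ?F"
    show "z \<in> U"
    proof (rule ccontr)
      assume "z \<notin> U"
      then obtain y where "y \<in> Y" "z \<in> D y" using z F(3) Y(3) unfolding cell_def by auto
      then show False using z D[of y] Y(1) unfolding cell_def by fastforce
    qed
  qed
  moreover have "x \<in> cell \<phi> X ?F" "?F \<subseteq> I \<times> UNIV" using D Y(1) xX unfolding cell_def by auto
  ultimately show thesis using that[of ?F] Y(2) by blast
qed

lemma Hausdorff_if_separated:
  assumes cont: "\<And>i. i \<in> I \<Longrightarrow> continuous_map X euclideanreal (\<phi> i)"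
    and sep: "\<And>x y. x \<in> topspace X \<Longrightarrow> y \<in> topspace X \<Longrightarrow> y \<noteq> x \<Longrightarrow> \<exists>i\<in>I. \<phi> i y \<noteq> \<phi> i x"
  shows "Hausdorff_space X"
  unfolding Hausdorff_space_def
proof (intro allI impI)
  fix x y assume xy: "x \<in> topspace X \<and> y \<in> topspace X \<and> x \<noteq> y"
  then obtain i where i: "i \<in> I" "\<phi> i x \<noteq> \<phi> i y" using sep[of x y] by metis
  obtain A B where AB: "open A" "open B" "\<phi> i x \<in> A" "\<phi> i y \<in> B" "A \<inter> B = {}"
    using hausdorff[OF i(2)] by blast
  show "\<exists>U V. openin X U \<and> openin X V \<and> x \<in> U \<and> y \<in> V \<and> disjnt U V"
    using xy AB cont[OF i(1)]
    by (intro exI[of _ "{z \<in> topspace X. \<phi> i z \<in> A}"] exI[of _ "{z \<in> topspace X. \<phi> i z \<in> B}"])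
      (auto simp: disjnt_def intro!: openin_continuous_map_preimage)
qed

lemma card_of_Times_le_infinite:
  assumes "infinite A" "|B| \<le>o |A|" "|C| \<le>o |A|"
  shows "|B \<times> C| \<le>o |A|"
  using assms by (intro card_of_Times_ordLeq_infinite_Field[OF _ _ _ card_of_Card_order]) (simp_all add: Field_card_of)

lemma card_of_finite_subsets:
  assumes "infinite A"
  shows "|{F. finite F \<and> F \<subseteq> A}| \<le>o |A|"
proof -
  have le: "|{F. finite F \<and> F \<subseteq> A \<and> card F = n}| \<le>o |A|" for n
  proof (induction n)
    case 0
    have "{F. finite F \<and> F \<subseteq> A \<and> card F = 0} = {{}}" by auto
    moreover obtain a where "a \<in> A" using assms by fastforce
    ultimately show ?case by (intro card_of_ordLeqI[of "\<lambda>_. a"]) auto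
  next
    case (Suc n)
    let ?S = "{F. finite F \<and> F \<subseteq> A \<and> card F = n}"
    have "{F. finite F \<and> F \<subseteq> A \<and> card F = Suc n} \<subseteq> (\<lambda>(a, F). insert a F) ` (A \<times> ?S)"
    proof
      fix F assume "F \<in> {F. finite F \<and> F \<subseteq> A \<and> card F = Suc n}"
      then obtain a G where "F = insert a G" "a \<notin> G" "card G = n" "finite G" "F \<subseteq> A"
        by (auto simp: card_Suc_eq)
      then show "F \<in> (\<lambda>(a, F). insert a F) ` (A \<times> ?S)" by (auto intro!: image_eqI[of _ _ "(a, G)"])
    qed
    then have "|{F. finite F \<and> F \<subseteq> A \<and> card F = Suc n}| \<le>o |(\<lambda>(a, F). insert a F) ` (A \<times> ?S)|"
      by (rule card_of_mono1)
    also have "|(\<lambda>(a, F). insert a F) ` (A \<times> ?S)| \<le>o |A \<times> ?S|" by (rule card_of_image)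
    also have "|A \<times> ?S| \<le>o |A|"
      by (rule card_of_Times_le_infinite[OF assms card_of_mono1[OF subset_refl] Suc.IH])
    finally show ?case .
  qed
  have "|\<Union>n\<in>(UNIV::nat set). {F. finite F \<and> F \<subseteq> A \<and> card F = n}| \<le>o |A|"
    using assms le by (intro card_of_UNION_ordLeq_infinite) (auto simp: infinite_iff_card_of_nat)
  moreover have "(\<Union>n\<in>(UNIV::nat set). {F. finite F \<and> F \<subseteq> A \<and> card F = n}) = {F. finite F \<and> F \<subseteq> A}" by auto
  ultimately show ?thesis by simp
qed

lemma base_of_iff:
  "base_of X \<B> \<longleftrightarrow> (\<forall>V\<in>\<B>. openin X V) \<and> (\<forall>U x. openin X U \<longrightarrow> x \<in> U \<longrightarrow> (\<exists>V\<in>\<B>. x \<in> V \<and> V \<subseteq> U))"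
  unfolding base_of_def openin_topology_base_unique by meson

lemma weight_le_separating:
  assumes X: "compact_space X" and cont: "\<And>i. i \<in> I \<Longrightarrow> continuous_map X euclideanreal (\<phi> i)"
    and sep: "\<And>x y. x \<in> topspace X \<Longrightarrow> y \<in> topspace X \<Longrightarrow> y \<noteq> x \<Longrightarrow> \<exists>i\<in>I. \<phi> i y \<noteq> \<phi> i x"
    and "infinite I"
  shows "weight X \<le>o |I|"
proof -
  let ?J = "I \<times> (UNIV::(rat \<times> rat) set)"
  let ?B = "cell \<phi> X ` {F. finite F \<and> F \<subseteq> ?J}"
  have "base_of X ?B"
    unfolding base_of_iff
  proof (intro conjI allI impI ballI)
    fix V assume "V \<in> ?B"
    then obtain F where "finite F" "F \<subseteq> ?J" "V = cell \<phi> X F" by blast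
    then show "openin X V" using openin_cell[OF \<open>finite F\<close> \<open>F \<subseteq> ?J\<close> cont] by simp
  next
    fix U x assume Ux: "openin X U" "x \<in> U"
    then have xX: "x \<in> topspace X" using openin_subset by blast
    obtain F where "finite F" "F \<subseteq> ?J" "x \<in> cell \<phi> X F" "cell \<phi> X F \<subseteq> U"
      by (rule compact_separating_cell[OF X cont Ux, of I]) (use sep[OF xX] in auto)
    then show "\<exists>V\<in>?B. x \<in> V \<and> V \<subseteq> U" by blast
  qed
  then have "weight X \<le>o |?B|" by (rule weight_least)
  also have "|?B| \<le>o |{F. finite F \<and> F \<subseteq> ?J}|" by (rule card_of_image)
  also have "|{F. finite F \<and> F \<subseteq> ?J}| \<le>o |?J|"
    using \<open>infinite I\<close> by (intro card_of_finite_subsets) (auto simp: finite_cartesian_product_iff)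
  also have "|?J| \<le>o |I|"
  proof -
    have "|UNIV::(rat \<times> rat) set| \<le>o |UNIV::nat set|"
      using countableE[of "UNIV::(rat \<times> rat) set"] card_of_ordLeqI[of _ UNIV UNIV] by (metis UNIV_I countableI_type)
    then have "|UNIV::(rat \<times> rat) set| \<le>o |I|"
      using \<open>infinite I\<close> infinite_iff_card_of_nat ordLeq_transitive by blast
    then show ?thesis
      by (rule card_of_Times_le_infinite[OF \<open>infinite I\<close> card_of_mono1[OF subset_refl]])
  qed
  finally show ?thesis .
qed

lemma first_countable_if_separated:
  assumes X: "compact_space X"
    and cont: "\<And>i. i \<in> I \<Longrightarrow> continuous_map X euclideanreal (\<phi> i)"
    and sep: "\<And>x. x \<in> topspace X \<Longrightarrow> \<exists>C\<subseteq>I. countable C \<and> (\<forall>y\<in>topspace X. y \<noteq> x \<longrightarrow> (\<exists>i\<in>C. \<phi> i y \<noteq> \<phi> i x))"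
  shows "first_countable X"
  unfolding first_countable_def
proof
  fix x assume "x \<in> topspace X"
  then obtain C where C: "C \<subseteq> I" "countable C" "\<And>y. y \<in> topspace X \<Longrightarrow> y \<noteq> x \<Longrightarrow> \<exists>i\<in>C. \<phi> i y \<noteq> \<phi> i x"
    using sep by meson
  let ?B = "cell \<phi> X ` {F. finite F \<and> F \<subseteq> C \<times> UNIV}"
  have "countable {F. finite F \<and> F \<subseteq> C \<times> (UNIV::(rat \<times> rat) set)}"
    using C(2) by (intro countable_Collect_finite_subset) auto
  moreover have "openin X V" if V: "V \<in> ?B" for V
  proof -
    obtain F where "finite F" "F \<subseteq> C \<times> UNIV" "V = cell \<phi> X F" using V by blast
    moreover have "continuous_map X euclideanreal (\<phi> i)" if "i \<in> C" for i using cont C(1) that by blast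
    ultimately show ?thesis using openin_cell[of F C X \<phi>] by simp
  qed
  moreover have "\<exists>V\<in>?B. x \<in> V \<and> V \<subseteq> U" if U: "openin X U" "x \<in> U" for U
  proof -
    obtain F where "finite F" "F \<subseteq> C \<times> UNIV" "x \<in> cell \<phi> X F" "cell \<phi> X F \<subseteq> U"
      by (rule compact_separating_cell[OF X _ U, of C \<phi>]) (use cont C in auto)
    then show ?thesis by blast
  qed
  ultimately show "\<exists>\<B>. countable \<B> \<and> (\<forall>V\<in>\<B>. openin X V) \<and> (\<forall>U. openin X U \<and> x \<in> U \<longrightarrow> (\<exists>V\<in>\<B>. x \<in> V \<and> V \<subseteq> U))"
    by (intro exI[of _ ?B]) auto
qed

lemma weight_ge_disjoint_opens:
  assumes open_U: "\<And>i. i \<in> I \<Longrightarrow> openin X (U i)" and nonempty: "\<And>i. i \<in> I \<Longrightarrow> U i \<noteq> {}"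
    and disj: "\<And>i j. i \<in> I \<Longrightarrow> j \<in> I \<Longrightarrow> i \<noteq> j \<Longrightarrow> U i \<inter> U j = {}"
  shows "|I| \<le>o weight X"
proof -
  obtain \<B> where B: "base_of X \<B>" "weight X = |\<B>|" using ex_base_weight by blast
  have "\<exists>V\<in>\<B>. V \<noteq> {} \<and> V \<subseteq> U i" if "i \<in> I" for i
    using B(1) open_U[OF that] nonempty[OF that]
    unfolding base_of_iff by (metis all_not_in_conv)
  then obtain V where V: "\<And>i. i \<in> I \<Longrightarrow> V i \<in> \<B> \<and> V i \<noteq> {} \<and> V i \<subseteq> U i" by metis
  have "inj_on V I"
  proof (rule inj_onI)
    fix i j assume "i \<in> I" "j \<in> I" "V i = V j"
    then show "i = j" using V[of i] V[of j] disj[of i j] by blast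
  qed
  moreover have "V ` I \<subseteq> \<B>" using V by blast
  ultimately show ?thesis using B(2) card_of_ordLeq by metis
qed

lemma homeomorphic_weight_le:
  assumes "X homeomorphic_space Y"
  shows "weight Y \<le>o weight X"
proof -
  obtain f g where fg: "homeomorphic_maps X Y f g" using assms unfolding homeomorphic_space_def by blast
  then have f: "homeomorphic_map X Y f" using homeomorphic_maps_map by blast
  obtain \<B> where B: "base_of X \<B>" "weight X = |\<B>|" using ex_base_weight by blast
  have openB: "\<And>V. V \<in> \<B> \<Longrightarrow> openin X V" and baseB: "\<And>U x. openin X U \<Longrightarrow> x \<in> U \<Longrightarrow> \<exists>V\<in>\<B>. x \<in> V \<and> V \<subseteq> U"
    using B(1) unfolding base_of_iff by blast+
  have "base_of Y ((`) f ` \<B>)"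
    unfolding base_of_iff
  proof (intro conjI allI impI ballI)
    fix V assume "V \<in> (`) f ` \<B>"
    then show "openin Y V" using f openB homeomorphic_imp_open_map open_map_def by blast
  next
    fix U y assume Uy: "openin Y U" "y \<in> U"
    let ?U = "{x \<in> topspace X. f x \<in> U}"
    have "openin X ?U"
      using f Uy homeomorphic_imp_continuous_map openin_continuous_map_preimage by blast
    moreover have "y \<in> f ` topspace X"
      using openin_subset[OF Uy(1)] Uy(2) homeomorphic_imp_surjective_map[OF f] by auto
    then obtain x where x: "x \<in> topspace X" "y = f x" by blast
    ultimately obtain V where "V \<in> \<B>" "x \<in> V" "V \<subseteq> ?U" using baseB[of ?U x] Uy by blast
    then show "\<exists>V\<in>(`) f ` \<B>. y \<in> V \<and> V \<subseteq> U" using x(2) by blast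
  qed
  from weight_least[OF this] card_of_image show ?thesis unfolding B(2) by (rule ordLeq_transitive)
qed

lemma homeomorphic_weight: "X homeomorphic_space Y \<Longrightarrow> weight X =o weight Y"
  unfolding ordIso_iff_ordLeq
  using homeomorphic_weight_le[of X Y] homeomorphic_weight_le[of Y X] homeomorphic_space_sym[of X Y] by metis

text \<open>
  A point of a Hausdorff space is determined by the members of a base that contain it, so the points can be
  replaced by subsets of a set whose size is the weight.
\<close>

lemma homeomorphic_copy:
  fixes X :: "'a topology" and \<kappa> :: "'k rel"
  assumes X: "Hausdorff_space X" and w: "weight X \<le>o \<kappa>"
  obtains Z :: "'k set topology" where "X homeomorphic_space Z"
proof -
  obtain \<B> where B: "base_of X \<B>" "weight X = |\<B>|" using ex_base_weight by blast
  have openB: "\<And>V. V \<in> \<B> \<Longrightarrow> openin X V" and baseB: "\<And>U x. openin X U \<Longrightarrow> x \<in> U \<Longrightarrow> \<exists>V\<in>\<B>. x \<in> V \<and> V \<subseteq> U"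
    using B(1) unfolding base_of_iff by blast+
  have "|\<B>| \<le>o |UNIV::'k set|"
    using w B(2) card_of_mono2[of "|\<B>|" \<kappa>] card_of_mono1[of "Field \<kappa>" UNIV]
    by (simp add: Field_card_of) (metis ordLeq_transitive)
  then obtain e :: "'a set \<Rightarrow> 'k" where e: "inj_on e \<B>" by (metis card_of_ordLeq)
  define \<phi> where "\<phi> x = e ` {U\<in>\<B>. x \<in> U}" for x
  have inj: "inj_on \<phi> (topspace X)"
  proof (rule inj_onI, rule ccontr)
    fix x y assume xy: "x \<in> topspace X" "y \<in> topspace X" "\<phi> x = \<phi> y" "x \<noteq> y"
    obtain U V where UV: "openin X U" "openin X V" "x \<in> U" "y \<in> V" "disjnt U V"
      using X[unfolded Hausdorff_space_def, rule_format, of x y] xy by auto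
    obtain W where W: "W \<in> \<B>" "x \<in> W" "W \<subseteq> U" using baseB[OF UV(1,3)] by blast
    have "{U\<in>\<B>. x \<in> U} = {U\<in>\<B>. y \<in> U}"
    proof (rule inj_on_image_eq_iff[OF e, THEN iffD1])
      show "e ` {U\<in>\<B>. x \<in> U} = e ` {U\<in>\<B>. y \<in> U}" using xy(3) by (simp only: \<phi>_def)
    qed auto
    then have "y \<in> W" using W by blast
    then show False using W UV unfolding disjnt_def by blast
  qed
  define \<psi> where "\<psi> = inv_into (topspace X) \<phi>"
  have inv: "\<And>x. x \<in> topspace X \<Longrightarrow> \<psi> (\<phi> x) = x" unfolding \<psi>_def using inj by (rule inv_into_f_f)
  let ?Z = "pullback_topology (\<phi> ` topspace X) \<psi> X"
  have top: "topspace ?Z = \<phi> ` topspace X"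
    unfolding topspace_pullback_topology using inv by auto
  have "homeomorphic_maps X ?Z \<phi> \<psi>"
    unfolding homeomorphic_maps_def
  proof (intro conjI ballI)
    show "continuous_map X ?Z \<phi>"
    proof (rule continuous_map_pullback')
      have "continuous_map X X (\<psi> \<circ> \<phi>)"
        by (rule continuous_map_eq[OF continuous_map_id]) (simp add: inv)
      then show "continuous_map X X (\<psi> \<circ> \<phi>)" .
    qed auto
    show "continuous_map ?Z X \<psi>"
      using continuous_map_pullback[OF continuous_map_id, of "\<phi> ` topspace X" \<psi> X] by simp
  qed (auto simp: top inv)
  then show thesis using that homeomorphic_space_def by blast
qed

lemma incomparableI:
  assumes "\<And>i j f. i \<in> I \<Longrightarrow> j \<in> I \<Longrightarrow> i \<noteq> j \<Longrightarrow> continuous_map (X i) (X j) f \<Longrightarrow> inj_on f (topspace (X i)) \<Longrightarrow> False"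
  shows "incomparable I X"
  unfolding incomparable_def
proof (intro ballI impI notI)
  fix i j assume ij: "i \<in> I" "j \<in> I" "i \<noteq> j"
  assume "\<exists>S. S \<subseteq> topspace (X j) \<and> X i homeomorphic_space subtopology (X j) S"
  then obtain S f g where "homeomorphic_maps (X i) (subtopology (X j) S) f g"
    unfolding homeomorphic_space_def by blast
  then have "homeomorphic_map (X i) (subtopology (X j) S) f" using homeomorphic_maps_map by blast
  then have "continuous_map (X i) (subtopology (X j) S) f" "inj_on f (topspace (X i))"
    using homeomorphic_imp_continuous_map homeomorphic_imp_injective_map by blast+
  then show False using assms[OF ij] continuous_map_into_fulltopology by blast
qed

section \<open>Topology and size of combs\<close>

lemma closed_graph_space: "closed (graph_space R V)"
proof -
  have eq: "closed {u::'a \<Rightarrow> real^3. u x = c}" for x c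
    by (intro closed_Collect_eq continuous_intros)
  have eq': "closed {u::'a \<Rightarrow> real^3. u y = - u x}" for x y
    by (intro closed_Collect_eq continuous_intros)
  have S2: "closed {u::'a \<Rightarrow> real^3. u x \<in> S2}" for x
    using closed_vimage[OF compact_imp_closed[OF compact_S2] continuous_on_coordinate[OF continuous_on_id]]
    by (simp add: vimage_def)
  show ?thesis unfolding graph_space_def
    by (intro closed_Collect_conj closed_Collect_all closed_Collect_imp closed_Collect_disj
        closed_Collect_const open_Collect_const eq eq' S2)
qed

lemma compact_comb:
  assumes "compact T" shows "compact (comb T B (\<lambda>b. graph_space (R b) V))"
proof -
  let ?K = "{w. \<forall>b. w b \<in> {u. \<forall>v. u v \<in> S2}}"
  let ?C = "{p. \<forall>b. snd p b = base_point \<or> (b \<in> B \<and> fst p = b \<and> snd p b \<in> graph_space (R b) V)}"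
  have "compact ?K" using compact_S2 by (intro compact_funset)
  then have K: "compact (T \<times> ?K)" using assms by (intro compact_Times)
  have g: "closed {p. snd p b \<in> graph_space (R b) V}" for b
    using closed_vimage[OF closed_graph_space continuous_on_snd_coordinate] by (simp add: vimage_def)
  have "closed ?C"
    by (intro closed_Collect_conj closed_Collect_all closed_Collect_disj
        closed_Collect_const closed_fst_eq closed_snd_eq_base_point g)
  then have "compact ((T \<times> ?K) \<inter> ?C)" using K by (rule compact_Int_closed[rotated])
  moreover have "comb T B (\<lambda>b. graph_space (R b) V) = (T \<times> ?K) \<inter> ?C"
  proof (intro equalityI subsetI)
    fix p assume p: "p \<in> comb T B (\<lambda>b. graph_space (R b) V)"
    have "snd p b v \<in> S2" for b v
    proof -
      consider "snd p b = base_point" | "snd p b \<in> graph_space (R b) V" using p unfolding comb_def by blast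
      then show ?thesis
      proof cases
        case 1 then show ?thesis by (simp add: base_point_def)
      next
        case 2 then show ?thesis by (rule graph_spaceD(1))
      qed
    qed
    then have "snd p \<in> ?K" by blast
    then show "p \<in> (T \<times> ?K) \<inter> ?C" using p unfolding comb_def Int_iff mem_Times_iff by blast
  next
    fix p assume "p \<in> (T \<times> ?K) \<inter> ?C"
    then show "p \<in> comb T B (\<lambda>b. graph_space (R b) V)" unfolding comb_def Int_iff mem_Times_iff by blast
  qed
  ultimately show ?thesis by simp
qed

lemma tooth_in_comb:
  "t \<in> T \<Longrightarrow> tooth t base_point \<in> comb T B Y"
  "b \<in> B \<Longrightarrow> B \<subseteq> T \<Longrightarrow> u \<in> Y b \<Longrightarrow> tooth b u \<in> comb T B Y"
  unfolding tooth_def comb_def by auto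

lemma comb_cases:
  assumes G: "\<And>b. b \<in> B \<Longrightarrow> simple_graph (R b) V"
    and p: "p \<in> comb T B (\<lambda>b. graph_space (R b) V)"
  obtains t where "t \<in> T" "p = tooth t base_point"
  | b x a e where "b \<in> B" "cone_adj (R b) V (Some x) a" "e \<in> S2" "p = tooth b (edge_sphere x a e)"
proof -
  have pt: "p = tooth (fst p) (snd p (fst p))" using comb_in_piece[OF p] unfolding in_piece_iff_tooth .
  show thesis
  proof (cases "snd p (fst p) = base_point")
    case True
    have "p = tooth (fst p) base_point" using pt unfolding True .
    moreover have "fst p \<in> T" using p unfolding comb_def by blast
    ultimately show thesis by (rule that(1)[rotated])
  next
    case False
    then have b: "fst p \<in> B" "snd p (fst p) \<in> graph_space (R (fst p)) V" using p unfolding comb_def by blast+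
    interpret H: simple_graph "R (fst p)" V using G b(1) .
    obtain x a where xa: "H.edge x a" "snd p (fst p) x \<in> S2" "snd p (fst p) = edge_sphere x a (snd p (fst p) x)"
      using H.graph_space_cases[OF b(2) False] by blast
    have "p = tooth (fst p) (edge_sphere x a (snd p (fst p) x))" by (rule trans[OF pt arg_cong[OF xa(3), of "tooth (fst p)"]])
    then show thesis by (rule that(2)[OF b(1) xa(1,2)])
  qed
qed

text \<open>
  A point on an edge sphere is joined within this sphere to a tip, from there within a sphere at the apex
  to the apex, and then within the base.
\<close>

lemma path_connected_comb:
  fixes R :: "('j \<Rightarrow> real) \<Rightarrow> 'v \<Rightarrow> 'v \<Rightarrow> bool"
  assumes G: "\<And>b. b \<in> B \<Longrightarrow> simple_graph (R b) V" and "B \<subseteq> T" and T: "path_connected T"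
  shows "path_connected (comb T B (\<lambda>b. graph_space (R b) V))"
proof (cases "T = {}")
  case True
  then show ?thesis by (simp add: comb_def)
next
  case False
  then obtain t0 where t0: "t0 \<in> T" by blast
  let ?C = "comb T B (\<lambda>b. graph_space (R b) V)"
  have conn: "path_component ?C p q" if "path_connected S" "S \<subseteq> ?C" "p \<in> S" "q \<in> S" for S p q
    using that path_component_of_subset unfolding path_connected_component by blast
  have base: "path_component ?C (tooth t base_point) (tooth t0 base_point)" if t: "t \<in> T" for t
  proof (rule conn)
    let ?f = "\<lambda>t. (t, \<lambda>_. base_point) :: ('j \<Rightarrow> real) \<times> (('j \<Rightarrow> real) \<Rightarrow> 'v \<Rightarrow> real^3)"
    have f: "?f t = tooth t base_point" for t unfolding tooth_def by (simp add: fun_eq_iff)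
    show "path_connected (?f ` T)"
      by (intro path_connected_continuous_image T continuous_on_Pair continuous_on_id continuous_on_const)
    show "?f ` T \<subseteq> ?C" unfolding f using tooth_in_comb(1) by blast
    show "tooth t base_point \<in> ?f ` T" "tooth t0 base_point \<in> ?f ` T" unfolding f using t t0 by blast+
  qed
  have sphere: "path_component ?C (tooth b (edge_sphere x a d)) (tooth b (edge_sphere x a e))"
    if b: "b \<in> B" "cone_adj (R b) V (Some x) a" "d \<in> S2" "e \<in> S2" for b x a d e
  proof (rule conn)
    interpret H: simple_graph "R b" V using G b(1) .
    show "path_connected (tooth b ` edge_sphere x a ` S2)"
      by (intro path_connected_continuous_image path_connected_S2 continuous_on_tooth continuous_on_edge_sphere)
    show "tooth b ` edge_sphere x a ` S2 \<subseteq> ?C"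
      using tooth_in_comb(2)[OF b(1) \<open>B \<subseteq> T\<close>, of _ "\<lambda>b. graph_space (R b) V"] H.edge_sphere_in_graph_space[OF b(2)] by blast
  qed (use b in auto)
  have all: "path_component ?C p (tooth t0 base_point)" if p: "p \<in> ?C" for p
  proof (rule comb_cases[OF G p])
    fix t assume 1: "t \<in> T" "p = tooth t base_point"
    show ?thesis unfolding 1(2) by (rule base[OF 1(1)])
  next
    fix b x a e
    assume 2: "b \<in> B" "cone_adj (R b) V (Some x) a" "e \<in> S2" "p = tooth b (edge_sphere x a e)"
    interpret H: simple_graph "R b" V using G 2(1) .
    have x: "cone_adj (R b) V (Some x) None" using H.edge_carrier(1)[OF 2(2)] by simp
    have "path_component ?C p (tooth b (edge_sphere x a (- pole)))"
      unfolding 2(4) by (rule sphere[OF 2(1,2,3)]) simp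
    also have "edge_sphere x a (- pole) = edge_sphere x None (- pole)"
      using edge_sphere_poles(1)[OF H.edge_distinct[OF 2(2)]] edge_sphere_poles(1)[of None x] by simp
    finally have "path_component ?C p (tooth b (edge_sphere x None (- pole)))" .
    moreover have "path_component ?C (tooth b (edge_sphere x None (- pole))) (tooth b base_point)"
      using sphere[OF 2(1) x, of "- pole" pole] edge_sphere_poles(2)[of None x] by (simp add: tip.simps)
    moreover have "path_component ?C (tooth b base_point) (tooth t0 base_point)"
      using base 2(1) \<open>B \<subseteq> T\<close> by blast
    ultimately show ?thesis using path_component_trans by blast
  qed
  show ?thesis
    unfolding path_connected_component
  proof (intro ballI)
    fix p q assume "p \<in> ?C" "q \<in> ?C"
    then show "path_component ?C p q" using path_component_trans[OF all path_component_sym[OF all]] by blast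
  qed
qed

text \<open>
  The real coordinates of a point of a comb.  Continuous functions that separate points control the
  weight of a compact space, and local bases in it.
\<close>

fun coord :: "'j + (('j \<Rightarrow> real) \<times> 'v \<times> 3) \<Rightarrow> ('j \<Rightarrow> real) \<times> (('j \<Rightarrow> real) \<Rightarrow> 'v \<Rightarrow> real^3) \<Rightarrow> real" where
  "coord (Inl j) p = fst p j"
| "coord (Inr (b, v, k)) p = snd p b v $ k"

lemma continuous_map_coord: "continuous_map (top_of_set S) euclideanreal (coord i)"
proof -
  have "continuous_on S (coord i)"
  proof (cases i)
    case (Inl j)
    then have "coord i = (\<lambda>p. fst p j)" by auto
    then show ?thesis using continuous_on_fst_coordinate[of S j] by simp
  next
    case (Inr q)
    obtain b v k where q: "q = (b, v, k)" by (cases q)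
    then have "coord i = (\<lambda>p. snd p b v $ k)" using Inr by auto
    then show ?thesis using continuous_on_component[OF continuous_on_snd_coordinate2] by simp
  qed
  then show ?thesis by simp
qed

text \<open>
  The index set depends on \<open>p\<close>: besides the coordinates of the base, only those of the space attached at
  the base position of \<open>p\<close> are needed.  This is what makes combs with many teeth first countable.
\<close>

lemma comb_coord_separate:
  assumes p: "p \<in> comb (cone_base N L) B (\<lambda>b. graph_space (R b) V)"
    and q: "q \<in> comb (cone_base N L) B (\<lambda>b. graph_space (R b) V)" and "q \<noteq> p"
  shows "\<exists>i\<in>(N \<times> L) <+> (({fst p} \<inter> B) \<times> V \<times> UNIV). coord i q \<noteq> coord i p"
proof (cases "fst p = fst q")
  case False
  then obtain j where j: "fst p j \<noteq> fst q j" by blast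
  have "fst p \<in> cone_base N L" "fst q \<in> cone_base N L" using p q unfolding comb_def by blast+
  then have "j \<in> N \<times> L" using j cone_baseD(3)[of "fst p" N L j] cone_baseD(3)[of "fst q" N L j] by metis
  then show ?thesis using j by (intro bexI[of _ "Inl j"]) auto
next
  case True
  then have "snd p \<noteq> snd q" using \<open>q \<noteq> p\<close> by (metis prod_eqI)
  then obtain b v where bv: "snd p b v \<noteq> snd q b v" by blast
  have "snd p b \<noteq> base_point \<or> snd q b \<noteq> base_point" using bv by auto
  then have b: "b \<in> B" "b = fst p" using p q True unfolding comb_def by force+
  have "snd p b \<in> graph_space (R b) V \<or> snd p b = base_point" "snd q b \<in> graph_space (R b) V \<or> snd q b = base_point"
    using p q unfolding comb_def by blast+
  then have "snd p b v \<noteq> pole \<Longrightarrow> v \<in> V" "snd q b v \<noteq> pole \<Longrightarrow> v \<in> V"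
    using graph_spaceD(2) unfolding base_point_def by fastforce+
  then have "v \<in> V" using bv by metis
  obtain k where "snd p b v $ k \<noteq> snd q b v $ k" using bv by (metis vec_eq_iff)
  then show ?thesis using b \<open>v \<in> V\<close> by (intro bexI[of _ "Inr (b, v, k)"]) auto
qed

lemma Hausdorff_comb: "Hausdorff_space (top_of_set (comb (cone_base N L) B (\<lambda>b. graph_space (R b) V)))"
proof (rule Hausdorff_if_separated[where I = UNIV and \<phi> = coord])
  fix x y
  assume "x \<in> topspace (top_of_set (comb (cone_base N L) B (\<lambda>b. graph_space (R b) V)))"
    "y \<in> topspace (top_of_set (comb (cone_base N L) B (\<lambda>b. graph_space (R b) V)))" "y \<noteq> x"
  then show "\<exists>i\<in>UNIV. coord i y \<noteq> coord i x" using comb_coord_separate[of x N L B R V y] by auto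
qed (rule continuous_map_coord)

lemma compact_space_comb:
  "compact_space (top_of_set (comb (cone_base N L) B (\<lambda>b. graph_space (R b) V)))"
  by (rule compact_space_subtopology) (simp add: compact_comb compact_cone_base)

lemma first_countable_comb:
  assumes "countable N" "countable L" "countable V"
  shows "first_countable (top_of_set (comb (cone_base N L) B (\<lambda>b. graph_space (R b) V)))"
proof (rule first_countable_if_separated[OF compact_space_comb, where I = UNIV and \<phi> = coord])
  fix x assume x: "x \<in> topspace (top_of_set (comb (cone_base N L) B (\<lambda>b. graph_space (R b) V)))"
  let ?C = "(N \<times> L) <+> (({fst x} \<inter> B) \<times> V \<times> (UNIV::3 set))"
  have "countable ({fst x} \<inter> B)" by (rule countable_subset[of _ "{fst x}"]) auto
  then have "countable ?C" using assms by (intro countable_Plus countable_SIGMA) auto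
  then show "\<exists>C\<subseteq>UNIV. countable C \<and> (\<forall>y\<in>topspace (top_of_set (comb (cone_base N L) B (\<lambda>b. graph_space (R b) V))).
      y \<noteq> x \<longrightarrow> (\<exists>i\<in>C. coord i y \<noteq> coord i x))"
    using comb_coord_separate[of x N L B R V] x by (intro exI[of _ ?C]) auto
qed (rule continuous_map_coord)

text \<open>
  The coordinates bound the weight from above; small neighbourhoods of the tips are disjoint open sets that
  bound it from below.
\<close>

lemma weight_comb:
  assumes G: "\<And>b. b \<in> B \<Longrightarrow> simple_graph (R b) V" and B: "B \<subseteq> cone_base N L"
    and inf: "infinite (B \<times> V)" and NL: "|N \<times> L| \<le>o |B \<times> V|"
  shows "weight (top_of_set (comb (cone_base N L) B (\<lambda>b. graph_space (R b) V))) =o |B \<times> V|"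
proof -
  let ?C = "comb (cone_base N L) B (\<lambda>b. graph_space (R b) V)"
  let ?I = "(N \<times> L) <+> (B \<times> V \<times> (UNIV::3 set))"
  have sep: "\<exists>i\<in>?I. coord i y \<noteq> coord i x"
    if xy: "x \<in> topspace (top_of_set ?C)" "y \<in> topspace (top_of_set ?C)" "y \<noteq> x" for x y
  proof -
    have "\<exists>i\<in>(N \<times> L) <+> (({fst x} \<inter> B) \<times> V \<times> UNIV). coord i y \<noteq> coord i x"
      using xy by (intro comb_coord_separate) auto
    then show ?thesis by blast
  qed
  have V3: "|B \<times> V \<times> (UNIV::3 set)| \<le>o |B \<times> V|"
  proof -
    have "|B \<times> V \<times> (UNIV::3 set)| \<le>o |(B \<times> V) \<times> (UNIV::3 set)|"
      by (rule card_of_ordLeqI[of "\<lambda>(b, v, k). ((b, v), k)"]) (auto simp: inj_on_def)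
    moreover have "|UNIV::3 set| \<le>o |B \<times> V|"
      using inf finite_ordLess_infinite[of "|UNIV::3 set|" "|B \<times> V|"]
      by (simp add: Field_card_of card_of_well_order_on ordLess_imp_ordLeq)
    ultimately show ?thesis
      using card_of_Times_le_infinite[OF inf card_of_mono1[OF subset_refl]] ordLeq_transitive by blast
  qed
  have "infinite ?I"
    using inf by (auto simp: finite_cartesian_product_iff)
  then have "weight (top_of_set ?C) \<le>o |?I|"
    using compact_space_comb sep by (intro weight_le_separating[where \<phi> = coord] continuous_map_coord)
  also have "|?I| \<le>o |B \<times> V|"
    using inf NL V3
    by (intro card_of_Plus_ordLeq_infinite_Field[OF _ _ _ card_of_Card_order]) (simp_all add: Field_card_of)
  finally have le: "weight (top_of_set ?C) \<le>o |B \<times> V|" .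
  \<comment> \<open>At \<open>pole\<close> the first component is 1, and antipodal points have first components of opposite signs.\<close>
  let ?U = "\<lambda>(b, v). {p \<in> ?C. snd p b v $ 1 < 0}"
  have pole1: "pole $ 1 = 1" unfolding pole_def by (simp add: axis_def)
  have "|B \<times> V| \<le>o weight (top_of_set ?C)"
  proof (rule weight_ge_disjoint_opens[where U = ?U])
    fix i assume "i \<in> B \<times> V"
    then obtain b v where i: "i = (b, v)" "b \<in> B" "v \<in> V" by blast
    have "openin (top_of_set ?C) {p \<in> topspace (top_of_set ?C). coord (Inr (b, v, 1)) p \<in> {..<0}}"
      by (rule openin_continuous_map_preimage[OF continuous_map_coord]) simp
    then show "openin (top_of_set ?C) (?U i)" by (simp add: i)
    interpret H: simple_graph "R b" V using G i(2) .
    have "edge_sphere v None (- pole) \<in> graph_space (R b) V" using i(3) by (intro H.edge_sphere_in_graph_space) simp_all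
    then have "tooth b (edge_sphere v None (- pole)) \<in> ?C" by (intro tooth_in_comb(2)[OF i(2) B])
    moreover have "snd (tooth b (edge_sphere v None (- pole))) b v $ 1 < 0"
      by (simp add: tooth_def edge_sphere_apply pole1)
    ultimately show "?U i \<noteq> {}" unfolding i by blast
  next
    fix i j assume ij: "i \<in> B \<times> V" "j \<in> B \<times> V" "i \<noteq> j"
    obtain b v where i: "i = (b, v)" by (cases i)
    obtain c w where j: "j = (c, w)" by (cases j)
    show "?U i \<inter> ?U j = {}"
    proof (rule ccontr)
      assume "?U i \<inter> ?U j \<noteq> {}"
      then obtain p where p: "p \<in> ?C" "snd p b v $ 1 < 0" "snd p c w $ 1 < 0" unfolding i j by auto
      have ne: "snd p b v \<noteq> pole" "snd p c w \<noteq> pole" using p(2,3) pole1 by auto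
      then have "snd p b \<noteq> base_point" "snd p c \<noteq> base_point" unfolding base_point_def by auto
      then have bc: "b = c" "snd p b \<in> graph_space (R b) V" using p(1) unfolding comb_def by blast+
      then have "v \<noteq> w" using ij(3) unfolding i j by blast
      then have "snd p b w = - snd p b v"
        using graph_spaceD(3)[OF bc(2), of v w] ne bc(1) by blast
      then show False using p(2,3) bc(1) by simp
    qed
  qed
  with le show ?thesis by (simp add: ordIso_iff_ordLeq)
qed

lemma card_Un_le:
  assumes "infinite C" "|A| \<le>o |C|" "|B| \<le>o |C|" shows "|A \<union> B| \<le>o |C|"
  using assms by (intro card_of_Un_ordLeq_infinite_Field[OF _ _ _ card_of_Card_order]) (simp_all add: Field_card_of)

lemma card_of_comb_le:
  assumes G: "\<And>b. b \<in> B \<Longrightarrow> simple_graph (R b) V"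
    and C: "infinite C" "|T| \<le>o |C|" "|B \<times> V| \<le>o |C|" "|S2| \<le>o |C|"
  shows "|comb T B (\<lambda>b. graph_space (R b) V)| \<le>o |C|"
proof -
  let ?f = "\<lambda>t. tooth t (base_point :: 'b \<Rightarrow> real^3)"
  let ?g = "\<lambda>((b, x), e). tooth b (edge_sphere x None e)"
  let ?h = "\<lambda>((b, x), ((c, y), e)). tooth b (edge_sphere x (Some y) e)"
  have "comb T B (\<lambda>b. graph_space (R b) V) \<subseteq> ?f ` T \<union> (?g ` ((B \<times> V) \<times> S2) \<union> ?h ` ((B \<times> V) \<times> ((B \<times> V) \<times> S2)))"
  proof
    fix p assume p: "p \<in> comb T B (\<lambda>b. graph_space (R b) V)"
    show "p \<in> ?f ` T \<union> (?g ` ((B \<times> V) \<times> S2) \<union> ?h ` ((B \<times> V) \<times> ((B \<times> V) \<times> S2)))" (is ?thesis)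
    proof (rule comb_cases[OF G p])
      fix t assume "t \<in> T" "p = tooth t base_point"
      then show ?thesis by blast
    next
      fix b x a e
      assume 2: "b \<in> B" "cone_adj (R b) V (Some x) a" "e \<in> S2" "p = tooth b (edge_sphere x a e)"
      interpret H: simple_graph "R b" V using G 2(1) .
      note x = H.edge_carrier(1)[OF 2(2)]
      show ?thesis
      proof (cases a)
        case None
        then have "p = ?g ((b, x), e)" using 2(4) by simp
        moreover have "((b, x), e) \<in> (B \<times> V) \<times> S2" using 2 x by simp
        ultimately show ?thesis by blast
      next
        case (Some y)
        have y: "y \<in> V" using H.edge_carrier(2) 2(2) Some by blast
        have "p = ?h ((b, x), ((b, y), e))" using 2(4) Some by simp
        moreover have "((b, x), ((b, y), e)) \<in> (B \<times> V) \<times> ((B \<times> V) \<times> S2)" using 2 x y by simp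
        ultimately show ?thesis by blast
      qed
    qed
  qed
  then have "|comb T B (\<lambda>b. graph_space (R b) V)| \<le>o |?f ` T \<union> (?g ` ((B \<times> V) \<times> S2) \<union> ?h ` ((B \<times> V) \<times> ((B \<times> V) \<times> S2)))|"
    by (rule card_of_mono1)
  also have "|?f ` T \<union> (?g ` ((B \<times> V) \<times> S2) \<union> ?h ` ((B \<times> V) \<times> ((B \<times> V) \<times> S2)))| \<le>o |C|"
    by (intro card_Un_le C(1) ordLeq_transitive[OF card_of_image] card_of_Times_le_infinite C)
  finally show ?thesis .
qed

lemma card_of_comb_ge:
  assumes G: "\<And>b. b \<in> B \<Longrightarrow> simple_graph (R b) V" and B: "B \<subseteq> T"
  shows "|T| \<le>o |comb T B (\<lambda>b. graph_space (R b) V)|" "|B \<times> V| \<le>o |comb T B (\<lambda>b. graph_space (R b) V)|"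
proof -
  show "|T| \<le>o |comb T B (\<lambda>b. graph_space (R b) V)|"
  proof (rule card_of_ordLeqI[of "\<lambda>t. tooth t base_point"])
    show "inj_on (\<lambda>t. tooth t (base_point :: 'b \<Rightarrow> real^3)) T" unfolding tooth_def by (intro inj_onI) simp
  qed (rule tooth_in_comb(1))
  show "|B \<times> V| \<le>o |comb T B (\<lambda>b. graph_space (R b) V)|"
  proof (rule card_of_ordLeqI[of "\<lambda>(b, v). tooth b (edge_sphere v None (- pole))"])
    have *: "v = w" if "edge_sphere v None (- pole) = edge_sphere w None (- pole)" for v w :: 'b
      using fun_cong[OF that, of v] by (auto simp: edge_sphere_apply split: if_splits)
    have fst_tooth: "fst (tooth b u) = b" "snd (tooth b u) b = u" for b and u :: "'b \<Rightarrow> real^3" by (simp_all add: tooth_def)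
    show "inj_on (\<lambda>(b, v). tooth b (edge_sphere v None (- pole))) (B \<times> V)"
      by (rule inj_onI) (auto dest: arg_cong[of _ _ fst] simp: fst_tooth intro: *, metis * fst_tooth)
    fix i assume "i \<in> B \<times> V"
    then obtain b v where i: "i = (b, v)" "b \<in> B" "v \<in> V" by blast
    interpret H: simple_graph "R b" V using G i(2) .
    have "edge_sphere v None (- pole) \<in> graph_space (R b) V" using i(3) by (intro H.edge_sphere_in_graph_space) simp_all
    then show "(\<lambda>(b, v). tooth b (edge_sphere v None (- pole))) i \<in> comb T B (\<lambda>b. graph_space (R b) V)"
      unfolding i(1) split_conv by (intro tooth_in_comb(2)[OF i(2) B])
  qed
qed

section \<open>Combs of coded graphs\<close>

context topped_wellorder
begin

lemma simple_graph_code_graph: "simple_graph (code_graph A) (W \<times> UNIV)"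
  using code_graph_sym code_graph_irrefl code_graph_carrier by unfold_locales blast+

lemma code_graph_degree: "x \<in> W \<times> UNIV \<Longrightarrow> \<exists>y. code_graph A x y"
  by (intro exI[of _ "(fst x, snd x + 1)"]) (auto simp: code_graph_def near_def)

definition code_comb :: "'n set \<Rightarrow> 'l set \<Rightarrow> ('n \<times> 'l \<Rightarrow> real) set \<Rightarrow> (('n \<times> 'l \<Rightarrow> real) \<Rightarrow> 'w set) \<Rightarrow>
    (('n \<times> 'l \<Rightarrow> real) \<times> (('n \<times> 'l \<Rightarrow> real) \<Rightarrow> 'w \<times> nat \<Rightarrow> real^3)) set" where
  "code_comb N L B A = comb (cone_base N L) B (\<lambda>b. graph_space (code_graph (A b)) (W \<times> UNIV))"

lemma code_comb_embedding:
  fixes N N' :: "'n set" and L L' :: "'l set"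
  assumes "B \<subseteq> cone_base N L" and A: "\<And>b. b \<in> B \<Longrightarrow> A b \<subseteq> W - {origin}"
    and cont: "continuous_map (top_of_set (code_comb N L B A)) (top_of_set (code_comb N' L' B' A')) f"
    and inj: "inj_on f (code_comb N L B A)" and b: "b \<in> B"
  shows "\<exists>b'\<in>B'. A b \<subseteq> A' b'"
proof -
  have "continuous_on (code_comb N L B A) f" "f ` code_comb N L B A \<subseteq> code_comb N' L' B' A'"
    using cont unfolding continuous_map_in_subtopology by auto
  then have "\<exists>b'\<in>B'. \<exists>g. inj_on g (insert None (Some ` (W \<times> UNIV))) \<and>
      (\<forall>a c. cone_adj (code_graph (A b)) (W \<times> UNIV) a c \<longrightarrow> cone_adj (code_graph (A' b')) (W \<times> UNIV) (g a) (g c))"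
    using inj unfolding code_comb_def
    by (intro comb_embedding_imp_cone_hom[where T = "cone_base N L" and T' = "cone_base N' L'" and f = f and B = B])
      (use assms(1) b simple_graph_code_graph code_graph_degree infinite_carrier no_S2_embedding_cone_base in auto)
  then obtain b' g where "b' \<in> B'" "inj_on g (insert None (Some ` (W \<times> UNIV)))"
    "\<And>a c. cone_adj (code_graph (A b)) (W \<times> UNIV) a c \<Longrightarrow> cone_adj (code_graph (A' b')) (W \<times> UNIV) (g a) (g c)"
    by blast
  then show ?thesis using cone_hom_imp_subset[of g "A b" "A' b'"] A[OF b] by blast
qed

lemma card_of_vertices: "|W \<times> (UNIV::nat set)| =o |W|"
  using infinite_carrier infinite_iff_card_of_nat card_of_Times_infinite[of W "UNIV::nat set"] by auto

lemma code_comb_space: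
  fixes A :: "('n \<times> 'l \<Rightarrow> real) \<Rightarrow> 'w set"
  assumes B: "B \<subseteq> cone_base N L" "B \<noteq> {}" and NL: "|N \<times> L| \<le>o |B \<times> W|"
  defines "X \<equiv> top_of_set (code_comb N L B A)"
  shows "path_connected_space X" "compact_space X" "Hausdorff_space X"
    "weight X =o |B \<times> W|" "countable N \<Longrightarrow> countable L \<Longrightarrow> countable W \<Longrightarrow> first_countable X"
    "|cone_base N L| \<le>o |topspace X|" "|B \<times> W| \<le>o |topspace X|"
    "infinite C \<Longrightarrow> |cone_base N L| \<le>o |C| \<Longrightarrow> |B \<times> W| \<le>o |C| \<Longrightarrow> |S2| \<le>o |C| \<Longrightarrow> |topspace X| \<le>o |C|"
proof -
  let ?V = "W \<times> (UNIV::nat set)"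
  have BV: "|B \<times> ?V| =o |B \<times> W|" using card_of_vertices by (simp add: ordIso_iff_ordLeq card_of_Times_mono2)
  have "path_connected (code_comb N L B A)"
    unfolding code_comb_def
    by (intro path_connected_comb simple_graph_code_graph B path_connected_cone_base)
  then show "path_connected_space X"
    unfolding X_def path_connected_space_def pathin_def path_connected_def path_def path_image_def
      pathstart_def pathfinish_def continuous_map_in_subtopology by (simp add: image_subset_iff_funcset)
  show "compact_space X" unfolding X_def code_comb_def by (rule compact_space_comb)
  show "Hausdorff_space X" unfolding X_def code_comb_def by (rule Hausdorff_comb)
  have "infinite (B \<times> ?V)" using B(2) infinite_carrier by (auto simp: finite_cartesian_product_iff)
  moreover have "|N \<times> L| \<le>o |B \<times> ?V|" using NL BV ordIso_symmetric ordLeq_ordIso_trans by blast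
  ultimately have "weight X =o |B \<times> ?V|"
    unfolding X_def code_comb_def by (intro weight_comb simple_graph_code_graph B)
  then show "weight X =o |B \<times> W|" using BV by (rule ordIso_transitive)
  show "countable N \<Longrightarrow> countable L \<Longrightarrow> countable W \<Longrightarrow> first_countable X"
    unfolding X_def code_comb_def by (intro first_countable_comb) auto
  have top: "topspace X = comb (cone_base N L) B (\<lambda>b. graph_space (code_graph (A b)) ?V)"
    unfolding X_def code_comb_def by simp
  show "|cone_base N L| \<le>o |topspace X|"
    unfolding top by (rule card_of_comb_ge(1)[OF simple_graph_code_graph B(1)])
  have "|B \<times> ?V| \<le>o |topspace X|"
    unfolding top by (rule card_of_comb_ge(2)[OF simple_graph_code_graph B(1)])
  then show "|B \<times> W| \<le>o |topspace X|" using BV ordIso_symmetric ordIso_ordLeq_trans by blast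
  assume C: "infinite C" "|cone_base N L| \<le>o |C|" "|B \<times> W| \<le>o |C|" "|S2| \<le>o |C|"
  then have "|B \<times> ?V| \<le>o |C|" using BV ordIso_ordLeq_trans by blast
  then show "|topspace X| \<le>o |C|"
    unfolding top using C by (intro card_of_comb_le simple_graph_code_graph)
qed

end

section \<open>Cardinal arithmetic\<close>

text \<open>
  Code \<open>S\<close> by the disjoint union of \<open>S\<close> and its complement in \<open>K\<close>.
\<close>

lemma antichain_codes:
  fixes K :: "'k set" and W :: "'w set"
  assumes "infinite W" "|K| \<le>o |W|"
  shows "\<exists>code :: 'k set \<Rightarrow> 'w set. (\<forall>S. code S \<subseteq> W) \<and>
    (\<forall>S S'. S \<subseteq> K \<longrightarrow> S' \<subseteq> K \<longrightarrow> code S \<subseteq> code S' \<longrightarrow> S = S') \<and> (\<forall>S. |K| \<le>o |code S| )"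
proof -
  have "|UNIV::bool set| \<le>o |W|"
    using assms(1) finite_ordLess_infinite[of "|UNIV::bool set|" "|W|"]
    by (simp add: Field_card_of card_of_well_order_on ordLess_imp_ordLeq)
  then have "|K \<times> (UNIV::bool set)| \<le>o |W|"
    using assms by (intro card_of_Times_le_infinite)
  then obtain e where e: "inj_on e (K \<times> (UNIV::bool set))" "e ` (K \<times> UNIV) \<subseteq> W"
    unfolding card_of_ordLeq[symmetric] by blast
  define sel where "sel S = (\<lambda>x. (x, x \<in> S)) ` K" for S
  have sel: "sel S \<subseteq> K \<times> UNIV" for S unfolding sel_def by blast
  show ?thesis
  proof (intro exI[of _ "\<lambda>S. e ` sel S"] conjI allI impI)
    fix S show "e ` sel S \<subseteq> W" using e(2) sel by blast
    show "|K| \<le>o |e ` sel S|"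
    proof (rule card_of_ordLeqI[of "\<lambda>x. e (x, x \<in> S)"])
      show "inj_on (\<lambda>x. e (x, x \<in> S)) K" using e(1) by (auto simp: inj_on_def)
    qed (auto simp: sel_def)
  next
    fix S S' assume S: "S \<subseteq> K" "S' \<subseteq> K" and "e ` sel S \<subseteq> e ` sel S'"
    then have "sel S \<subseteq> sel S'" using e(1) sel by (metis inj_on_image_subset_iff)
    then have "x \<in> S \<longleftrightarrow> x \<in> S'" if "x \<in> K" for x using that unfolding sel_def by blast
    then show "S = S'" using S by blast
  qed
qed

lemma card_of_Pow_Field: "|Pow (Field r)| =o ctwo ^c r"
  unfolding ctwo_def cexp_def Field_card_of by (rule card_of_Pow_Func)

lemma card_of_reals_nat_sets: "|UNIV::real set| =o |UNIV::nat set set|"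
  by (rule ordIso_symmetric[OF nat_sets_eqpoll_reals[unfolded eqpoll_iff_card_of_ordIso]])

lemma card_of_reals: "|UNIV::real set| =o continuum"
proof -
  note card_of_reals_nat_sets
  also have "|UNIV::nat set set| =o ctwo ^c |UNIV::nat set|"
    using card_of_Pow_Field[of "|UNIV::nat set|"] by (simp add: Field_card_of)
  also have "ctwo ^c |UNIV::nat set| =o continuum"
    by (rule cexp_cong2[OF card_of_nat Card_order_ctwo card_of_Card_order])
  finally show ?thesis .
qed

lemma infinite_reals: "infinite (UNIV::real set)"
  by (rule infinite_UNIV_char_0)

lemma card_of_S2: "|S2| \<le>o |UNIV::real set|"
proof -
  have "|S2| \<le>o |(UNIV::real set) \<times> (UNIV::real set) \<times> (UNIV::real set)|"
    by (rule card_of_ordLeqI[of "\<lambda>e. (e $ 1, e $ 2, e $ 3)"]) (auto simp: inj_on_def vec_eq_iff forall_3)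
  moreover have "|(UNIV::real set) \<times> (UNIV::real set) \<times> (UNIV::real set)| \<le>o |UNIV::real set|"
    by (intro card_of_Times_le_infinite infinite_reals card_of_mono1 subset_refl)
  ultimately show ?thesis by (rule ordLeq_transitive)
qed

lemma cone_base_unit:
  "|cone_base (UNIV::unit set) (UNIV::unit set)| =o |UNIV::real set|"
proof -
  have "|cone_base (UNIV::unit set) (UNIV::unit set)| \<le>o |UNIV::real set|"
    by (rule card_of_ordLeqI[of "\<lambda>t. t ((), ())"]) (auto simp: inj_on_def fun_eq_iff)
  moreover have "|{0..1::real}| \<le>o |cone_base (UNIV::unit set) (UNIV::unit set)|"
    by (rule card_of_ordLeqI[of "\<lambda>s _. s"]) (auto simp: inj_on_def fun_eq_iff intro!: cone_baseI)
  moreover have "|UNIV::real set| \<le>o |{0..1::real}|"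
    using closed_interval_eqpoll_reals[of 0 1] eqpoll_iff_card_of_ordIso ordIso_symmetric ordIso_imp_ordLeq
    by (metis zero_less_one)
  ultimately show ?thesis unfolding ordIso_iff_ordLeq using ordLeq_transitive by blast
qed

text \<open>
  A point of the cone is determined by its height and the partial function given by its support.
\<close>

lemma card_of_cone_base:
  assumes "infinite N" "infinite L"
  shows "|cone_base N L| =o |L| ^c |N|"
proof -
  let ?F = "Func N L"
  have eq: "|L| ^c |N| = |?F|" unfolding cexp_def by (simp add: Field_card_of)
  have two: "ctwo \<le>o |L|" using assms(2) by (intro ctwo_ordLeq_Cinfinite) (simp add: cinfinite_def Field_card_of card_of_card_order_on)
  have N: "Cinfinite |N|" using assms(1) by (simp add: cinfinite_def Field_card_of card_of_card_order_on)
  have "infinite ?F"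
    using cinfinite_cexp[OF two N] unfolding eq by (simp add: cinfinite_def Field_card_of)
  have "|UNIV::real set| \<le>o |?F|"
  proof -
    have "continuum \<le>o ctwo ^c |N|"
      using natLeq_ordLeq_cinfinite[OF N] Card_order_ctwo
      by (intro cexp_mono2_Cnotzero) (auto simp: Cinfinite_Cnotzero[OF natLeq_Cinfinite])
    also have "ctwo ^c |N| \<le>o |L| ^c |N|" using two card_of_Card_order by (rule cexp_mono1)
    finally show ?thesis using card_of_reals ordIso_ordLeq_trans unfolding eq by blast
  qed
  moreover have "|Func N (Some ` L \<union> {None})| \<le>o |?F|"
  proof -
    have "|Some ` L \<union> {None}| \<le>o |L|"
      using assms(2) finite_ordLess_infinite[of "|{None :: 'b option}|" "|L|"]
      by (intro card_Un_le card_of_image) (simp_all add: Field_card_of card_of_well_order_on ordLess_imp_ordLeq)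
    then have "|Some ` L \<union> {None}| ^c |N| \<le>o |L| ^c |N|" using card_of_Card_order by (rule cexp_mono1)
    then show ?thesis unfolding eq cexp_def by (simp add: Field_card_of)
  qed
  ultimately have up: "|(UNIV::real set) \<times> Func N (Some ` L \<union> {None})| \<le>o |?F|"
    using \<open>infinite ?F\<close> by (intro card_of_Times_le_infinite)
  let ?height = "\<lambda>t::'a \<times> 'b \<Rightarrow> real. if \<exists>j. t j \<noteq> 0 then t (SOME j. t j \<noteq> 0) else 0"
  let ?supp = "\<lambda>t n. if n \<in> N then (if \<exists>x. t (n, x) \<noteq> (0::real) then Some (SOME x. t (n, x) \<noteq> 0) else None) else undefined"
  have "|cone_base N L| \<le>o |(UNIV::real set) \<times> Func N (Some ` L \<union> {None})|"
  proof (rule card_of_ordLeqI[of "\<lambda>t. (?height t, ?supp t)"])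
    have height: "?height t = t j" if t: "t \<in> cone_base N L" "t j \<noteq> 0" for t j
    proof -
      have ex: "\<exists>j. t j \<noteq> 0" using t(2) by blast
      then have "t (SOME j. t j \<noteq> 0) \<noteq> 0" by (rule someI_ex)
      then have "t (SOME j. t j \<noteq> 0) = t j" using cone_baseD(4)[OF t(1)] t(2) by blast
      then show ?thesis using ex by (simp only: if_True)
    qed
    have supp: "?supp t n = Some x \<longleftrightarrow> t (n, x) \<noteq> 0" if t: "t \<in> cone_base N L" "n \<in> N" for t n x
    proof
      assume "t (n, x) \<noteq> 0"
      moreover from this have "t (n, SOME x. t (n, x) \<noteq> 0) \<noteq> 0" by (rule someI)
      ultimately have "(SOME x. t (n, x) \<noteq> 0) = x"
        using cone_baseD(5)[OF t(1), of "(n, x)" "(n, SOME x. t (n, x) \<noteq> 0)"] by force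
      then show "?supp t n = Some x" using \<open>t (n, x) \<noteq> 0\<close> t(2) by auto
    next
      assume "?supp t n = Some x"
      then have ex: "\<exists>y. t (n, y) \<noteq> 0" and x: "x = (SOME y. t (n, y) \<noteq> 0)"
        using t(2) by (auto split: if_splits)
      show "t (n, x) \<noteq> 0" unfolding x by (rule someI_ex[OF ex])
    qed
    show "inj_on (\<lambda>t. (?height t, ?supp t)) (cone_base N L)"
    proof (rule inj_onI)
      fix s t assume st: "s \<in> cone_base N L" "t \<in> cone_base N L" "(?height s, ?supp s) = (?height t, ?supp t)"
      then have h: "?height s = ?height t" and f: "?supp s = ?supp t" by (simp_all only: prod.inject)
      have "s (n, x) = t (n, x)" for n x
      proof (cases "n \<in> N")
        case True
        have "s (n, x) \<noteq> 0 \<longleftrightarrow> t (n, x) \<noteq> 0"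
          using supp[OF st(1) True, of x] supp[OF st(2) True, of x] fun_cong[OF f, of n] by metis
        then show ?thesis using height[OF st(1), of "(n, x)"] height[OF st(2), of "(n, x)"] h by metis
      next
        case False
        then have "s (n, x) = 0" "t (n, x) = 0" using cone_baseD(3)[OF st(1)] cone_baseD(3)[OF st(2)] by blast+
        then show ?thesis by simp
      qed
      then show "s = t" by (simp add: fun_eq_iff)
    qed
    fix t assume t: "t \<in> cone_base N L"
    have "?supp t \<in> Func N (Some ` L \<union> {None})"
      unfolding Func_def
    proof (intro CollectI conjI ballI allI impI)
      fix n assume n: "n \<in> N"
      show "?supp t n \<in> Some ` L \<union> {None}"
      proof (cases "?supp t n")
        case (Some x)
        then have "t (n, x) \<noteq> 0" using supp[OF t n] by blast
        then have "x \<in> L" using cone_baseD(3)[OF t] by blast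
        then show ?thesis using Some by blast
      qed blast
    qed simp
    then show "(?height t, ?supp t) \<in> (UNIV::real set) \<times> Func N (Some ` L \<union> {None})" by simp
  qed
  then have "|cone_base N L| \<le>o |?F|" using up ordLeq_transitive by blast
  moreover have "|?F| \<le>o |cone_base N L|"
  proof (rule card_of_ordLeqI[of "\<lambda>f (n, x). if n \<in> N \<and> f n = x then 1 else 0"])
    show "inj_on (\<lambda>f (n, x). if n \<in> N \<and> f n = x then 1 else (0::real)) ?F"
    proof (rule inj_onI)
      fix f g assume fg: "f \<in> ?F" "g \<in> ?F"
        "(\<lambda>(n, x). if n \<in> N \<and> f n = x then 1 else (0::real)) = (\<lambda>(n, x). if n \<in> N \<and> g n = x then 1 else 0)"
      have "f n = g n" for n
      proof (cases "n \<in> N")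
        case True
        then show ?thesis using fun_cong[OF fg(3), of "(n, f n)"] by (simp split: if_splits)
      next
        case False
        then show ?thesis using fg(1,2) unfolding Func_def by simp
      qed
      then show "f = g" by (rule ext)
    qed
    fix f assume "f \<in> ?F"
    then show "(\<lambda>(n, x). if n \<in> N \<and> f n = x then 1 else (0::real)) \<in> cone_base N L"
      by (intro cone_baseI) (auto simp: Func_def split: if_splits)
  qed
  ultimately show ?thesis unfolding eq ordIso_iff_ordLeq by blast
qed

section \<open>The families of incomparable spaces\<close>

lemma incomparable_copies:
  fixes \<kappa> :: "'k rel" and \<theta> :: "'t rel" and F :: "'k set \<Rightarrow> 'a topology"
  assumes F: "\<And>i. i \<in> I \<Longrightarrow> path_connected_space (F i) \<and> compact_space (F i) \<and> Hausdorff_space (F i) \<and>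
      weight (F i) =o \<kappa> \<and> |topspace (F i)| =o \<theta> \<and> (P \<longrightarrow> first_countable (F i))"
    and no_emb: "\<And>i j f. i \<in> I \<Longrightarrow> j \<in> I \<Longrightarrow> i \<noteq> j \<Longrightarrow> continuous_map (F i) (F j) f \<Longrightarrow> inj_on f (topspace (F i)) \<Longrightarrow> False"
  shows "\<exists>X :: 'k set \<Rightarrow> 'k set topology. incomparable I X \<and>
    (\<forall>i\<in>I. path_connected_space (X i) \<and> compact_space (X i) \<and> Hausdorff_space (X i) \<and>
      weight (X i) =o \<kappa> \<and> |topspace (X i)| =o \<theta> \<and> (P \<longrightarrow> first_countable (X i)))"
proof -
  have "\<exists>Z :: 'k set topology. F i homeomorphic_space Z" if i: "i \<in> I" for i
  proof -
    have "Hausdorff_space (F i)" "weight (F i) \<le>o \<kappa>" using F[OF i] ordIso_imp_ordLeq by blast+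
    then obtain Z :: "'k set topology" where "F i homeomorphic_space Z" by (rule homeomorphic_copy)
    then show ?thesis by blast
  qed
  then obtain X :: "'k set \<Rightarrow> 'k set topology" where X: "\<And>i. i \<in> I \<Longrightarrow> F i homeomorphic_space X i" by metis
  then obtain u v where uv: "\<And>i. i \<in> I \<Longrightarrow> homeomorphic_maps (F i) (X i) (u i) (v i)"
    unfolding homeomorphic_space_def by metis
  have maps: "continuous_map (F i) (X i) (u i)" "continuous_map (X i) (F i) (v i)"
    "inj_on (u i) (topspace (F i))" "inj_on (v i) (topspace (X i))" "bij_betw (u i) (topspace (F i)) (topspace (X i))"
    if "i \<in> I" for i
  proof -
    have 1: "homeomorphic_map (F i) (X i) (u i)" using uv[OF that] homeomorphic_maps_map by blast
    have 2: "homeomorphic_map (X i) (F i) (v i)" using uv[OF that] homeomorphic_maps_map homeomorphic_maps_sym by blast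
    show "continuous_map (F i) (X i) (u i)" "continuous_map (X i) (F i) (v i)"
      "inj_on (u i) (topspace (F i))" "inj_on (v i) (topspace (X i))"
      using 1 2 by (auto intro: homeomorphic_imp_continuous_map homeomorphic_imp_injective_map)
    then show "bij_betw (u i) (topspace (F i)) (topspace (X i))"
      unfolding bij_betw_def using homeomorphic_imp_surjective_map[OF 1] by blast
  qed
  have "incomparable I X"
  proof (rule incomparableI)
    fix i j f assume ij: "i \<in> I" "j \<in> I" "i \<noteq> j" and f: "continuous_map (X i) (X j) f" "inj_on f (topspace (X i))"
    have "continuous_map (F i) (F j) (v j \<circ> (f \<circ> u i))"
      using continuous_map_compose maps(1)[OF ij(1)] f(1) maps(2)[OF ij(2)] by metis
    moreover have "inj_on (f \<circ> u i) (topspace (F i))"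
      using maps(3,5)[OF ij(1)] f(2) by (auto simp: bij_betw_def intro: comp_inj_on)
    then have "inj_on (v j \<circ> (f \<circ> u i)) (topspace (F i))"
    proof (rule comp_inj_on)
      have "(f \<circ> u i) ` topspace (F i) \<subseteq> topspace (X j)"
        using maps(1)[OF ij(1)] f(1) continuous_map_compose continuous_map_image_subset_topspace by metis
      then show "inj_on (v j) ((f \<circ> u i) ` topspace (F i))" using maps(4)[OF ij(2)] inj_on_subset by blast
    qed
    ultimately show False using no_emb[OF ij] by blast
  qed
  moreover have "path_connected_space (X i) \<and> compact_space (X i) \<and> Hausdorff_space (X i) \<and>
      weight (X i) =o \<kappa> \<and> |topspace (X i)| =o \<theta> \<and> (P \<longrightarrow> first_countable (X i))" if i: "i \<in> I" for i
  proof (intro conjI impI)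
    note hom = X[OF i] and Fi = F[OF i]
    show "path_connected_space (X i)" using Fi homeomorphic_path_connected_space[OF hom] by blast
    show "compact_space (X i)" using Fi homeomorphic_compact_space[OF hom] by blast
    show "Hausdorff_space (X i)" using Fi homeomorphic_Hausdorff_space[OF hom] by blast
    show "weight (X i) =o \<kappa>" using Fi homeomorphic_weight[OF hom] ordIso_symmetric ordIso_transitive by blast
    show "|topspace (X i)| =o \<theta>"
      using Fi card_of_ordIsoI[OF maps(5)[OF i]] ordIso_symmetric ordIso_transitive by blast
    show "first_countable (X i)" if P using Fi that homeomorphic_space_first_countability[OF hom] by blast
  qed
  ultimately show ?thesis by blast
qed

text \<open>
  Points of \<open>K\<close> are coded twice: by points \<open>\<beta> x\<close> of the unit interval, where a space is to be attached, and by
  sets \<open>\<psi> x\<close> of natural numbers, which determine pairwise incomparable graph spaces to be attached there.  The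
  set of attached spaces runs through an antichain.
\<close>

lemma first_countable_family:
  fixes \<kappa> :: "'k rel"
  assumes \<kappa>: "Cinfinite \<kappa>" "\<kappa> \<le>o continuum"
  shows "\<exists>X :: 'k set \<Rightarrow> 'k set topology. incomparable (Pow (Field \<kappa>)) X \<and>
    (\<forall>i\<in>Pow (Field \<kappa>). path_connected_space (X i) \<and> compact_space (X i) \<and> Hausdorff_space (X i) \<and>
      weight (X i) =o \<kappa> \<and> |topspace (X i)| =o continuum \<and> first_countable (X i))"
proof -
  let ?K = "Field \<kappa>"
  have K: "infinite ?K" "|?K| =o \<kappa>" using \<kappa>(1) card_of_Field_ordIso unfolding cinfinite_def by blast+
  have KR: "|?K| \<le>o |UNIV::real set|"
    by (rule ordLeq_ordIso_trans[OF ordIso_ordLeq_trans[OF K(2) \<kappa>(2)] ordIso_symmetric[OF card_of_reals]])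
  obtain less where "topped_wellorder (UNIV::nat set) less" using ex_topped_wellorder[of "UNIV::nat set"] by auto
  then interpret N: topped_wellorder "UNIV::nat set" less .
  let ?T = "cone_base (UNIV::unit set) (UNIV::unit set)"
  have "|?K| \<le>o |?T|" by (rule ordLeq_ordIso_trans[OF KR ordIso_symmetric[OF cone_base_unit]])
  then obtain \<beta> where \<beta>: "inj_on \<beta> ?K" "\<beta> ` ?K \<subseteq> ?T" unfolding card_of_ordLeq[symmetric] by blast
  have "|?K| \<le>o |UNIV::nat set set|"
    by (rule ordLeq_ordIso_trans[OF KR card_of_reals_nat_sets])
  then obtain \<psi> :: "'k \<Rightarrow> nat set" where \<psi>: "inj_on \<psi> ?K" unfolding card_of_ordLeq[symmetric] by blast
  have "infinite (UNIV - {N.origin})" by simp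
  moreover from this have "|UNIV::nat set| \<le>o |UNIV - {N.origin}|" using infinite_iff_card_of_nat by blast
  ultimately obtain c :: "nat set \<Rightarrow> nat set" where c: "\<And>S. c S \<subseteq> UNIV - {N.origin}" "\<And>S S'. c S \<subseteq> c S' \<Longrightarrow> S = S'"
    using antichain_codes[of "UNIV - {N.origin}" "UNIV::nat set"] by auto
  obtain d where d: "\<And>S. d S \<subseteq> ?K" "\<And>S S'. S \<subseteq> ?K \<Longrightarrow> S' \<subseteq> ?K \<Longrightarrow> d S \<subseteq> d S' \<Longrightarrow> S = S'" "\<And>S. |?K| \<le>o |d S|"
    using antichain_codes[OF K(1) card_of_mono1[OF subset_refl]] by blast
  define A where "A b = c (\<psi> (inv_into ?K \<beta> b))" for b
  define B where "B i = \<beta> ` d i" for i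
  have A: "A (\<beta> x) = c (\<psi> x)" if "x \<in> ?K" for x unfolding A_def using \<beta>(1) that by simp
  define F where "F i = top_of_set (N.code_comb UNIV UNIV (B i) A)" for i
  have B: "B i \<subseteq> ?T" for i unfolding B_def using \<beta>(2) d(1) by blast
  have card_B: "|B i| =o |?K|" for i
  proof -
    have "inj_on \<beta> (d i)" using \<beta>(1) d(1) inj_on_subset by blast
    then have "|d i| =o |B i|" unfolding B_def using card_of_ordIsoI inj_on_imp_bij_betw by blast
    moreover have "|d i| =o |?K|" by (simp add: ordIso_iff_ordLeq d(3) card_of_mono1[OF d(1)])
    ultimately show ?thesis using ordIso_symmetric ordIso_transitive by blast
  qed
  have inf_B: "infinite (B i)" for i using card_B[of i] K(1) card_of_ordIso_finite by blast
  have card_BW: "|B i \<times> (UNIV::nat set)| =o \<kappa>" for i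
  proof -
    have "|B i \<times> (UNIV::nat set)| =o |B i|"
      using inf_B[of i] infinite_iff_card_of_nat card_of_Times_infinite[of "B i" "UNIV::nat set"] by auto
    then show ?thesis by (rule ordIso_transitive[OF ordIso_transitive[OF _ card_B] K(2)])
  qed
  have props: "path_connected_space (F i) \<and> compact_space (F i) \<and> Hausdorff_space (F i) \<and>
      weight (F i) =o \<kappa> \<and> |topspace (F i)| =o continuum \<and> first_countable (F i)" for i
  proof -
    have ne: "B i \<noteq> {}" using inf_B[of i] by auto
    have "|(UNIV::unit set) \<times> (UNIV::unit set)| \<le>o |B i \<times> (UNIV::nat set)|"
      using ne by (intro card_of_ordLeqI[of "\<lambda>_. (SOME b. b \<in> B i, 0)"]) (auto simp: inj_on_def some_in_eq)
    note P = N.code_comb_space[OF B ne this, where A = A, folded F_def]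
    have BR: "|B i \<times> (UNIV::nat set)| \<le>o |UNIV::real set|"
      using card_BW[of i] \<kappa>(2) card_of_reals ordIso_ordLeq_trans ordLeq_ordIso_trans ordIso_symmetric by metis
    have "|topspace (F i)| \<le>o |UNIV::real set|"
      using P(8)[OF infinite_reals _ BR card_of_S2] cone_base_unit ordIso_imp_ordLeq by metis
    moreover have "|UNIV::real set| \<le>o |topspace (F i)|"
      using P(6) cone_base_unit ordIso_symmetric ordIso_ordLeq_trans by metis
    ultimately have "|topspace (F i)| =o |UNIV::real set|" by (simp add: ordIso_iff_ordLeq)
    then have "|topspace (F i)| =o continuum" using card_of_reals by (rule ordIso_transitive)
    moreover have "weight (F i) =o \<kappa>" using P(4) card_BW ordIso_transitive by metis
    ultimately show ?thesis using P(1,2,3,5) by simp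
  qed
  have no_emb: False if ij: "i \<in> Pow ?K" "j \<in> Pow ?K" "i \<noteq> j" and f: "continuous_map (F i) (F j) f" "inj_on f (topspace (F i))"
    for i j f
  proof -
    have "d i \<subseteq> d j"
    proof
      fix x assume x: "x \<in> d i"
      then have xK: "x \<in> ?K" using d(1) by blast
      have "\<exists>b'\<in>B j. A (\<beta> x) \<subseteq> A b'"
      proof (rule N.code_comb_embedding[OF B])
        show "A b \<subseteq> UNIV - {N.origin}" for b unfolding A_def by (rule c(1))
        show "continuous_map (top_of_set (N.code_comb UNIV UNIV (B i) A)) (top_of_set (N.code_comb UNIV UNIV (B j) A)) f"
          using f(1) unfolding F_def .
        show "inj_on f (N.code_comb UNIV UNIV (B i) A)" using f(2) unfolding F_def by simp
        show "\<beta> x \<in> B i" unfolding B_def using x by blast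
      qed
      then obtain y where y: "y \<in> d j" "A (\<beta> x) \<subseteq> A (\<beta> y)" unfolding B_def by blast
      then have yK: "y \<in> ?K" using d(1) by blast
      then have "\<psi> x = \<psi> y" using y(2) A[OF xK] A[OF yK] c(2) by simp
      then show "x \<in> d j" using \<psi> xK yK y(1) by (metis inj_onD)
    qed
    then show False using d(2)[of i j] ij by blast
  qed
  show ?thesis by (rule incomparable_copies[where P = True and F = F, unfolded simp_thms, OF props no_emb])
qed

text \<open>
  One graph space on \<open>\<kappa>\<close> vertices, attached at the vertex of the cone.
\<close>

lemma large_family:
  fixes \<kappa> :: "'k rel" and N :: "'n set" and L :: "'l set" and \<theta> :: "'t rel"
  assumes \<kappa>: "Cinfinite \<kappa>" and NL: "|N \<times> L| \<le>o \<kappa>" and \<theta>: "Card_order \<theta>" "\<kappa> \<le>o \<theta>" "continuum \<le>o \<theta>" "|cone_base N L| \<le>o \<theta>"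
    and size: "\<theta> \<le>o |cone_base N L| \<or> \<theta> =o \<kappa>"
  shows "\<exists>X :: 'k set \<Rightarrow> 'k set topology. incomparable (Pow (Field \<kappa>)) X \<and>
    (\<forall>i\<in>Pow (Field \<kappa>). path_connected_space (X i) \<and> compact_space (X i) \<and> Hausdorff_space (X i) \<and>
      weight (X i) =o \<kappa> \<and> |topspace (X i)| =o \<theta>)"
proof -
  let ?K = "Field \<kappa>"
  have K: "infinite ?K" "|?K| =o \<kappa>" using \<kappa>(1) card_of_Field_ordIso unfolding cinfinite_def by blast+
  have \<Theta>: "|Field \<theta>| =o \<theta>" using \<theta>(1) by (rule card_of_Field_ordIso)
  obtain less where "topped_wellorder ?K less" using ex_topped_wellorder[OF K(1)] by auto
  then interpret N: topped_wellorder ?K less .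
  have inf: "infinite (?K - {N.origin})" using K(1) by simp
  have "|?K| \<le>o |?K - {N.origin}|"
  proof -
    obtain b where "b \<in> ?K - {N.origin}" using inf by (metis all_not_in_conv finite.emptyI)
    then have "|{N.origin}| \<le>o |?K - {N.origin}|" by (intro card_of_ordLeqI[of "\<lambda>_. b"]) auto
    then have "|(?K - {N.origin}) \<union> {N.origin}| \<le>o |?K - {N.origin}|"
      by (rule card_Un_le[OF inf card_of_mono1[OF subset_refl]])
    moreover have "|?K| \<le>o |(?K - {N.origin}) \<union> {N.origin}|" by (rule card_of_mono1) blast
    ultimately show ?thesis by (rule ordLeq_transitive[rotated])
  qed
  from antichain_codes[OF inf this] obtain c where C: "(\<forall>S. c S \<subseteq> ?K - {N.origin}) \<and>
    (\<forall>S S'. S \<subseteq> ?K \<longrightarrow> S' \<subseteq> ?K \<longrightarrow> c S \<subseteq> c S' \<longrightarrow> S = S') \<and> (\<forall>S. |?K| \<le>o |c S| )" ..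
  have c: "c S \<subseteq> ?K - {N.origin}" for S using C by simp
  have c_inj: "S = S'" if "S \<subseteq> ?K" "S' \<subseteq> ?K" "c S \<subseteq> c S'" for S S' using C that by simp
  let ?z = "(\<lambda>_. 0) :: 'n \<times> 'l \<Rightarrow> real"
  let ?B = "{?z}"
  define F where "F i = top_of_set (N.code_comb N L ?B (\<lambda>_. c i))" for i
  have B: "?B \<subseteq> cone_base N L" using zero_in_cone_base by blast
  have card_BW: "|?B \<times> ?K| =o \<kappa>"
  proof -
    have "bij_betw (\<lambda>x. (?z, x)) ?K (?B \<times> ?K)" by (auto simp: bij_betw_def inj_on_def)
    then have "|?K| =o |?B \<times> ?K|" by (rule card_of_ordIsoI)
    then show ?thesis using K(2) ordIso_symmetric ordIso_transitive by metis
  qed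
  have props: "path_connected_space (F i) \<and> compact_space (F i) \<and> Hausdorff_space (F i) \<and>
      weight (F i) =o \<kappa> \<and> |topspace (F i)| =o \<theta>" for i
  proof -
    have "|N \<times> L| \<le>o |?B \<times> ?K|" using NL card_BW ordIso_symmetric ordLeq_ordIso_trans by metis
    note P = N.code_comb_space[OF B insert_not_empty this, where A = "\<lambda>_. c i", folded F_def]
    have 1: "|?B \<times> ?K| \<le>o |Field \<theta>|"
      using card_BW \<theta>(2) \<Theta> ordIso_symmetric ordIso_ordLeq_trans ordLeq_ordIso_trans by metis
    have 2: "|cone_base N L| \<le>o |Field \<theta>|" using \<theta>(4) \<Theta> ordIso_symmetric ordLeq_ordIso_trans by metis
    have "|UNIV::real set| \<le>o \<theta>" using card_of_reals \<theta>(3) ordIso_ordLeq_trans by metis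
    then have "|S2| \<le>o \<theta>" using card_of_S2 ordLeq_transitive by metis
    then have 3: "|S2| \<le>o |Field \<theta>|" using \<Theta> ordIso_symmetric ordLeq_ordIso_trans by metis
    have 4: "infinite (Field \<theta>)"
      using card_of_ordLeq_infinite[OF card_of_mono2[OF \<theta>(2)] K(1)] .
    have "|topspace (F i)| \<le>o |Field \<theta>|" by (rule P(8)[OF 4 2 1 3])
    then have le: "|topspace (F i)| \<le>o \<theta>" using \<Theta> ordLeq_ordIso_trans by metis
    have "\<theta> \<le>o |topspace (F i)|"
      using size
    proof
      assume "\<theta> \<le>o |cone_base N L|"
      then show ?thesis using P(6) by (rule ordLeq_transitive)
    next
      assume "\<theta> =o \<kappa>"
      then have "\<theta> =o |?B \<times> ?K|" by (rule ordIso_transitive[OF _ ordIso_symmetric[OF card_BW]])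
      then show ?thesis using P(7) by (rule ordIso_ordLeq_trans)
    qed
    with le have "|topspace (F i)| =o \<theta>" by (simp add: ordIso_iff_ordLeq)
    moreover have "weight (F i) =o \<kappa>" using P(4) card_BW ordIso_transitive by metis
    ultimately show ?thesis using P(1,2,3) by simp
  qed
  have no_emb: False if ij: "i \<in> Pow ?K" "j \<in> Pow ?K" "i \<noteq> j" and f: "continuous_map (F i) (F j) f" "inj_on f (topspace (F i))"
    for i j f
  proof -
    have "\<exists>b'\<in>?B. c i \<subseteq> c j"
    proof (rule N.code_comb_embedding[OF B])
      show "c i \<subseteq> ?K - {N.origin}" by (rule c)
      show "continuous_map (top_of_set (N.code_comb N L ?B (\<lambda>_. c i))) (top_of_set (N.code_comb N L ?B (\<lambda>_. c j))) f"
        using f(1) unfolding F_def .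
      show "inj_on f (N.code_comb N L ?B (\<lambda>_. c i))" using f(2) unfolding F_def by simp
      show "?z \<in> ?B" by simp
    qed
    then show False using c_inj[of i j] ij by blast
  qed
  show ?thesis by (rule incomparable_copies[where P = False and F = F, unfolded simp_thms, OF props no_emb])
qed

theorem theorem1:
  fixes \<kappa> :: "'k rel"
    and \<theta> :: "'t rel"
  assumes "Cinfinite \<kappa>"
  shows
    "(Card_order \<theta> \<and>
      (is_card_max \<theta> \<kappa> continuum \<or>
       (\<exists>l::'k rel. Cinfinite l \<and> l \<le>o \<kappa> \<and> \<theta> =o l ^c nu l \<kappa>)) \<longrightarrow>
      (\<exists>(I::'k set set) (X::'k set \<Rightarrow> 'k set topology).
         |I| =o ctwo ^c \<kappa> \<and> incomparable I X \<and>
         (\<forall>i\<in>I. path_connected_space (X i) \<and> compact_space (X i) \<and> Hausdorff_space (X i) \<and>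
                weight (X i) =o \<kappa> \<and> |topspace (X i)| =o \<theta>) \<and>
         (\<theta> =o continuum \<longrightarrow> (\<forall>i\<in>I. first_countable (X i))))) \<and>
     (\<forall>\<mu>::'k rel. Cinfinite \<mu> \<and> \<mu> \<le>o \<kappa> \<longrightarrow>
      (\<exists>(I::'k set set) (X::'k set \<Rightarrow> 'k set topology).
         |I| =o ctwo ^c \<kappa> \<and> incomparable I X \<and>
         (\<forall>i\<in>I. connected_space (X i) \<and> compact_space (X i) \<and> Hausdorff_space (X i) \<and>
                weight (X i) =o \<kappa> \<and> |topspace (X i)| =o \<kappa> ^c \<mu>)))"
proof -
  let ?I = "Pow (Field \<kappa>)"
  have K: "infinite (Field \<kappa>)" "|Field \<kappa>| =o \<kappa>"
    using assms card_of_Field_ordIso unfolding cinfinite_def by blast+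
  note I = card_of_Pow_Field[of \<kappa>]
  have power_family: "\<exists>X :: 'k set \<Rightarrow> 'k set topology. incomparable ?I X \<and>
      (\<forall>i\<in>?I. path_connected_space (X i) \<and> compact_space (X i) \<and> Hausdorff_space (X i) \<and>
        weight (X i) =o \<kappa> \<and> |topspace (X i)| =o t)"
    if l: "Cinfinite l" "l \<le>o \<kappa>" and m: "Cinfinite m" "m \<le>o \<kappa>" and t: "Card_order t" "t =o l ^c m" "\<kappa> \<le>o l ^c m"
    for l m :: "'k rel" and t :: "'s rel"
  proof -
    have inf: "infinite (Field m)" "infinite (Field l)" using l(1) m(1) unfolding cinfinite_def by blast+
    have "|Field m \<times> Field l| \<le>o \<kappa>"
    proof -
      have "|Field m| \<le>o |Field \<kappa>|" "|Field l| \<le>o |Field \<kappa>|" using l(2) m(2) card_of_mono2 by blast+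
      then have "|Field m \<times> Field l| \<le>o |Field \<kappa>|" using K(1) by (intro card_of_Times_le_infinite)
      then show ?thesis using K(2) ordLeq_ordIso_trans by metis
    qed
    moreover have T: "|cone_base (Field m) (Field l)| =o t"
    proof -
      have "|cone_base (Field m) (Field l)| =o |Field l| ^c |Field m|" by (rule card_of_cone_base[OF inf])
      moreover have "|Field l| ^c |Field m| = l ^c m" unfolding cexp_def by (simp add: Field_card_of)
      ultimately show ?thesis using t(2) ordIso_symmetric ordIso_transitive by metis
    qed
    moreover have "continuum \<le>o t"
    proof -
      have "continuum \<le>o ctwo ^c m"
        using natLeq_ordLeq_cinfinite[OF m(1)] Card_order_ctwo by (intro cexp_mono2_Cnotzero) (auto simp: Cinfinite_Cnotzero[OF natLeq_Cinfinite])
      also have "ctwo ^c m \<le>o l ^c m" using ctwo_ordLeq_Cinfinite[OF l(1)] m(1) by (intro cexp_mono1) auto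
      finally show ?thesis using t(2) ordIso_symmetric ordLeq_ordIso_trans by metis
    qed
    moreover have "\<kappa> \<le>o t" using t(2,3) ordIso_symmetric ordLeq_ordIso_trans by metis
    moreover have "|cone_base (Field m) (Field l)| \<le>o t" "t \<le>o |cone_base (Field m) (Field l)|"
      using T by (auto simp: ordIso_iff_ordLeq)
    ultimately show ?thesis
      using assms t(1) by (intro large_family[of \<kappa> "Field m" "Field l" t]) auto
  qed
  show ?thesis
  proof (intro conjI impI allI)
    assume \<theta>: "Card_order \<theta> \<and> (is_card_max \<theta> \<kappa> continuum \<or>
       (\<exists>l::'k rel. Cinfinite l \<and> l \<le>o \<kappa> \<and> \<theta> =o l ^c nu l \<kappa>))"
    have \<kappa>\<theta>: "\<kappa> \<le>o \<theta>"
    proof -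
      have "\<kappa> \<le>o \<theta>" if "Cinfinite l" "\<theta> =o l ^c nu l \<kappa>" for l :: "'k rel"
        using less_cexp_nu[OF that(1) assms] that(2) ordLess_imp_ordLeq ordIso_symmetric ordLeq_ordIso_trans by metis
      then show ?thesis using \<theta> unfolding is_card_max_def by blast
    qed
    show "\<exists>(I::'k set set) (X::'k set \<Rightarrow> 'k set topology).
         |I| =o ctwo ^c \<kappa> \<and> incomparable I X \<and>
         (\<forall>i\<in>I. path_connected_space (X i) \<and> compact_space (X i) \<and> Hausdorff_space (X i) \<and>
                weight (X i) =o \<kappa> \<and> |topspace (X i)| =o \<theta>) \<and>
         (\<theta> =o continuum \<longrightarrow> (\<forall>i\<in>I. first_countable (X i)))"
    proof (cases "\<theta> =o continuum")
      case True
      then have "\<kappa> \<le>o continuum" using \<kappa>\<theta> ordLeq_ordIso_trans by metis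
      then obtain X :: "'k set \<Rightarrow> 'k set topology" where X: "incomparable ?I X"
        "\<And>i. i \<in> ?I \<Longrightarrow> path_connected_space (X i) \<and> compact_space (X i) \<and> Hausdorff_space (X i) \<and>
          weight (X i) =o \<kappa> \<and> |topspace (X i)| =o continuum \<and> first_countable (X i)"
        using first_countable_family[OF assms] by auto
      have "|topspace (X i)| =o \<theta>" if "i \<in> ?I" for i
        using X(2)[OF that] True ordIso_symmetric ordIso_transitive by metis
      then show ?thesis using I X by (intro exI[of _ ?I] exI[of _ X]) blast
    next
      case False
      have "\<exists>X :: 'k set \<Rightarrow> 'k set topology. incomparable ?I X \<and>
        (\<forall>i\<in>?I. path_connected_space (X i) \<and> compact_space (X i) \<and> Hausdorff_space (X i) \<and>
          weight (X i) =o \<kappa> \<and> |topspace (X i)| =o \<theta>)"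
      proof (cases "is_card_max \<theta> \<kappa> continuum")
        case True
        then have max: "continuum \<le>o \<theta>" "\<theta> =o \<kappa>" using False unfolding is_card_max_def by blast+
        have "|(UNIV::unit set) \<times> (UNIV::unit set)| \<le>o |Field \<kappa>|"
        proof -
          obtain a where "a \<in> Field \<kappa>" using K(1) by fastforce
          then show ?thesis by (intro card_of_ordLeqI[of "\<lambda>_. a"]) (auto simp: inj_on_def)
        qed
        then have "|(UNIV::unit set) \<times> (UNIV::unit set)| \<le>o \<kappa>" using K(2) ordLeq_ordIso_trans by metis
        moreover have "|cone_base (UNIV::unit set) (UNIV::unit set)| =o continuum"
          using cone_base_unit card_of_reals by (rule ordIso_transitive)
        then have "|cone_base (UNIV::unit set) (UNIV::unit set)| \<le>o \<theta>" using max(1) ordIso_ordLeq_trans by metis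
        ultimately show ?thesis
          using assms \<theta> \<kappa>\<theta> max by (intro large_family[of \<kappa> "UNIV::unit set" "UNIV::unit set" \<theta>]) auto
      next
        case nomax: False
        then obtain l :: "'k rel" where l: "Cinfinite l" "l \<le>o \<kappa>" "\<theta> =o l ^c nu l \<kappa>" using \<theta> by blast
        have "nu l \<kappa> \<le>o \<kappa>"
        proof (rule nu_least[OF l(1) assms assms])
          have "\<kappa> <o ctwo ^c \<kappa>" using assms by (simp add: ordLess_ctwo_cexp)
          also have "ctwo ^c \<kappa> \<le>o l ^c \<kappa>" using l(1) assms by (simp add: cexp_mono1 ctwo_ordLeq_Cinfinite)
          finally (ordLess_ordLeq_trans) show "\<kappa> <o l ^c \<kappa>" .
        qed
        then show ?thesis
          using power_family[OF l(1,2) Cinfinite_nu[OF l(1) assms] _ _ l(3) ordLess_imp_ordLeq[OF less_cexp_nu[OF l(1) assms]]] \<theta>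
          by blast
      qed
      then show ?thesis using I False by blast
    qed
  next
    fix \<mu> :: "'k rel" assume \<mu>: "Cinfinite \<mu> \<and> \<mu> \<le>o \<kappa>"
    have "\<kappa> \<le>o \<kappa> ^c \<mu>" using \<mu> assms Cinfinite_Cnotzero by (intro ordLeq_cexp1) auto
    then have "\<exists>X :: 'k set \<Rightarrow> 'k set topology. incomparable ?I X \<and>
      (\<forall>i\<in>?I. path_connected_space (X i) \<and> compact_space (X i) \<and> Hausdorff_space (X i) \<and>
        weight (X i) =o \<kappa> \<and> |topspace (X i)| =o \<kappa> ^c \<mu>)"
      using \<mu> assms by (intro power_family[of \<kappa> \<mu>] Card_order_cexp ordIso_refl ordLeq_refl) auto
    then show "\<exists>(I::'k set set) (X::'k set \<Rightarrow> 'k set topology).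
         |I| =o ctwo ^c \<kappa> \<and> incomparable I X \<and>
         (\<forall>i\<in>I. connected_space (X i) \<and> compact_space (X i) \<and> Hausdorff_space (X i) \<and>
                weight (X i) =o \<kappa> \<and> |topspace (X i)| =o \<kappa> ^c \<mu>)"
      using I path_connected_imp_connected_space by blast
  qed
qed

end
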